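(* (Path Murnaghan–Nakayama Rule.) Let $\mu=(\mu_1,\dots,\mu_r)$ be a partition of $n$. Then $$\vec p_\mu=m(\mu)!\cdot\sum_T \mathrm{sign}(T)\cdot s_{\mathrm{shape}(T)},$$ where the sum is over all monotonic ribbon tilings $T$ whose ribbon sizes, read from west to east, form a rearrangement of $(\mu_1,\dots,\mu_r)$.
   Context: A ribbon is an edgewise connected skew shape containing no $2\times2$ square; its height is the number of rows it occupies minus one, its sign is $(-1)^{\text{height}}$, and its tail is its southwesternmost cell. A monotonic ribbon tiling $T$ of shape $\lambda$ is a decomposition of the Young diagram of $\lambda$ (English convention) into disjoint ribbons $\xi^{(1)},\dots,\xi^{(r)}$ such that the tails of $\xi^{(1)},\dots,\xi^{(r)}$ lie in distinct columns $c_1<\dots<c_r$, and each union $\xi^{(1)}\sqcup\cdots\sqcup\xi^{(i)}$, $0\le i\le r$, is the Young diagram of a partition. $\mathrm{shape}(T)=\lambda$ and $\mathrm{sign}(T)$ is the product of the signs of its ribbons. $m(\mu)!=\prod_i m_i(\mu)!$ with $m_i(\mu)$ the multiplicity of $i$ in $\mu$. The path power sum $\vec p_\mu=\sum_{\lambda\vdash n}a_\lambda p_\lambda$, where $a_\lambda$ counts permutations $w\in\mathfrak{S}_n$ of cycle type $\lambda$ with $w(i_t)=j_t$ for all $t$, for any pair $(I,J)$ of equal-length sequences of distinct elements of $[n]$ whose directed graph on $[n]$ (edges $i_t\to j_t$) is a disjoint union of directed paths with vertex counts $\mu_1,\dots,\mu_r$ (isolated vertices being one-vertex paths). $s_\lambda$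 is the Schur function. *)

theory Defs
  imports Complex_Main "HOL-Library.Multiset" "HOL-Library.FuncSet" "HOL-Combinatorics.Orbits"
begin

section \<open>Power series in the countably many variables \<open>x\<^sub>0, x\<^sub>1, \<dots>\<close>\<close>

text \<open>
  Symmetric functions are formal power series in infinitely many commuting variables. A monomial is
  the finite multiset of the indices of its variables, so that multiplication of monomials is
  addition of multisets, and a power series is its coefficient function. The ring of symmetric
  functions is a subring of this ring, and equality of symmetric functions is equality here.
\<close>

typedef 'a mvfps = "UNIV :: (nat multiset \<Rightarrow> 'a) set"
  morphisms mvcoeff Abs_mvfps ..

setup_lifting type_definition_mvfps

lemma mvfps_eqI: "(\<And>m. mvcoeff f m = mvcoeff g m) \<Longrightarrow> f = g"
  by transfer auto

definition msplits :: "nat multiset \<Rightarrow> (nat multiset \<times> nat multiset) set" where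
  "msplits m = {(a, b). a + b = m}"

lemma finite_submsets: "finite {a :: 'b multiset. a \<subseteq># m}"
proof (rule finite_subset)
  show "{a. a \<subseteq># m} \<subseteq> mset ` {xs. set xs \<subseteq> set_mset m \<and> length xs \<le> size m}"
  proof
    fix a assume a: "a \<in> {a. a \<subseteq># m}"
    obtain xs where xs: "mset xs = a" using ex_mset by blast
    have "set xs \<subseteq> set_mset m" "length xs \<le> size m"
      using a xs set_mset_mono[of a m] size_mset_mono[of a m] by auto
    then show "a \<in> mset ` {xs. set xs \<subseteq> set_mset m \<and> length xs \<le> size m}" using xs by blast
  qed
  show "finite (mset ` {xs. set xs \<subseteq> set_mset m \<and> length xs \<le> size m})"
    by (intro finite_imageI finite_lists_length_le) simp
qed

lemma finite_msplits: "finite (msplits m)"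
  by (rule finite_subset[of _ "{a. a \<subseteq># m} \<times> {a. a \<subseteq># m}"])
     (auto simp: msplits_def finite_submsets)

instantiation mvfps :: (comm_ring_1) comm_ring_1
begin

lift_definition zero_mvfps :: "'a mvfps" is "\<lambda>_. 0" .
lift_definition one_mvfps :: "'a mvfps" is "\<lambda>m. if m = {#} then 1 else 0" .
lift_definition plus_mvfps :: "'a mvfps \<Rightarrow> 'a mvfps \<Rightarrow> 'a mvfps" is "\<lambda>f g m. f m + g m" .
lift_definition minus_mvfps :: "'a mvfps \<Rightarrow> 'a mvfps \<Rightarrow> 'a mvfps" is "\<lambda>f g m. f m - g m" .
lift_definition uminus_mvfps :: "'a mvfps \<Rightarrow> 'a mvfps" is "\<lambda>f m. - f m" .
lift_definition times_mvfps :: "'a mvfps \<Rightarrow> 'a mvfps \<Rightarrow> 'a mvfps"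
  is "\<lambda>f g m. \<Sum>(a, b) \<in> msplits m. f a * g b" .

instance
proof
  fix f g h :: "'a mvfps"
  show "f + g + h = f + (g + h)" "f + g = g + f" "0 + f = f" "- f + f = 0" "f - g = f + - g"
    by (transfer; simp add: add_ac)+
  show "(f + g) * h = f * h + g * h"
    by transfer (simp add: sum.distrib distrib_right case_prod_beta)
  show "(0 :: 'a mvfps) \<noteq> 1"
    by transfer (metis one_neq_zero)
  show "f * g = g * f"
  proof (transfer, rule ext)
    fix f g :: "nat multiset \<Rightarrow> 'a" and m
    show "(\<Sum>(a, b) \<in> msplits m. f a * g b) = (\<Sum>(a, b) \<in> msplits m. g a * f b)"
      by (rule sum.reindex_bij_witness[of _ prod.swap prod.swap])
         (auto simp: msplits_def mult.commute add.commute)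
  qed
  show "1 * f = f"
  proof (transfer, rule ext)
    fix f :: "nat multiset \<Rightarrow> 'a" and m
    have "(\<Sum>(a, b) \<in> msplits m. (if a = {#} then 1 else 0) * f b)
        = (\<Sum>(a, b) \<in> {({#} :: nat multiset, m)}. (if a = {#} then 1 else 0) * f b)"
      by (rule sum.mono_neutral_right)
         (auto simp: msplits_def finite_msplits[unfolded msplits_def] split: if_splits)
    then show "(\<Sum>(a, b) \<in> msplits m. (if a = {#} then 1 else 0) * f b) = f m" by simp
  qed
  show "f * g * h = f * (g * h)"
  proof (transfer, rule ext)
    fix f g h :: "nat multiset \<Rightarrow> 'a" and m
    have "(\<Sum>(d, c) \<in> msplits m. (\<Sum>(a, b) \<in> msplits d. f a * g b) * h c)
        = (\<Sum>p \<in> msplits m. \<Sum>q \<in> msplits (fst p). f (fst q) * g (snd q) * h (snd p))"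
      by (simp add: case_prod_beta sum_distrib_right)
    also have "\<dots> = (\<Sum>(p, q) \<in> (SIGMA p:msplits m. msplits (fst p)).
        f (fst q) * g (snd q) * h (snd p))"
      by (rule sum.Sigma) (auto simp: finite_msplits)
    also have "\<dots> = (\<Sum>(p, q) \<in> (SIGMA p:msplits m. msplits (snd p)).
        f (fst p) * (g (fst q) * h (snd q)))"
      by (rule sum.reindex_bij_witness[of _
            "\<lambda>(p, q). ((fst p + fst q, snd q), (fst p, fst q))"
            "\<lambda>(p, q). ((fst q, snd q + snd p), (snd q, snd p))"])
         (auto simp: msplits_def add_ac mult_ac)
    also have "\<dots> = (\<Sum>p \<in> msplits m. \<Sum>q \<in> msplits (snd p). f (fst p) * (g (fst q) * h (snd q)))"
      by (rule sum.Sigma[symmetric]) (auto simp: finite_msplits)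
    also have "\<dots> = (\<Sum>(a, d) \<in> msplits m. f a * (\<Sum>(b, c) \<in> msplits d. g b * h c))"
      by (simp add: case_prod_beta sum_distrib_left)
    finally show "(\<Sum>(d, c) \<in> msplits m. (\<Sum>(a, b) \<in> msplits d. f a * g b) * h c)
        = (\<Sum>(a, d) \<in> msplits m. f a * (\<Sum>(b, c) \<in> msplits d. g b * h c))" .
  qed
qed

end

section \<open>Partitions, power sums and Schur functions\<close>

definition is_partition :: "nat list \<Rightarrow> bool" where
  "is_partition lam \<longleftrightarrow> sorted_wrt (\<ge>) lam \<and> 0 \<notin> set lam"

definition partitions_of :: "nat \<Rightarrow> nat list set" where
  "partitions_of n = {lam. is_partition lam \<and> sum_list lam = n}"

text \<open>English convention: a cell is a pair (row, column), both counted from 0, with row 0 on top.\<close>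

definition young_diagram :: "nat list \<Rightarrow> (nat \<times> nat) set" where
  "young_diagram lam = {(i, j). i < length lam \<and> j < lam ! i}"

lift_definition power_sum :: "nat \<Rightarrow> 'a :: comm_ring_1 mvfps"
  is "\<lambda>k m. if \<exists>i. m = replicate_mset k i then 1 else 0" .

definition power_sum_part :: "nat list \<Rightarrow> 'a :: comm_ring_1 mvfps" where
  "power_sum_part lam = prod_list (map power_sum lam)"

definition ssyt :: "nat list \<Rightarrow> (nat \<times> nat \<Rightarrow> nat) set" where
  "ssyt lam = {t \<in> extensional (young_diagram lam).
     (\<forall>i j j'. (i, j) \<in> young_diagram lam \<longrightarrow> (i, j') \<in> young_diagram lam \<longrightarrow> j < j'
        \<longrightarrow> t (i, j) \<le> t (i, j')) \<and>
     (\<forall>i i' j. (i, j) \<in> young_diagram lam \<longrightarrow> (i', j) \<in> young_diagram lam \<longrightarrow> i < i'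
        \<longrightarrow> t (i, j) < t (i', j))}"

text \<open>The sum over all semistandard tableaux of the product of the variables of its entries.\<close>

lift_definition schur :: "nat list \<Rightarrow> 'a :: comm_ring_1 mvfps"
  is "\<lambda>lam m. of_nat (card {t \<in> ssyt lam. image_mset t (mset_set (young_diagram lam)) = m})" .

section \<open>Path power sums\<close>

definition cycle_type :: "nat \<Rightarrow> (nat \<Rightarrow> nat) \<Rightarrow> nat multiset" where
  "cycle_type n w = image_mset card (mset_set (orbit w ` {1..n}))"

text \<open>
  The digraph on \<open>{1..n}\<close> with edges \<open>I ! t \<rightarrow> J ! t\<close> is a disjoint union of directed paths whose
  vertex counts are the entries of \<open>mu\<close>. Each path is the list of its successive vertices.
\<close>

definition path_pair :: "nat \<Rightarrow> nat list \<Rightarrow> nat list \<Rightarrow> nat list \<Rightarrow> bool" where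
  "path_pair n mu I J \<longleftrightarrow>
     length I = length J \<and> distinct I \<and> distinct J \<and> set I \<subseteq> {1..n} \<and> set J \<subseteq> {1..n} \<and>
     (\<exists>P. [] \<notin> set P \<and> distinct (concat P) \<and> set (concat P) = {1..n} \<and>
          mset (map length P) = mset mu \<and>
          set (zip I J) = (\<Union>p \<in> set P. {(p ! k, p ! Suc k) | k. Suc k < length p}))"

definition path_perm_count :: "nat \<Rightarrow> nat list \<Rightarrow> nat list \<Rightarrow> nat list \<Rightarrow> nat" where
  "path_perm_count n I J lam =
     card {w. w permutes {1..n} \<and> cycle_type n w = mset lam \<and> (\<forall>t < length I. w (I ! t) = J ! t)}"

text \<open>
  The path power sum of \<open>mu\<close>, computed from a pair with \<open>path_pair n mu I J\<close>. Such a pair exists for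
  every partition \<open>mu\<close> of \<open>n\<close> (\<open>path_pair_exists\<close> below).
\<close>

definition path_power_sum :: "nat \<Rightarrow> nat list \<Rightarrow> nat list \<Rightarrow> 'a :: comm_ring_1 mvfps" where
  "path_power_sum n I J =
     (\<Sum>lam \<in> partitions_of n. of_nat (path_perm_count n I J lam) * power_sum_part lam)"

lemma path_blocks_exist:
  assumes "0 \<notin> set mu"
  shows "\<exists>P. [] \<notin> set P \<and> distinct (concat P) \<and> set (concat P) = {1..sum_list mu} \<and>
             map length P = mu"
  using assms
proof (induction mu rule: rev_induct)
  case Nil
  show ?case by (intro exI[of _ "[]"]) auto
next
  case (snoc k mu)
  then have k: "0 < k" and mu: "0 \<notin> set mu" by auto
  from snoc.IH[OF mu] obtain P where P: "[] \<notin> set P" "distinct (concat P)"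
      "set (concat P) = {1..sum_list mu}" "map length P = mu"
    by (elim exE conjE)
  define B where "B = [Suc (sum_list mu)..<Suc (sum_list mu + k)]"
  have B: "distinct B" "set B = {Suc (sum_list mu)..sum_list mu + k}" "length B = k"
    unfolding B_def by (simp_all only: distinct_upt set_upt length_upt atLeastLessThanSuc_atLeastAtMost)
  have c: "concat (P @ [B]) = concat P @ B" by simp
  show ?case
  proof (intro exI[of _ "P @ [B]"] conjI)
    show "[] \<notin> set (P @ [B])" using P(1) B(3) k by auto
    show "distinct (concat (P @ [B]))"
      unfolding c distinct_append P(3) B(2) using P(2) B(1) by auto
    show "set (concat (P @ [B])) = {1..sum_list (mu @ [k])}"
      unfolding c set_append P(3) B(2) by auto
    show "map length (P @ [B]) = mu @ [k]" using P(4) B(3) by simp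
  qed
qed

lemma path_edges_exist:
  assumes "distinct (concat P)"
  shows "\<exists>I J. length I = length J \<and> distinct I \<and> distinct J \<and> set I \<subseteq> set (concat P) \<and>
           set J \<subseteq> set (concat P) \<and>
           set (zip I J) = (\<Union>p \<in> set P. {(p ! k, p ! Suc k) | k. Suc k < length p})"
  using assms
proof (induction P)
  case Nil
  show ?case by (intro exI[of _ "[]"]) auto
next
  case (Cons p P)
  from Cons.prems have d: "distinct p" "distinct (concat P)" "set p \<inter> set (concat P) = {}" by auto
  from Cons.IH[OF d(2)] obtain I J where IJ: "length I = length J" "distinct I" "distinct J"
      "set I \<subseteq> set (concat P)" "set J \<subseteq> set (concat P)"
      "set (zip I J) = (\<Union>p \<in> set P. {(p ! k, p ! Suc k) | k. Suc k < length p})" by blast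
  have sub: "set (butlast p) \<subseteq> set p" "set (tl p) \<subseteq> set p"
    by (auto dest: in_set_butlastD) (cases p; simp)
  have e: "set (zip (butlast p) (tl p)) = {(p ! k, p ! Suc k) | k. Suc k < length p}"
    unfolding set_zip by (intro Collect_cong ex_cong1) (auto simp: nth_butlast nth_tl)
  show ?case
  proof (rule exI[of _ "butlast p @ I"], rule exI[of _ "tl p @ J"], intro conjI)
    show "length (butlast p @ I) = length (tl p @ J)" using IJ by simp
    have "set (butlast p) \<inter> set I = {}" "set (tl p) \<inter> set J = {}"
      using d(3) sub IJ(4,5) by blast+
    then show "distinct (butlast p @ I)" "distinct (tl p @ J)"
      using IJ(2,3) d(1) by (simp_all add: distinct_butlast distinct_tl)
    have "set (concat (p # P)) = set p \<union> set (concat P)" by simp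
    then show "set (butlast p @ I) \<subseteq> set (concat (p # P))"
        "set (tl p @ J) \<subseteq> set (concat (p # P))"
      unfolding set_append using IJ(4,5) sub by blast+
    show "set (zip (butlast p @ I) (tl p @ J))
        = (\<Union>p \<in> set (p # P). {(p ! k, p ! Suc k) | k. Suc k < length p})"
      using IJ(1,6) e by simp
  qed
qed

lemma path_pair_exists:
  assumes "mu \<in> partitions_of n"
  shows "\<exists>I J. path_pair n mu I J"
proof -
  from assms have mu: "0 \<notin> set mu" "sum_list mu = n"
    by (auto simp: partitions_of_def is_partition_def)
  from path_blocks_exist[OF mu(1), unfolded mu(2)] obtain P where
    P: "[] \<notin> set P" "distinct (concat P)" "set (concat P) = {1..n}" "map length P = mu"
    by (elim exE conjE)
  from path_edges_exist[OF P(2), unfolded P(3)] obtain I J where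
    IJ: "length I = length J" "distinct I" "distinct J" "set I \<subseteq> {1..n}" "set J \<subseteq> {1..n}"
      "set (zip I J) = (\<Union>p \<in> set P. {(p ! k, p ! Suc k) | k. Suc k < length p})"
    by (elim exE conjE)
  have "path_pair n mu I J"
    unfolding path_pair_def
  proof (intro conjI exI[of _ P])
    show "mset (map length P) = mset mu" by (simp only: P(4))
  qed (fact IJ P)+
  then show ?thesis by (intro exI)
qed

section \<open>Monotonic ribbon tilings\<close>

definition skew_shape :: "(nat \<times> nat) set \<Rightarrow> bool" where
  "skew_shape S \<longleftrightarrow> (\<exists>lam nu. is_partition lam \<and> is_partition nu \<and>
     young_diagram nu \<subseteq> young_diagram lam \<and> S = young_diagram lam - young_diagram nu)"

definition edge_adjacent :: "nat \<times> nat \<Rightarrow> nat \<times> nat \<Rightarrow> bool" where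
  "edge_adjacent c d \<longleftrightarrow>
     (fst c = fst d \<and> (snd d = Suc (snd c) \<or> snd c = Suc (snd d))) \<or>
     (snd c = snd d \<and> (fst d = Suc (fst c) \<or> fst c = Suc (fst d)))"

definition edgewise_connected :: "(nat \<times> nat) set \<Rightarrow> bool" where
  "edgewise_connected S \<longleftrightarrow>
     (\<forall>c \<in> S. \<forall>d \<in> S. (c, d) \<in> {(a, b). a \<in> S \<and> b \<in> S \<and> edge_adjacent a b}\<^sup>*)"

definition ribbon :: "(nat \<times> nat) set \<Rightarrow> bool" where
  "ribbon S \<longleftrightarrow> S \<noteq> {} \<and> skew_shape S \<and> edgewise_connected S \<and>
     \<not> (\<exists>i j. {(i, j), (i, Suc j), (Suc i, j), (Suc i, Suc j)} \<subseteq> S)"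

definition ribbon_height :: "(nat \<times> nat) set \<Rightarrow> nat" where
  "ribbon_height S = card (fst ` S) - 1"

definition ribbon_sign :: "(nat \<times> nat) set \<Rightarrow> 'a :: comm_ring_1" where
  "ribbon_sign S = (- 1) ^ ribbon_height S"

text \<open>The southwesternmost cell, which a ribbon always has.\<close>

definition ribbon_tail :: "(nat \<times> nat) set \<Rightarrow> nat \<times> nat" where
  "ribbon_tail S = (THE c. c \<in> S \<and> (\<forall>d \<in> S. fst d \<le> fst c \<and> snd c \<le> snd d))"

text \<open>
  The ribbons are listed from west to east, that is, by the columns of their tails. These are
  distinct, so each tiling corresponds to exactly one list.
\<close>

definition monotonic_ribbon_tiling :: "nat list \<Rightarrow> (nat \<times> nat) set list \<Rightarrow> bool" where
  "monotonic_ribbon_tiling lam T \<longleftrightarrow>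
     is_partition lam \<and> \<Union> (set T) = young_diagram lam \<and>
     (\<forall>S \<in> set T. ribbon S) \<and>
     sorted_wrt (\<lambda>S S'. S \<inter> S' = {}) T \<and>
     sorted_wrt (<) (map (\<lambda>S. snd (ribbon_tail S)) T) \<and>
     (\<forall>i \<le> length T. \<exists>nu. is_partition nu \<and> \<Union> (set (take i T)) = young_diagram nu)"

definition tiling_shape :: "(nat \<times> nat) set list \<Rightarrow> nat list" where
  "tiling_shape T = (THE lam. monotonic_ribbon_tiling lam T)"

definition tiling_sign :: "(nat \<times> nat) set list \<Rightarrow> 'a :: comm_ring_1" where
  "tiling_sign T = prod_list (map ribbon_sign T)"

definition monotonic_tilings_of_type :: "nat list \<Rightarrow> (nat \<times> nat) set list set" where
  "monotonic_tilings_of_type mu =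
     {T. (\<exists>lam. monotonic_ribbon_tiling lam T) \<and> mset (map card T) = mset mu}"

section \<open>Finiteness of the sums, and uniqueness of the shape of a tiling\<close>

lemma finite_partitions_of: "finite (partitions_of n)"
proof (rule finite_subset)
  show "partitions_of n \<subseteq> {xs. set xs \<subseteq> {..n} \<and> length xs \<le> n}"
  proof
    fix lam assume l: "lam \<in> partitions_of n"
    have "0 \<notin> set lam \<Longrightarrow> length lam \<le> sum_list lam"
      by (induction lam) auto
    then show "lam \<in> {xs. set xs \<subseteq> {..n} \<and> length xs \<le> n}"
      using l member_le_sum_list[of _ lam] by (auto simp: partitions_of_def is_partition_def)
  qed
qed (simp add: finite_lists_length_le)

lemma young_diagram_SIGMA: "young_diagram lam = (SIGMA i:{..<length lam}. {..<lam ! i})"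
  by (auto simp: young_diagram_def)

lemma finite_young_diagram: "finite (young_diagram lam)"
  by (simp add: young_diagram_SIGMA)

lemma card_young_diagram: "card (young_diagram lam) = sum_list lam"
  by (simp add: young_diagram_SIGMA sum_list_sum_nth atLeast0LessThan)

lemma young_diagram_inj:
  assumes "is_partition lam" "is_partition nu" "young_diagram lam = young_diagram nu"
  shows "lam = nu"
proof (rule nth_equalityI)
  have len: "{i. (i, 0) \<in> young_diagram k} = {..<length k}" if "is_partition k" for k
    using that by (auto simp: young_diagram_def is_partition_def) (metis gr0I nth_mem)
  show l: "length lam = length nu" using len[OF assms(1)] len[OF assms(2)] assms(3) by simp
  fix i assume i: "i < length lam"
  have row: "{j. (i, j) \<in> young_diagram k} = {..<k ! i}" if "i < length k" for k
    using that by (auto simp: young_diagram_def)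
  show "lam ! i = nu ! i" using row[of lam] row[of nu] i l assms(3) by simp
qed

lemma tiling_shape_eq:
  assumes "monotonic_ribbon_tiling lam T"
  shows "tiling_shape T = lam"
  unfolding tiling_shape_def using assms young_diagram_inj
  by (intro the_equality) (auto simp: monotonic_ribbon_tiling_def)

lemma finite_monotonic_tilings_of_type: "finite (monotonic_tilings_of_type mu)"
proof (rule finite_subset)
  let ?D = "\<Union>lam \<in> partitions_of (sum_list mu). young_diagram lam"
  show "monotonic_tilings_of_type mu \<subseteq> {T. set T \<subseteq> Pow ?D \<and> length T \<le> length mu}"
  proof
    fix T assume T: "T \<in> monotonic_tilings_of_type mu"
    then obtain lam where lam: "monotonic_ribbon_tiling lam T" and m: "mset (map card T) = mset mu"
      by (auto simp: monotonic_tilings_of_type_def)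
    have U: "\<Union> (set T) = young_diagram lam" and dj: "sorted_wrt (\<lambda>S S'. S \<inter> S' = {}) T"
      and p: "is_partition lam"
      using lam by (auto simp: monotonic_ribbon_tiling_def)
    have fin: "\<forall>S \<in> set T. finite S"
      using U finite_young_diagram[of lam] by (metis Union_upper finite_subset)
    have "card (\<Union> (set T)) = sum_list (map card T)" using dj fin
    proof (induction T)
      case (Cons S T)
      have "S \<inter> \<Union> (set T) = {}" using Cons.prems by auto
      then show ?case using Cons by (simp add: card_Un_disjoint)
    qed simp
    also have "\<dots> = sum_list mu" using m by (metis sum_mset_sum_list)
    finally have "lam \<in> partitions_of (sum_list mu)"
      using U p by (simp add: partitions_of_def card_young_diagram)
    moreover have "length T = length mu" using m by (metis length_map size_mset)
    ultimately show "T \<in> {T. set T \<subseteq> Pow ?D \<and> length T \<le> length mu}" using U by auto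
  qed
  show "finite {T. set T \<subseteq> Pow ?D \<and> length T \<le> length mu}"
    by (intro finite_lists_length_le finite_Pow_iff[THEN iffD2] finite_UN_I
          finite_partitions_of finite_young_diagram)
qed

end

theory Submission
  imports Defs "HOL-Combinatorics.Cycles" "HOL-Combinatorics.Multiset_Permutations"
begin

text \<open>
  A partition with at most \<open>N\<close> columns, of heights \<open>h\<^sub>0 \<ge> h\<^sub>1 \<ge> \<dots>\<close>, is encoded by \<open>N\<close> beads at the
  positions \<open>h\<^sub>c - c\<close>. The dual Jacobi--Trudi determinant extends the Schur polynomial to an
  alternating function of arbitrary bead positions, and \<open>p\<^sub>k\<close> acts on it as \<open>(-1)\<^bsup>k-1\<^esup>\<close> times the sum
  over all ways to raise one bead by \<open>k\<close>. The path power sum satisfies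
  \<open>p\<^sub>k \<cdot> P(\<mu>\<^sub>1, \<dots>, \<mu>\<^sub>r) = P(k, \<mu>\<^sub>1, \<dots>, \<mu>\<^sub>r) - \<Sum>\<^sub>i P(\<dots>, \<mu>\<^sub>i + k, \<dots>)\<close>, since the last vertex of a path is
  sent to the first vertex of the same or of another path. Up to the sign, the sum over all ways to
  raise \<open>r\<close> distinct beads of the empty partition by \<open>\<mu>\<^sub>1, \<dots>, \<mu>\<^sub>r\<close> satisfies the same recursion. When
  these beads are moved in the order of decreasing destinations, every move adds a ribbon whose tail
  lies in the column given by the new rank of the bead, so the tails go from west to east: the sum
  runs over the monotonic ribbon tilings, each of them counted \<open>m(\<mu>)!\<close> times.
\<close>

section \<open>Bead polynomials\<close>

text \<open>The determinant behind \<open>bead_poly x N M b\<close> has the entries e_{b c + j}(x_0,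
  ..., x_{M-1}) for c, j < N. The dual form fits because tails are compared by columns, and because
  an elementary symmetric polynomial has degree at most one in each variable: one more variable only
  decides which beads drop by one. \<open>M\<close> is arbitrary and serves to truncate the
  variables; \<open>N\<close> is the size of \<mu>. The finite number of beads is the obstacle that
  shapes the proof: the action of p_k can fail unless the \<open>k\<close> lowest beads are at rest.
  Hence a bound on the moved beads is needed for every nonvanishing term, and \<open>N\<close> must
  leave room for the part that is still to come. Both sides are compared through sets of moves,
  without order or labels. A set with a repeated destination contributes zero; any other set has
  exactly one listing by decreasing destinations, which fixes a rearrangement of \<mu>. The signs
  agree because a ribbon of \<open>k\<close> cells in the columns \<open>p\<close> to
  \<open>q\<close> has sign (-1)^(k-1) (-1)^(q-p): the first factor belongs to p_k, the second to
  the renumbering of the beads.\<close>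

text \<open>
  Expanding the elementary symmetric polynomials of the determinant one variable at a time, a
  variable to the power \<open>card E\<close> lowers the beads in \<open>E\<close> by one; without variables only the
  permutations of the beads \<open>0, -1, \<dots>, 1 - N\<close> of the empty partition survive.
\<close>

definition ground :: "nat \<Rightarrow> (nat \<Rightarrow> int) \<Rightarrow> 'r :: comm_ring_1" where
  "ground N b = (\<Sum>w | w permutes {..<N}.
     if \<forall>c<N. b c = - int (w c) then of_int (sign w) else 0)"

definition lower :: "(nat \<Rightarrow> int) \<Rightarrow> nat set \<Rightarrow> nat \<Rightarrow> int" where
  "lower b E c = b c - (if c \<in> E then 1 else 0)"

definition raise :: "(nat \<Rightarrow> int) \<Rightarrow> nat \<Rightarrow> nat \<Rightarrow> nat \<Rightarrow> int" where
  "raise b i k = b(i := b i + int k)"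

primrec bead_poly :: "(nat \<Rightarrow> 'r) \<Rightarrow> nat \<Rightarrow> nat \<Rightarrow> (nat \<Rightarrow> int) \<Rightarrow> 'r :: comm_ring_1" where
  "bead_poly x N 0 b = ground N b"
| "bead_poly x N (Suc M) b =
     (\<Sum>E \<in> Pow {..<N}. x M ^ card E * bead_poly x N M (lower b E))"

lemma ground_cong: "(\<And>c. c < N \<Longrightarrow> b c = b' c) \<Longrightarrow> ground N b = ground N b'"
  unfolding ground_def by (intro sum.cong) auto

lemma bead_poly_cong: "(\<And>c. c < N \<Longrightarrow> b c = b' c) \<Longrightarrow> bead_poly x N M b = bead_poly x N M b'"
proof (induction M arbitrary: b b')
  case 0
  then show ?case by (simp add: ground_cong[of N b b'])
next
  case (Suc M)
  have "bead_poly x N M (lower b E) = bead_poly x N M (lower b' E)" for E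
    by (rule Suc.IH) (simp add: lower_def Suc.prems)
  then show ?case by simp
qed

lemma ground_eq_0I:
  assumes "\<And>w. w permutes {..<N} \<Longrightarrow> \<not> (\<forall>c<N. b c = - int (w c))"
  shows "ground N b = 0"
  unfolding ground_def by (intro sum.neutral ballI if_not_P) (use assms in blast)

text \<open>\<open>ground\<close> is the determinant of the 0-1 matrix with entries [b c = -j], and
  two of its rows are exchanged. The sum over \<open>w\<close> is reindexed by composition with the
  transposition.\<close>

lemma ground_transpose:
  assumes "i < N" "j < N" "i \<noteq> j"
  shows "ground N (b \<circ> transpose i j) = - (ground N b :: 'r :: comm_ring_1)"
proof -
  let ?t = "transpose i j"
  have t: "?t permutes {..<N}" using assms by (intro permutes_swap_id) auto
  have P: "permutation w" if "w permutes {..<N}" for w :: "nat \<Rightarrow> nat"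
    using that permutation_permutes by blast
  have "(ground N (b \<circ> ?t) :: 'r) = (\<Sum>w | w permutes {..<N}.
      if \<forall>c<N. b (?t c) = - int (w (?t c)) then of_int (sign (w \<circ> ?t)) else 0)"
    unfolding ground_def using sum_permutations_compose_right[OF t,
      of "\<lambda>w. if \<forall>c<N. (b \<circ> ?t) c = - int (w c) then of_int (sign w) else 0"]
    by simp
  also have "\<dots> = (\<Sum>w | w permutes {..<N}.
      - (if \<forall>c<N. b c = - int (w c) then of_int (sign w) else 0))"
  proof (rule sum.cong[OF refl])
    fix w :: "nat \<Rightarrow> nat" assume "w \<in> {w. w permutes {..<N}}"
    then have w: "w permutes {..<N}" by simp
    have "(\<forall>c<N. b (?t c) = - int (w (?t c))) \<longleftrightarrow> (\<forall>c<N. b c = - int (w c))"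
    proof (intro iffI allI impI)
      fix c assume *: "\<forall>c<N. b (?t c) = - int (w (?t c))" and "c < N"
      then have "?t c < N" using permutes_in_image[OF t, of c] by simp
      then show "b c = - int (w c)" using * transpose_involutory by metis
    next
      fix c assume *: "\<forall>c<N. b c = - int (w c)" and "c < N"
      then have "?t c < N" using permutes_in_image[OF t, of c] by simp
      then show "b (?t c) = - int (w (?t c))" using * by blast
    qed
    moreover have "sign (w \<circ> ?t) = - sign w"
      using sign_compose[OF P[OF w] P[OF t]] assms(3) by (simp add: sign_swap_id)
    ultimately show "(if \<forall>c<N. b (?t c) = - int (w (?t c)) then of_int (sign (w \<circ> ?t)) else 0) =
        - (if \<forall>c<N. b c = - int (w c) then of_int (sign w) else (0::'r))"
      by (simp only: if_distrib[of uminus] of_int_minus minus_zero)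
  qed
  finally show ?thesis by (simp add: ground_def sum_negf)
qed

text \<open>The set \<open>E\<close> of lowered beads is carried along by the transposition; its
  cardinality, and with it the power of the newest variable, stays the same.\<close>

lemma bead_poly_transpose:
  assumes "i < N" "j < N" "i \<noteq> j"
  shows "bead_poly x N M (b \<circ> transpose i j) = - bead_poly x N M b"
proof (induction M arbitrary: b)
  case 0
  show ?case using ground_transpose[OF assms] by (simp only: bead_poly.simps)
next
  case (Suc M)
  let ?t = "transpose i j"
  have t: "?t permutes {..<N}" using assms by (intro permutes_swap_id) auto
  have tt: "?t ` (?t ` E) = E" for E by (simp add: image_image)
  have sub: "?t ` E \<subseteq> {..<N}" if "E \<subseteq> {..<N}" for E
    using that permutes_image[OF t] by blast
  have "bead_poly x N (Suc M) (b \<circ> ?t)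
      = (\<Sum>E \<in> Pow {..<N}. x M ^ card E * bead_poly x N M (lower b (?t ` E) \<circ> ?t))"
  proof -
    have "lower (b \<circ> ?t) E = lower b (?t ` E) \<circ> ?t" for E
      by (auto simp: lower_def fun_eq_iff inj_image_mem_iff)
    then show ?thesis by simp
  qed
  also have "\<dots> = (\<Sum>E \<in> Pow {..<N}. x M ^ card E * bead_poly x N M (lower b E \<circ> ?t))"
    by (rule sum.reindex_bij_witness[of _ "image ?t" "image ?t"])
       (use sub in \<open>auto simp: tt card_image\<close>)
  finally show ?case by (simp only: Suc.IH mult_minus_right sum_negf bead_poly.simps)
qed


text \<open>In characteristic 2 the change of sign alone does not force a value to vanish, so terms
  are cancelled in pairs. A set \<open>E\<close> containing both or neither of \<open>i\<close>,
  \<open>j\<close> keeps the coincidence and vanishes by induction; the transposition exchanges the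
  remaining two kinds of sets with opposite signs.\<close>

lemma bead_poly_repeated:
  assumes "i < N" "j < N" "i \<noteq> j" "b i = b j"
  shows "bead_poly x N M b = 0"
  using assms(4)
proof (induction M arbitrary: b)
  case 0
  have "\<not> (\<forall>c<N. b c = - int (w c))" if "w permutes {..<N}" for w
    using permutes_inj[OF that] 0 assms(1-3) by (metis inj_eq neg_equal_iff_equal of_nat_eq_iff)
  then show ?case by (simp add: ground_eq_0I)
next
  case (Suc M)
  let ?t = "transpose i j" and ?f = "\<lambda>E. x M ^ card E * bead_poly x N M (lower b E)"
  define A where "A = {E \<in> Pow {..<N}. i \<in> E \<and> j \<notin> E}"
  define B where "B = {E \<in> Pow {..<N}. j \<in> E \<and> i \<notin> E}"
  have t: "?t permutes {..<N}" using assms by (intro permutes_swap_id) auto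
  have sub: "?t ` E \<subseteq> {..<N}" if "E \<subseteq> {..<N}" for E
    using that permutes_image[OF t] by blast
  have tt: "?t ` (?t ` E) = E" for E by (simp add: image_image)
  have ij: "i \<in> ?t ` E \<longleftrightarrow> j \<in> E" "j \<in> ?t ` E \<longleftrightarrow> i \<in> E" for E
    by (metis inj_image_mem_iff inj_transpose transpose_apply_first transpose_apply_second)+
  have low: "lower b (?t ` E) = lower b E \<circ> ?t" for E
  proof
    fix c
    have "c \<in> ?t ` E \<longleftrightarrow> ?t c \<in> E"
      by (metis inj_image_mem_iff inj_transpose transpose_involutory)
    moreover have "b (?t c) = b c" using Suc.prems by (auto simp: transpose_def)
    ultimately show "lower b (?t ` E) c = (lower b E \<circ> ?t) c" by (simp add: lower_def)
  qed
  have "sum ?f (Pow {..<N}) = sum ?f (A \<union> B)"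
  proof (rule sum.mono_neutral_right)
    show "\<forall>E \<in> Pow {..<N} - (A \<union> B). ?f E = 0"
      by (intro ballI, subst Suc.IH) (auto simp: A_def B_def lower_def Suc.prems)
  qed (auto simp: A_def B_def)
  also have "\<dots> = sum ?f A + sum ?f B"
    by (rule sum.union_disjoint) (auto simp: A_def B_def)
  also have "sum ?f B = (\<Sum>E\<in>A. - ?f E)"
  proof (rule sum.reindex_bij_witness[of _ "image ?t" "image ?t"])
    fix E assume "E \<in> B"
    show "- ?f (?t ` E) = ?f E"
      by (simp add: low bead_poly_transpose[OF assms(1-3)] card_image)
  qed (use sub ij in \<open>auto simp: tt A_def B_def\<close>)
  finally show ?case by (simp add: sum_negf)
qed

lemma bead_poly_not_inj: "\<not> inj_on b {..<N} \<Longrightarrow> bead_poly x N M b = 0"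
  by (auto simp: inj_on_def intro: bead_poly_repeated)

text \<open>Beads are only ever lowered, and without variables each of them has to occupy one of the
  positions 0, ..., 1 - N.\<close>

lemma bead_poly_low:
  assumes "c < N" "b c \<le> - int N"
  shows "bead_poly x N M b = 0"
  using assms(2)
proof (induction M arbitrary: b)
  case 0
  have "\<not> (\<forall>c<N. b c = - int (w c))" if "w permutes {..<N}" for w
    using permutes_in_image[OF that, of c] 0 assms(1) by force
  then show ?case by (simp add: ground_eq_0I)
next
  case (Suc M)
  have "bead_poly x N M (lower b E) = 0" for E
    by (rule Suc.IH) (use Suc.prems in \<open>simp add: lower_def\<close>)
  then show ?case by simp
qed

text \<open>The cyclic shift that renumbers the beads when the bead of index \<open>q\<close> has
  been raised to the rank \<open>p\<close>.\<close>

definition rot :: "nat \<Rightarrow> nat \<Rightarrow> (nat \<Rightarrow> 'b) \<Rightarrow> nat \<Rightarrow> 'b" where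
  "rot p q b c = (if c = p then b q else if p < c \<and> c \<le> q then b (c - 1) else b c)"

text \<open>The shift is a product of \<open>q - p\<close> adjacent transpositions.\<close>

lemma bead_poly_rot:
  assumes "p \<le> q" "q < N"
  shows "bead_poly x N M (rot p q b) = (- 1) ^ (q - p) * bead_poly x N M b"
  using assms
proof (induction q arbitrary: b rule: dec_induct)
  case base
  have "rot p p b = b" by (auto simp: rot_def)
  then show ?case by simp
next
  case (step q)
  have "rot p (Suc q) b = rot p q (b \<circ> transpose q (Suc q))"
    using step.hyps by (auto simp: rot_def fun_eq_iff transpose_def)
  then have "bead_poly x N M (rot p (Suc q) b)
      = (- 1) ^ (q - p) * bead_poly x N M (b \<circ> transpose q (Suc q))"
    using step by simp
  also have "\<dots> = (- 1) ^ (q - p) * - bead_poly x N M b"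
    using step.prems by (subst bead_poly_transpose) auto
  finally show ?case using step.hyps by (simp add: Suc_diff_le)
qed

section \<open>Raising one bead, and multiplication by a power sum\<close>

definition raise_sum :: "(nat \<Rightarrow> 'r :: comm_ring_1) \<Rightarrow> nat \<Rightarrow> nat \<Rightarrow> nat \<Rightarrow> (nat \<Rightarrow> int) \<Rightarrow> 'r" where
  "raise_sum x N M k b = (\<Sum>i<N. bead_poly x N M (raise b i k))"

text \<open>Raising a third bead keeps the coincidence; the two terms that resolve it differ by a
  transposition and cancel.\<close>

lemma raise_sum_repeated:
  assumes "i < N" "j < N" "i \<noteq> j" "b i = b j"
  shows "raise_sum x N M k b = 0"
proof -
  have "raise_sum x N M k b = (\<Sum>l\<in>{i, j}. bead_poly x N M (raise b l k))"
    unfolding raise_sum_def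
  proof (rule sum.mono_neutral_right)
    show "\<forall>l\<in>{..<N} - {i, j}. bead_poly x N M (raise b l k) = 0"
      using assms by (intro ballI bead_poly_repeated[of i N j]) (auto simp: raise_def)
  qed (use assms in auto)
  moreover have "raise b j k = raise b i k \<circ> transpose i j"
    using assms(3,4) by (auto simp: raise_def fun_eq_iff transpose_def)
  ultimately show ?thesis
    using assms(1-3) by (simp add: bead_poly_transpose)
qed

lemma raise_sum_not_inj: "\<not> inj_on b {..<N} \<Longrightarrow> raise_sum x N M k b = 0"
  by (auto simp: inj_on_def intro: raise_sum_repeated)

text \<open>If the raised configuration filled the ground positions, then the position
  \<open>b i\<close> just vacated, which lies among them, would be occupied by another bead, against
  injectivity.\<close>

lemma ground_raise_eq_0:
  assumes inj: "inj_on b {..<N}" and lo: "\<And>c. c < N \<Longrightarrow> - int N < b c"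
    and "0 < k" "i < N"
  shows "ground N (raise b i k) = (0 :: 'r :: comm_ring_1)"
proof -
  have False if w: "w permutes {..<N}" and eq: "\<forall>c<N. raise b i k c = - int (w c)" for w
  proof -
    have "b i = - int (w i) - int k" using eq \<open>i < N\<close> by (auto simp: raise_def)
    define v where "v = nat (- b i)"
    have v: "b i = - int v" "v < N"
      using lo[OF \<open>i < N\<close>] \<open>b i = _\<close> by (auto simp: v_def)
    then obtain c where c: "c < N" "w c = v"
      using permutes_image[OF w] by (metis imageE lessThan_iff)
    have "c \<noteq> i" using v c eq \<open>i < N\<close> \<open>0 < k\<close> by (auto simp: raise_def)
    then have "b c = b i" using eq c v by (auto simp: raise_def)
    then show False using inj \<open>c \<noteq> i\<close> c(1) \<open>i < N\<close> by (auto simp: inj_on_def)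
  qed
  then show ?thesis by (intro ground_eq_0I) blast
qed

text \<open>
  The operators \<open>b \<mapsto> lower b E\<close> and \<open>b \<mapsto> raise b i k\<close> commute. Lowering a bead past the bottom
  kills every term of \<open>raise_sum\<close> but the one that brings this bead back to the top of the \<open>k\<close>
  lowest ones; this term carries the new power \<open>x M ^ k\<close>.
\<close>

lemma raise_sum_bead_poly:
  assumes "0 < k" "k \<le> N" "\<And>c. N - k \<le> c \<Longrightarrow> c < N \<Longrightarrow> b c = - int c"
    and "\<And>c. c < N \<Longrightarrow> - int N < b c"
  shows "raise_sum x N M k b = (- 1) ^ (k - 1) * (\<Sum>j<M. x j ^ k) * bead_poly x N M b"
  using assms(3,4)
proof (induction M arbitrary: b)
  case 0
  show ?case
  proof (cases "inj_on b {..<N}")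
    case True
    then show ?thesis using 0 assms(1) by (simp add: raise_sum_def ground_raise_eq_0)
  next
    case False
    then show ?thesis using raise_sum_not_inj[of b N x 0] by simp
  qed
next
  case (Suc M)
  show ?case
  proof (cases "inj_on b {..<N}")
    case False
    then show ?thesis by (simp add: raise_sum_not_inj bead_poly_not_inj del: bead_poly.simps)
  next
    case inj: True
    define L where "L = {N - k..<N}"
    define p where "p = (\<Sum>j<M. x j ^ k)"
    have NL: "N - 1 \<in> L" "N - 1 < N" using assms(1,2) by (auto simp: L_def)
    have cL: "card L = k" using assms(2) by (simp add: L_def)
    \<comment> \<open>By injectivity the lowest position belongs to bead \<open>N - 1\<close> alone,
      so any other bead can be lowered once and still satisfies the bound of the induction
      hypothesis.\<close>
    have lowbot: "- int N + 1 < b c" if "c < N" "c \<noteq> N - 1" for c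
    proof -
      have "b (N - 1) = - int N + 1" using NL Suc.prems(1)[of "N - 1"] by (auto simp: L_def)
      then have "b c \<noteq> - int N + 1" using inj that NL(2) by (metis inj_onD lessThan_iff)
      then show ?thesis using Suc.prems(2)[OF that(1)] by linarith
    qed
    have key: "raise_sum x N M k (lower b E) = (- 1) ^ (k - 1) * p * bead_poly x N M (lower b E)
        + (if L \<subseteq> E then (- 1) ^ (k - 1) * bead_poly x N M (lower b (E - L)) else 0)"
      (is "?lhs = ?rhs") and zero: "E \<inter> L \<noteq> {} \<Longrightarrow> bead_poly x N M (lower b E) = 0"
      if E: "E \<subseteq> {..<N}" for E
    proof -
      let ?b = "lower b E"
      have tail: "?b c = - int c - (if c \<in> E then 1 else 0)" if "c \<in> L" for c
        using that Suc.prems(1) by (auto simp: lower_def L_def)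
      consider "E \<inter> L = {}" | "E \<inter> L \<noteq> {}" "N - 1 \<notin> E" | "N - 1 \<in> E" by blast
      then have "?lhs = ?rhs \<and> (E \<inter> L \<noteq> {} \<longrightarrow> bead_poly x N M (lower b E) = 0)"
      proof cases
        case 1
        have "raise_sum x N M k ?b = (- 1) ^ (k - 1) * p * bead_poly x N M ?b"
          unfolding p_def
        proof (rule Suc.IH)
          fix c assume c: "N - k \<le> c" "c < N"
          then have "c \<notin> E" using 1 by (auto simp: L_def)
          then show "?b c = - int c" using Suc.prems(1)[OF c] by (simp add: lower_def)
        next
          fix c assume c: "c < N"
          show "- int N < ?b c"
          proof (cases "c = N - 1")
            case True
            then have "c \<notin> E" using 1 NL by auto
            then show ?thesis using Suc.prems(2)[OF c] by (simp add: lower_def)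
          next
            case False
            then show ?thesis using lowbot[OF c False] by (simp add: lower_def)
          qed
        qed
        moreover have "\<not> L \<subseteq> E" using 1 NL by auto
        ultimately show ?thesis using 1 by simp
      next
        case 2
        \<comment> \<open>The last lowered bead of the bottom block \<open>L\<close> falls onto its
          right neighbour, which stays in place.\<close>
        define c where "c = Max (E \<inter> L)"
        have fin: "finite (E \<inter> L)" by (simp add: L_def)
        have c: "c \<in> E" "c \<in> L" using Max_in[OF fin 2(1)] by (auto simp: c_def)
        then have "c \<noteq> N - 1" using 2 by auto
        then have c': "Suc c \<in> L" "Suc c < N" using c(2) by (auto simp: L_def)
        then have "Suc c \<notin> E" using Max_ge[OF fin, of "Suc c"] by (auto simp: c_def)
        then have rep: "?b c = ?b (Suc c)" using tail[OF c(2)] tail[OF c'(1)] c by simp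
        have "bead_poly x N M ?b = 0" "raise_sum x N M k ?b = 0"
          using bead_poly_repeated[of c N "Suc c"] raise_sum_repeated[of c N "Suc c"] rep c' by auto
        moreover have "\<not> L \<subseteq> E" using 2 NL by auto
        ultimately show ?thesis by simp
      next
        case 3
        have bot: "?b (N - 1) = - int N" using tail[OF NL(1)] 3 NL by simp
        have z: "bead_poly x N M ?b = 0" by (rule bead_poly_low[OF NL(2)]) (use bot in simp)
        let ?g = "raise ?b (N - 1) k"
        have "raise_sum x N M k ?b = (\<Sum>i\<in>{N - 1}. bead_poly x N M (raise ?b i k))"
          unfolding raise_sum_def
        proof (rule sum.mono_neutral_right)
          show "\<forall>i\<in>{..<N} - {N - 1}. bead_poly x N M (raise ?b i k) = 0"
            using bot NL(2) by (intro ballI bead_poly_low[of "N - 1"]) (auto simp: raise_def)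
        qed (use NL in auto)
        then have rs: "raise_sum x N M k ?b = bead_poly x N M ?g" by simp
        have gtop: "?g (N - 1) = - int (N - k)" using bot assms(2) by (simp add: raise_def of_nat_diff)
        have gtail: "?g c = - int c - (if c \<in> E then 1 else 0)" if "c \<in> L" "c \<noteq> N - 1" for c
          using tail[OF that(1)] that(2) by (simp add: raise_def)
        show ?thesis
        proof (cases "L \<subseteq> E")
          case False
          \<comment> \<open>The first bead of \<open>L\<close> that is not lowered gets hit: by the
            raised bottom bead if it heads the block, and otherwise by its left neighbour, which has
            been lowered onto it.\<close>
          define c where "c = Min (L - E)"
          have fin: "finite (L - E)" by (simp add: L_def)
          have c: "c \<in> L" "c \<notin> E" using Min_in[OF fin] False by (auto simp: c_def)
          then have cN: "c \<noteq> N - 1" "c < N" using 3 by (auto simp: L_def)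
          have "bead_poly x N M ?g = 0"
          proof (cases "c = N - k")
            case True
            then show ?thesis using gtail[OF c(1) cN(1)] gtop c cN NL(2)
              by (intro bead_poly_repeated[of c N "N - 1"]) auto
          next
            case False
            then have c': "c - 1 \<in> L" "c - 1 < c" using c(1) by (auto simp: L_def)
            then have "c - 1 \<in> E" using Min_le[OF fin, of "c - 1"] by (auto simp: c_def)
            moreover have "c - 1 \<noteq> N - 1" using c' cN by auto
            ultimately have "?g (c - 1) = ?g c"
              using gtail[OF c(1) cN(1)] gtail[OF c'(1)] c c'(2) by simp
            then show ?thesis using c' cN by (intro bead_poly_repeated[of "c - 1" N c]) auto
          qed
          then show ?thesis using False z rs by simp
        next
          case True
          \<comment> \<open>With all of \<open>L\<close> lowered, the raised bottom bead fills the
            gap left at the top of the block, so the block is at rest again up to a cyclic shift of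
            its \<open>k\<close> beads. This is the origin of the sign (-1)^(k-1).\<close>
          have "bead_poly x N M (lower b (E - L)) = bead_poly x N M (rot (N - k) (N - 1) ?g)"
          proof (rule bead_poly_cong)
            fix c assume c: "c < N"
            show "lower b (E - L) c = rot (N - k) (N - 1) ?g c"
            proof (cases "c \<in> L")
              case cl: True
              then have "lower b (E - L) c = - int c" using Suc.prems(1) by (auto simp: lower_def L_def)
              moreover have "?g (c - 1) = - int c" if "c \<noteq> N - k"
              proof -
                have "c - 1 \<in> L" "c - 1 \<noteq> N - 1" "0 < c" using that cl by (auto simp: L_def)
                then show ?thesis using gtail[of "c - 1"] True by (auto simp: of_nat_diff)
              qed
              ultimately show ?thesis using gtop cl by (auto simp: rot_def L_def)
            next
              case False
              then have "c < N - k" using c by (auto simp: L_def)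
              then show ?thesis using False NL assms(1) by (auto simp: rot_def raise_def lower_def)
            qed
          qed
          also have "\<dots> = (- 1) ^ (k - 1) * bead_poly x N M ?g"
            using assms(1,2) by (subst bead_poly_rot) auto
          finally have "bead_poly x N M ?g = (- 1) ^ (k - 1) * bead_poly x N M (lower b (E - L))"
            by (simp add: mult.assoc[symmetric] power_mult_distrib[symmetric])
          then show ?thesis using True z rs by simp
        qed
      qed
      then show "?lhs = ?rhs" "E \<inter> L \<noteq> {} \<Longrightarrow> bead_poly x N M (lower b E) = 0" by auto
    qed
    have comm: "lower (raise b i k) E = raise (lower b E) i k" for i E
      by (auto simp: lower_def raise_def)
    have "raise_sum x N (Suc M) k b
        = (\<Sum>E\<in>Pow {..<N}. x M ^ card E * raise_sum x N M k (lower b E))"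
      unfolding raise_sum_def bead_poly.simps comm sum_distrib_left by (rule sum.swap)
    also have "\<dots> = (\<Sum>E\<in>Pow {..<N}. (- 1) ^ (k - 1) * p * (x M ^ card E * bead_poly x N M (lower b E))
        + x M ^ card E * (if L \<subseteq> E then (- 1) ^ (k - 1) * bead_poly x N M (lower b (E - L)) else 0))"
      using key by (intro sum.cong) (auto simp: algebra_simps)
    also have "\<dots> = (- 1) ^ (k - 1) * p * bead_poly x N (Suc M) b
        + (\<Sum>E\<in>Pow {..<N}. x M ^ card E *
            (if L \<subseteq> E then (- 1) ^ (k - 1) * bead_poly x N M (lower b (E - L)) else 0))"
      by (simp add: sum.distrib sum_distrib_left)
    also have "(\<Sum>E\<in>Pow {..<N}. x M ^ card E *
            (if L \<subseteq> E then (- 1) ^ (k - 1) * bead_poly x N M (lower b (E - L)) else 0))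
        = (\<Sum>E\<in>{E \<in> Pow {..<N}. L \<subseteq> E}. x M ^ card E *
            ((- 1) ^ (k - 1) * bead_poly x N M (lower b (E - L))))"
      by (subst sum.inter_filter) (auto intro!: sum.cong)
    \<comment> \<open>Removing the \<open>k\<close> beads of \<open>L\<close> from \<open>E\<close>
      releases the factor \<open>x M ^ k\<close>, the share of the new variable in the power
      sum.\<close>
    also have "\<dots> = (\<Sum>E\<in>{E \<in> Pow {..<N}. E \<inter> L = {}}. x M ^ (k + card E) *
            ((- 1) ^ (k - 1) * bead_poly x N M (lower b E)))"
    proof (rule sum.reindex_bij_witness[of _ "\<lambda>E. E \<union> L" "\<lambda>E. E - L"])
      fix E assume E: "E \<in> {E \<in> Pow {..<N}. L \<subseteq> E}"
      have "finite E" using E by (auto intro: finite_subset)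
      then have "card E = k + card (E - L)"
        using E cL card_mono[of E L] by (simp add: card_Diff_subset finite_subset[of L E])
      then show "x M ^ (k + card (E - L)) * ((- 1) ^ (k - 1) * bead_poly x N M (lower b (E - L)))
          = x M ^ card E * ((- 1) ^ (k - 1) * bead_poly x N M (lower b (E - L)))" by simp
    qed (auto simp: L_def Diff_triv)
    also have "\<dots> = (\<Sum>E\<in>Pow {..<N}. x M ^ (k + card E) *
            ((- 1) ^ (k - 1) * bead_poly x N M (lower b E)))"
      using zero by (intro sum.mono_neutral_left) auto
    also have "\<dots> = (- 1) ^ (k - 1) * x M ^ k * bead_poly x N (Suc M) b"
      by (simp add: sum_distrib_left power_add mult_ac)
    finally show ?thesis by (simp add: p_def algebra_simps)
  qed
qed

abbreviation ground_state :: "nat \<Rightarrow> int" where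
  "ground_state \<equiv> \<lambda>c. - int c"

lemma ground_start: "ground N (\<lambda>c. - int c) = (1 :: 'r :: comm_ring_1)"
proof -
  have "ground N (\<lambda>c. - int c) = (\<Sum>w\<in>{id}.
      if \<forall>c<N. - int c = - int (w c) then of_int (sign w) else (0 :: 'r))"
    unfolding ground_def
  proof (rule sum.mono_neutral_right)
    show "\<forall>w\<in>{w. w permutes {..<N}} - {id}.
        (if \<forall>c<N. - int c = - int (w c) then of_int (sign w) else (0 :: 'r)) = 0"
    proof
      fix w assume w: "w \<in> {w. w permutes {..<N}} - {id}"
      then obtain c where "w c \<noteq> c" by (auto simp: fun_eq_iff)
      moreover from this have "c < N" using w permutes_not_in[of w "{..<N}" c] by auto
      ultimately have "\<not> (\<forall>c<N. - int c = - int (w c))" by force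
      then show "(if \<forall>c<N. - int c = - int (w c) then of_int (sign w) else (0 :: 'r)) = 0" by (rule if_not_P)
    qed
  qed (auto simp: finite_permutations permutes_id)
  then show ?thesis by simp
qed

text \<open>For a nonempty set of lowered beads, the last one falls onto its right neighbour or
  drops below the bottom; only the empty set survives at each stage.\<close>

lemma bead_poly_start: "bead_poly x N M (\<lambda>c. - int c) = 1"
proof (induction M)
  case 0
  then show ?case by (simp add: ground_start)
next
  case (Suc M)
  let ?b = "\<lambda>c. - int c"
  have z: "bead_poly x N M (lower ?b E) = 0" if E: "E \<subseteq> {..<N}" "E \<noteq> {}" for E
  proof -
    have fin: "finite E" using E(1) finite_subset by blast
    define c where "c = Max E"
    have c: "c \<in> E" "c < N" using Max_in[OF fin E(2)] E(1) by (auto simp: c_def)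
    have sc: "Suc c \<notin> E" using Max_ge[OF fin, of "Suc c"] by (auto simp: c_def)
    show ?thesis
    proof (cases "Suc c < N")
      case True
      then show ?thesis using c sc by (intro bead_poly_repeated[of c N "Suc c"]) (auto simp: lower_def)
    next
      case False
      then show ?thesis using c by (intro bead_poly_low[of c]) (auto simp: lower_def)
    qed
  qed
  have "bead_poly x N (Suc M) ?b
      = (\<Sum>E\<in>{{}}. x M ^ card E * bead_poly x N M (lower ?b E))"
    unfolding bead_poly.simps by (rule sum.mono_neutral_right) (auto simp: z)
  moreover have "lower ?b {} = ?b" by (auto simp: lower_def)
  ultimately show ?case using Suc.IH by simp
qed

section \<open>Raising several distinct beads of the empty partition\<close>

definition bump :: "(nat \<times> nat) set \<Rightarrow> nat \<Rightarrow> int" where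
  "bump Q c = (\<Sum>q\<in>Q. if fst q = c then int (snd q) else 0)"

text \<open>The displacement is read off the set of pairs of a bead and an amount, so the order in
  which the moves are listed does not matter. This is what later lets labelled moves be grouped by
  their sets.\<close>

definition displ :: "(nat \<Rightarrow> int) \<Rightarrow> nat list \<Rightarrow> nat list \<Rightarrow> nat \<Rightarrow> int" where
  "displ b gs ks c = b c + bump (set (zip gs ks)) c"

definition dlists :: "nat \<Rightarrow> nat \<Rightarrow> nat list set" where
  "dlists N r = {gs. length gs = r \<and> distinct gs \<and> set gs \<subseteq> {..<N}}"

lemma finite_dlists: "finite (dlists N r)"
  by (rule finite_subset[OF _ finite_lists_length_eq[of "{..<N}" r]]) (auto simp: dlists_def)

lemma bump_nth:
  assumes "distinct gs" "length gs = length ks" "a < length ks"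
  shows "bump (set (zip gs ks)) (gs ! a) = int (ks ! a)"
proof -
  have "bump (set (zip gs ks)) (gs ! a)
      = (\<Sum>q\<in>{(gs ! a, ks ! a)}. if fst q = gs ! a then int (snd q) else 0)"
    unfolding bump_def using assms
    by (intro sum.mono_neutral_right) (auto simp: set_zip nth_eq_iff_index_eq)
  then show ?thesis by simp
qed

lemma bump_notin: "c \<notin> set gs \<Longrightarrow> bump (set (zip gs ks)) c = 0"
  unfolding bump_def by (intro sum.neutral) (auto dest: set_zip_leftD)

lemma displ_Cons:
  assumes "i \<notin> set gs"
  shows "displ b (i # gs) (k # ks) = raise (displ b gs ks) i k"
proof -
  have "(i, k) \<notin> set (zip gs ks)" using assms by (auto dest: set_zip_leftD)
  then have "bump (set (zip (i # gs) (k # ks))) c = (if i = c then int k else 0) + bump (set (zip gs ks)) c" for c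
    by (simp add: bump_def)
  then show ?thesis by (auto simp: displ_def raise_def fun_eq_iff)
qed

text \<open>The counterpart of joining two paths: raising a bead a second time merges the two
  amounts into one part.\<close>

lemma displ_update:
  assumes "distinct gs" "length gs = length ks" "a < length ks"
  shows "displ b gs (ks[a := ks ! a + k]) = raise (displ b gs ks) (gs ! a) k"
proof
  fix c
  show "displ b gs (ks[a := ks ! a + k]) c = raise (displ b gs ks) (gs ! a) k c"
  proof (cases "c \<in> set gs")
    case True
    then obtain i where i: "i < length gs" "c = gs ! i" by (metis in_set_conv_nth)
    then show ?thesis using assms
      by (auto simp: displ_def raise_def bump_nth nth_eq_iff_index_eq)
  next
    case False
    then show ?thesis using assms by (auto simp: displ_def raise_def bump_notin)
  qed
qed

lemma sum_bump:
  assumes "distinct gs" "length gs = length ks" "finite A" "set gs \<subseteq> A"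
  shows "(\<Sum>c\<in>A. bump (set (zip gs ks)) c) = int (sum_list ks)"
proof -
  have "(\<Sum>c\<in>A. bump (set (zip gs ks)) c) = (\<Sum>c\<in>set gs. bump (set (zip gs ks)) c)"
    using assms by (intro sum.mono_neutral_right) (auto simp: bump_notin)
  also have "\<dots> = (\<Sum>a<length gs. bump (set (zip gs ks)) (gs ! a))"
    using assms(1) by (intro sum.reindex_bij_betw[symmetric] bij_betw_nth) auto
  also have "\<dots> = (\<Sum>a<length ks. int (ks ! a))"
    using assms by (intro sum.cong) (auto simp: bump_nth)
  finally show ?thesis by (simp add: sum_list_sum_nth atLeast0LessThan)
qed

text \<open>The maximum of a set of \<open>r\<close> positive numbers is at least \<open>r\<close>;
  it is removed in the induction.\<close>

lemma gauss_le_sum: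
  assumes "finite S" "0 \<notin> S"
  shows "\<Sum>{..card S} \<le> \<Sum>(S :: nat set)"
  using assms
proof (induction "card S" arbitrary: S)
  case 0
  then show ?case by simp
next
  case (Suc r)
  then have ne: "S \<noteq> {}" by auto
  let ?m = "Max S"
  have m: "?m \<in> S" using Suc.prems(1) ne by (rule Max_in)
  have "S \<subseteq> {1..?m}" using Suc.prems Max_ge[OF Suc.prems(1)] by (auto simp: Suc_le_eq intro: gr0I)
  then have "card S \<le> ?m" using card_mono[of "{1..?m}" S] by simp
  moreover have "\<Sum>{..card (S - {?m})} \<le> \<Sum>(S - {?m})"
    using Suc.hyps Suc.prems m by (intro Suc.hyps(1)) auto
  moreover have "\<Sum>S = ?m + \<Sum>(S - {?m})" by (rule sum.remove[OF Suc.prems(1) m])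
  moreover have "card S = Suc (card (S - {?m}))" by (rule card.remove[OF Suc.prems(1) m])
  ultimately show ?case by simp
qed

text \<open>The lowest moved bead leaves a hole, so its position is bounded by the total displacement.\<close>

lemma displ_inj_bound:
  assumes gs: "distinct gs" "length gs = length ks" "set gs \<subseteq> {..<N}" and ks: "0 \<notin> set ks"
    and inj: "inj_on (displ ground_state gs ks) {..<N}" and g: "g \<in> set gs"
  shows "g < sum_list ks"
proof -
  define j where "j = Max (set gs)"
  let ?d = "displ ground_state gs ks"
  have "finite (set gs)" "set gs \<noteq> {}" using g by auto
  then have j: "j \<in> set gs" "g \<le> j" using g Max_in by (auto simp: j_def)
  have le: "set gs \<subseteq> {..j}" by (auto simp: j_def)
  have nonneg: "0 \<le> bump (set (zip gs ks)) c" for c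
    unfolding bump_def by (intro sum_nonneg) auto
  have pos: "0 < ?d c + int j" if "c \<le> j" for c
  proof (cases "c = j")
    case True
    obtain a where a: "a < length gs" "j = gs ! a" using j by (metis in_set_conv_nth)
    then have "0 < ks ! a" using ks gs(2) by (metis gr0I nth_mem)
    then show ?thesis using True a gs by (simp add: displ_def bump_nth)
  next
    case False
    then show ?thesis using that nonneg[of c] by (simp add: displ_def)
  qed
  \<comment> \<open>Shifted by \<open>j\<close>, the beads 0, ..., j start at j, ..., 0 and end at j
    + 1 distinct positive numbers. Their sum rises to at least 1 + ... + (j + 1), that is by at
    least j + 1, and it rises by exactly \<open>sum_list ks\<close>.\<close>
  define S where "S = (\<lambda>c. nat (?d c + int j)) ` {..j}"
  have inj': "inj_on (\<lambda>c. nat (?d c + int j)) {..j}"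
  proof (rule inj_onI)
    fix c c' assume *: "c \<in> {..j}" "c' \<in> {..j}" "nat (?d c + int j) = nat (?d c' + int j)"
    then have "?d c = ?d c'" using pos[of c] pos[of c'] by simp
    then show "c = c'" using inj * j gs(3) by (auto simp: inj_on_def)
  qed
  have "\<Sum>{..card S} \<le> \<Sum>S"
  proof (rule gauss_le_sum)
    show "0 \<notin> S" using pos by (force simp: S_def)
  qed (simp add: S_def)
  also have "card S = Suc j" by (simp add: S_def card_image[OF inj'])
  also have "\<Sum>S = (\<Sum>c\<le>j. nat (?d c + int j))"
    unfolding S_def by (rule sum.reindex_cong[OF inj']) auto
  finally have "int (\<Sum>{..Suc j}) \<le> (\<Sum>c\<le>j. int (nat (?d c + int j)))"
    by (metis of_nat_le_iff of_nat_sum)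
  also have "\<dots> = (\<Sum>c\<le>j. (int j - int c) + bump (set (zip gs ks)) c)"
    using pos by (intro sum.cong) (force simp: displ_def)+
  also have "\<dots> = (\<Sum>c\<le>j. int (j - c)) + int (sum_list ks)"
    using sum_bump[OF gs(1,2) _ le] by (simp add: sum.distrib of_nat_diff)
  also have "(\<Sum>c\<le>j. int (j - c)) = (\<Sum>c\<le>j. int c)"
    by (rule sum.reindex_bij_witness[of _ "\<lambda>c. j - c" "\<lambda>c. j - c"]) auto
  finally show ?thesis using j(2) by simp
qed

text \<open>The values \<open>p k\<close> are left abstract so that one recursion covers the power
  sums as series, their truncations, and the weights of cycles.\<close>

fun path_poly :: "(nat \<Rightarrow> 'r :: comm_ring_1) \<Rightarrow> nat list \<Rightarrow> 'r" where
  "path_poly p [] = 1"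
| "path_poly p (k # ks) = p k * path_poly p ks + (\<Sum>i<length ks. path_poly p (ks[i := ks ! i + k]))"

definition bead_sum :: "(nat \<Rightarrow> 'r :: comm_ring_1) \<Rightarrow> nat \<Rightarrow> nat \<Rightarrow> nat list \<Rightarrow> 'r" where
  "bead_sum x N M ks = (\<Sum>gs\<in>dlists N (length ks). bead_poly x N M (displ ground_state gs ks))"

text \<open>One further bead is raised by \<open>k\<close>: a fresh one extends the list of moves,
  one already raised has its part enlarged. For an injective configuration the moved beads have
  index below \<open>sum_list ks\<close>, hence below \<open>N - k\<close>, so the \<open>k\<close>
  lowest beads are at rest as the action of the power sum requires; the other configurations
  contribute zero.\<close>

lemma bead_sum_Cons:
  assumes "sum_list (k # ks) \<le> N" "0 \<notin> set (k # ks)"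
  shows "bead_sum x N M (k # ks) = (- 1) ^ (k - 1) * (\<Sum>j<M. x j ^ k) * bead_sum x N M ks
      - (\<Sum>i<length ks. bead_sum x N M (ks[i := ks ! i + k]))"
proof -
  let ?D = "dlists N (length ks)"
  have rs: "raise_sum x N M k (displ ground_state gs ks)
      = (- 1) ^ (k - 1) * (\<Sum>j<M. x j ^ k) * bead_poly x N M (displ ground_state gs ks)" if "gs \<in> ?D" for gs
  proof (cases "inj_on (displ ground_state gs ks) {..<N}")
    case True
    have gs: "distinct gs" "length gs = length ks" "set gs \<subseteq> {..<N}"
      using that by (auto simp: dlists_def)
    have b: "g < N - k" if "g \<in> set gs" for g
      using displ_inj_bound[OF gs _ True that] assms by auto
    show ?thesis
    proof (rule raise_sum_bead_poly)
      fix c assume "N - k \<le> c" "c < N"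
      then have "c \<notin> set gs" using b by force
      then show "displ ground_state gs ks c = - int c" by (simp add: displ_def bump_notin)
    next
      fix c assume "c < N"
      moreover have "0 \<le> bump (set (zip gs ks)) c" unfolding bump_def by (intro sum_nonneg) auto
      ultimately show "- int N < displ ground_state gs ks c" by (simp add: displ_def)
    qed (use assms in auto)
  qed (simp add: raise_sum_not_inj bead_poly_not_inj)
  have split: "raise_sum x N M k (displ ground_state gs ks)
      = (\<Sum>i\<in>{..<N} - set gs. bead_poly x N M (displ ground_state (i # gs) (k # ks)))
        + (\<Sum>a<length ks. bead_poly x N M (displ ground_state gs (ks[a := ks ! a + k])))" if "gs \<in> ?D" for gs
  proof -
    have gs: "distinct gs" "length gs = length ks" "set gs \<subseteq> {..<N}"
      using that by (auto simp: dlists_def)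
    let ?f = "\<lambda>i. bead_poly x N M (raise (displ ground_state gs ks) i k)"
    have "raise_sum x N M k (displ ground_state gs ks) = sum ?f ({..<N} - set gs) + sum ?f (set gs)"
      unfolding raise_sum_def using gs(3) by (simp add: sum.subset_diff)
    also have "sum ?f (set gs) = (\<Sum>a<length ks. ?f (gs ! a))"
      using gs(1,2) by (intro sum.reindex_bij_betw[symmetric] bij_betw_nth) auto
    finally show ?thesis using gs by (simp add: displ_Cons displ_update)
  qed
  have "bead_sum x N M (k # ks)
      = (\<Sum>gs\<in>?D. \<Sum>i\<in>{..<N} - set gs. bead_poly x N M (displ ground_state (i # gs) (k # ks)))"
    unfolding bead_sum_def
    by (subst sum.Sigma, simp add: finite_dlists, simp,
        rule sum.reindex_bij_witness[of _ "\<lambda>(gs, i). i # gs" "\<lambda>l. (tl l, hd l)"])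
       (auto simp: dlists_def length_Suc_conv)
  also have "\<dots> = (\<Sum>gs\<in>?D. raise_sum x N M k (displ ground_state gs ks))
      - (\<Sum>gs\<in>?D. \<Sum>a<length ks. bead_poly x N M (displ ground_state gs (ks[a := ks ! a + k])))"
    by (simp add: split flip: sum_subtractf cong: sum.cong)
  also have "(\<Sum>gs\<in>?D. raise_sum x N M k (displ ground_state gs ks))
      = (- 1) ^ (k - 1) * (\<Sum>j<M. x j ^ k) * bead_sum x N M ks"
    by (simp add: rs bead_sum_def sum_distrib_left cong: sum.cong)
  also have "(\<Sum>gs\<in>?D. \<Sum>a<length ks. bead_poly x N M (displ ground_state gs (ks[a := ks ! a + k])))
      = (\<Sum>a<length ks. bead_sum x N M (ks[a := ks ! a + k]))"
    unfolding bead_sum_def by (subst sum.swap) simp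
  finally show ?thesis .
qed

text \<open>Merging two parts keeps the total and shortens the list by one. The sign (-1)^(total +
  length) therefore turns the minus of the bead recursion into the plus of the path recursion, and
  absorbs (-1)^(k-1) when the part \<open>k\<close> is split off.\<close>

lemma path_poly_power_sums:
  assumes "sum_list ks \<le> N" "0 \<notin> set ks"
  shows "path_poly (\<lambda>k. \<Sum>j<M. x j ^ k) ks = (- 1) ^ (sum_list ks + length ks) * bead_sum x N M ks"
  using assms
proof (induction "\<lambda>k. \<Sum>j<M. x j ^ k" ks rule: path_poly.induct)
  case 1
  have "dlists N 0 = {[]}" by (auto simp: dlists_def)
  moreover have "displ ground_state [] [] = (\<lambda>c. - int c)" by (auto simp: displ_def bump_def)
  ultimately show ?case by (simp add: bead_sum_def bead_poly_start)
next
  case (2 k ks)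
  let ?p = "\<lambda>k. \<Sum>j<M. x j ^ k"
  have k: "0 < k" using "2.prems" by auto
  have up: "sum_list (ks[i := ks ! i + k]) = sum_list (k # ks)" if "i < length ks" for i
    using that by (simp add: sum_list_update member_le_sum_list)
  have nz: "0 \<notin> set (ks[i := ks ! i + k])" if "i < length ks" for i
    using that k "2.prems" set_update_subset_insert by fastforce
  have IH1: "path_poly ?p ks = (- 1) ^ (sum_list ks + length ks) * bead_sum x N M ks"
    using "2.prems" by (intro "2.hyps") auto
  have IH2: "path_poly ?p (ks[i := ks ! i + k])
      = (- 1) ^ (sum_list (k # ks) + length ks) * bead_sum x N M (ks[i := ks ! i + k])"
    if "i < length ks" for i
    using "2.hyps"(2)[of i] up[OF that] nz[OF that] "2.prems" that by auto
  have IH2': "(\<Sum>i<length ks. path_poly ?p (ks[i := ks ! i + k]))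
      = (- 1) ^ (sum_list (k # ks) + length ks) * (\<Sum>i<length ks. bead_sum x N M (ks[i := ks ! i + k]))"
    unfolding sum_distrib_left by (intro sum.cong refl IH2) simp
  obtain m where m: "k = Suc m" using k by (cases k) auto
  let ?s = "sum_list ks" and ?B = "bead_sum x N M ks"
  let ?C = "\<Sum>i<length ks. bead_sum x N M (ks[i := ks ! i + k])"
  have s: "(- 1 :: 'a) ^ (sum_list (k # ks) + length (k # ks)) * (- 1) ^ (k - 1)
      = (- 1) ^ (?s + length ks)"
    "(- 1 :: 'a) ^ (sum_list (k # ks) + length (k # ks)) = - ((- 1) ^ (sum_list (k # ks) + length ks))"
    by (auto simp: m minus_one_power_iff)
  have "(- 1) ^ (sum_list (k # ks) + length (k # ks)) * ((- 1) ^ (k - 1) * ?p k * ?B - ?C)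
      = ((- 1) ^ (sum_list (k # ks) + length (k # ks)) * (- 1) ^ (k - 1)) * (?p k * ?B)
        - (- 1) ^ (sum_list (k # ks) + length (k # ks)) * ?C"
    by (simp only: right_diff_distrib mult.assoc)
  also have "\<dots> = (- 1) ^ (?s + length ks) * (?p k * ?B)
        + (- 1) ^ (sum_list (k # ks) + length ks) * ?C"
    unfolding s(1) unfolding s(2) by (simp only: mult_minus_left diff_minus_eq_add)
  finally show ?case
    unfolding bead_sum_Cons[OF "2.prems"] path_poly.simps IH1 IH2' by (simp only: mult.left_commute)
qed

section \<open>Column heights and Schur polynomials\<close>

definition column_diagram :: "(nat \<Rightarrow> nat) \<Rightarrow> (nat \<times> nat) set" where
  "column_diagram h = {(i, j). i < h j}"

definition heights :: "nat \<Rightarrow> (nat \<Rightarrow> nat) \<Rightarrow> bool" where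
  "heights N h \<longleftrightarrow> antimono h \<and> (\<forall>j\<ge>N. h j = 0)"

lemma heights_le: "heights N h \<Longrightarrow> i \<le> j \<Longrightarrow> h j \<le> h i"
  by (auto simp: heights_def dest: antimonoD)

lemma heights_pos: "heights N h \<Longrightarrow> 0 < h j \<Longrightarrow> j < N"
  by (metis heights_def leI less_irrefl)

lemma heights_mono: "heights N h \<Longrightarrow> N \<le> N' \<Longrightarrow> heights N' h"
  by (auto simp: heights_def)

lemma finite_column_diagram: "heights N h \<Longrightarrow> finite (column_diagram h)"
proof (rule finite_subset)
  assume h: "heights N h"
  show "column_diagram h \<subseteq> {..<h 0} \<times> {..<N}"
  proof (clarsimp simp: column_diagram_def)
    fix i j assume "i < h j"
    then show "i < h 0 \<and> j < N" using heights_pos[OF h, of j] heights_le[OF h, of 0 j] by simp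
  qed
qed simp

lemma down_closed_eq_lessThan:
  fixes A :: "nat set"
  assumes "finite A" "\<And>i i'. i \<in> A \<Longrightarrow> i' < i \<Longrightarrow> i' \<in> A"
  shows "A = {..<card A}"
proof (cases "A = {}")
  case False
  have "A = {..Max A}"
    using Max_in[OF assms(1) False] Max_ge[OF assms(1)] assms(2) by (auto simp: le_less)
  moreover from this have "card A = Suc (Max A)" by (metis card_atMost)
  ultimately show ?thesis by (simp add: lessThan_Suc_atMost)
qed simp

text \<open>\<open>h\<close> is the conjugate partition: the rows longer than \<open>j\<close> form
  an initial segment. The number of columns is bounded crudely, a single row being no longer than
  the sum of all rows.\<close>

lemma young_diagram_heights:
  assumes "is_partition lam"
  shows "\<exists>h. heights (sum_list lam) h \<and> young_diagram lam = column_diagram h"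
proof -
  define A where "A j = {i. i < length lam \<and> j < lam ! i}" for j
  have A: "A j = {..<card (A j)}" for j
  proof (rule down_closed_eq_lessThan)
    fix i i' assume *: "i \<in> A j" "i' < i"
    then have "lam ! i' \<ge> lam ! i"
      using assms by (auto simp: A_def is_partition_def sorted_wrt_iff_nth_less)
    then show "i' \<in> A j" using * by (auto simp: A_def)
  qed (simp add: A_def)
  define h where "h j = card (A j)" for j
  have m: "(i, j) \<in> young_diagram lam \<longleftrightarrow> i < h j" for i j
  proof -
    have "(i, j) \<in> young_diagram lam \<longleftrightarrow> i \<in> A j" by (simp add: young_diagram_def A_def)
    also have "\<dots> \<longleftrightarrow> i < h j" by (subst A) (simp add: h_def)
    finally show ?thesis .
  qed
  have "antimono h" unfolding h_def A_def by (intro antimonoI card_mono) auto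
  moreover have "h j = 0" if "j \<ge> sum_list lam" for j
  proof -
    have "lam ! i \<le> j" if "i < length lam" for i
      using member_le_sum_list[of "lam ! i" lam] that \<open>j \<ge> sum_list lam\<close> by simp
    then show ?thesis by (auto simp: h_def A_def not_less[symmetric])
  qed
  ultimately have "heights (sum_list lam) h" by (simp add: heights_def)
  moreover have "young_diagram lam = column_diagram h" using m by (auto simp: column_diagram_def)
  ultimately show ?thesis by blast
qed

lemma column_diagram_partition:
  assumes "heights N h"
  shows "\<exists>lam. is_partition lam \<and> young_diagram lam = column_diagram h"
proof -
  define A where "A i = {j. i < h j}" for i
  have fin: "finite (A i)" for i
    by (rule finite_subset[of _ "{..<N}"]) (use heights_pos[OF assms] in \<open>force simp: A_def\<close>)+
  have A: "A i = {..<card (A i)}" for i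
    using fin by (rule down_closed_eq_lessThan)
      (use heights_le[OF assms] in \<open>force simp: A_def dest: less_imp_le\<close>)
  define lam where "lam = map (\<lambda>i. card (A i)) [0..<h 0]"
  have "sorted_wrt (\<ge>) lam"
    unfolding lam_def sorted_wrt_map
    by (rule sorted_wrt_mono_rel[OF _ sorted_wrt_upt]) (auto intro!: card_mono fin[unfolded A_def] simp: A_def)
  moreover have "0 \<notin> set lam"
  proof -
    have "card (A i) \<noteq> 0" if "i < h 0" for i
      using that fin[of i] by (auto simp: A_def card_eq_0_iff)
    then show ?thesis unfolding lam_def set_map set_upt by fastforce
  qed
  moreover have "young_diagram lam = column_diagram h"
  proof (rule set_eqI, clarify)
    fix i j
    have "(i, j) \<in> young_diagram lam \<longleftrightarrow> i < h 0 \<and> j \<in> A i"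
      by (subst A) (auto simp: young_diagram_def lam_def)
    also have "\<dots> \<longleftrightarrow> i < h j" using heights_le[OF assms, of 0 j] by (auto simp: A_def)
    finally show "(i, j) \<in> young_diagram lam \<longleftrightarrow> (i, j) \<in> column_diagram h"
      by (simp add: column_diagram_def)
  qed
  ultimately show ?thesis unfolding is_partition_def by blast
qed

section \<open>Tableaux, horizontal strips and the dual Jacobi--Trudi identity\<close>

definition tableaux :: "nat \<Rightarrow> (nat \<times> nat) set \<Rightarrow> (nat \<times> nat \<Rightarrow> nat) set" where
  "tableaux M D = {t \<in> extensional D. (\<forall>c\<in>D. t c < M) \<and>
     (\<forall>i j j'. (i, j) \<in> D \<longrightarrow> (i, j') \<in> D \<longrightarrow> j < j' \<longrightarrow> t (i, j) \<le> t (i, j')) \<and>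
     (\<forall>i i' j. (i, j) \<in> D \<longrightarrow> (i', j) \<in> D \<longrightarrow> i < i' \<longrightarrow> t (i, j) < t (i', j))}"

definition tableau_poly :: "(nat \<Rightarrow> 'r :: comm_ring_1) \<Rightarrow> nat \<Rightarrow> (nat \<times> nat) set \<Rightarrow> 'r" where
  "tableau_poly x M D = (\<Sum>t\<in>tableaux M D. \<Prod>c\<in>D. x (t c))"

lemma finite_tableaux: "finite D \<Longrightarrow> finite (tableaux M D)"
  by (rule finite_subset[of _ "PiE D (\<lambda>_. {..<M})"]) (auto simp: tableaux_def PiE_def intro!: finite_PiE[unfolded PiE_def])

definition strip_heights :: "(nat \<Rightarrow> nat) \<Rightarrow> nat set \<Rightarrow> nat \<Rightarrow> nat" where
  "strip_heights h E j = h j - (if j \<in> E then 1 else 0)"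

text \<open>The sets of columns from whose bottom a horizontal strip can be removed.\<close>

definition strips :: "nat \<Rightarrow> (nat \<Rightarrow> nat) \<Rightarrow> nat set set" where
  "strips N h = {E. E \<subseteq> {..<N} \<and> (\<forall>c\<in>E. h (Suc c) = h c \<longrightarrow> Suc c \<in> E)}"

text \<open>An empty column has an empty right neighbour, so one such column in \<open>E\<close>
  would drag all columns to its right into the finite set \<open>E\<close>.\<close>

lemma strips_pos:
  assumes h: "heights N h" and E: "E \<in> strips N h" and c: "c \<in> E"
  shows "0 < h c"
proof (rule ccontr)
  assume "\<not> 0 < h c"
  have fin: "finite E" using E finite_subset by (auto simp: strips_def)
  have m: "Max E \<in> E" "c \<le> Max E" using fin c by (auto intro: Max_in)
  then have "h (Max E) = 0" "h (Suc (Max E)) = 0"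
    using heights_le[OF h, of c] \<open>\<not> 0 < h c\<close> by (metis le_zero_eq not_gr0, metis le_SucI le_zero_eq not_gr0)
  then have "Suc (Max E) \<in> E" using E m by (auto simp: strips_def)
  then show False using Max_ge[OF fin] by fastforce
qed

lemma strips_row:
  assumes h: "heights N h" and E: "E \<in> strips N h" and "c \<in> E" "c \<le> c'" "h c' = h c"
  shows "c' \<in> E"
  using assms(4,5)
proof (induction c' rule: dec_induct)
  case base
  show ?case by fact
next
  case (step k)
  then have "h (Suc k) \<le> h k" "h k \<le> h c"
    using heights_le[OF h, of k "Suc k"] heights_le[OF h, of c k] by simp_all
  then have "h k = h c" using step.prems by simp
  then show ?case using step E by (auto simp: strips_def)
qed

lemma strip_heights:
  assumes h: "heights N h" and E: "E \<in> strips N h"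
  shows "heights N (strip_heights h E)"
proof -
  have "antimono (strip_heights h E)"
  proof (rule antimonoI)
    fix i j :: nat assume "i \<le> j"
    then show "strip_heights h E j \<le> strip_heights h E i"
      using heights_le[OF h \<open>i \<le> j\<close>] strips_row[OF h E _ \<open>i \<le> j\<close>]
      by (cases "h j = h i") (auto simp: strip_heights_def)
  qed
  then show ?thesis using h by (auto simp: heights_def strip_heights_def)
qed

text \<open>If a column is lowered and its equally high right neighbour is not, the two beads
  collide. For the last bead the neighbour is the empty column \<open>N\<close>, and the bead drops
  to -N instead.\<close>

lemma bead_poly_not_strip:
  assumes h: "heights N h" and E: "E \<subseteq> {..<N}" "E \<notin> strips N h"
  shows "bead_poly x N M (lower (\<lambda>c. int (h c) - int c) E) = 0"
proof -
  obtain c where c: "c \<in> E" "h (Suc c) = h c" "Suc c \<notin> E" using E by (auto simp: strips_def)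
  show ?thesis
  proof (cases "Suc c < N")
    case True
    then show ?thesis using c by (intro bead_poly_repeated[of c N "Suc c"]) (auto simp: lower_def)
  next
    case False
    then have "h c = 0" "c < N" using c h E(1) by (auto simp: heights_def)
    then show ?thesis using c False by (intro bead_poly_low[of c]) (auto simp: lower_def)
  qed
qed

lemma column_diagram_strip:
  assumes h: "heights N h" and E: "E \<in> strips N h"
  shows "column_diagram h = column_diagram (strip_heights h E) \<union> (\<lambda>j. (h j - 1, j)) ` E"
    "column_diagram (strip_heights h E) \<inter> (\<lambda>j. (h j - 1, j)) ` E = {}"
  using strips_pos[OF h E] by (auto simp: column_diagram_def strip_heights_def image_iff split: if_splits)

text \<open>The value \<open>undefined\<close> outside the diagram keeps the filling extensional, so
  that it can be an element of \<open>tableaux\<close>.\<close>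

definition add_strip :: "nat \<Rightarrow> (nat \<Rightarrow> nat) \<Rightarrow> nat set \<Rightarrow> (nat \<times> nat \<Rightarrow> nat) \<Rightarrow> nat \<times> nat \<Rightarrow> nat" where
  "add_strip M h E t c = (if c \<in> column_diagram (strip_heights h E) then t c
     else if c \<in> column_diagram h then M else undefined)"

definition max_strip :: "nat \<Rightarrow> (nat \<Rightarrow> nat) \<Rightarrow> (nat \<times> nat \<Rightarrow> nat) \<Rightarrow> nat set" where
  "max_strip M h t = {j. 0 < h j \<and> t (h j - 1, j) = M}"

lemma add_strip_tableau:
  assumes h: "heights N h" and E: "E \<in> strips N h"
    and t: "t \<in> tableaux M (column_diagram (strip_heights h E))"
  shows "add_strip M h E t \<in> tableaux (Suc M) (column_diagram h)"
    "max_strip M h (add_strip M h E t) = E"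
    "restrict (add_strip M h E t) (column_diagram (strip_heights h E)) = t"
proof -
  let ?D' = "column_diagram (strip_heights h E)" and ?D = "column_diagram h" and ?s = "add_strip M h E t"
  have lt: "t c < M" if "c \<in> ?D'" for c using t that by (auto simp: tableaux_def)
  have sub: "?D' \<subseteq> ?D" using column_diagram_strip(1)[OF h E] by blast
  have out: "j \<in> E \<and> i = h j - 1" if "(i, j) \<in> ?D" "(i, j) \<notin> ?D'" for i j
    using that column_diagram_strip(1)[OF h E] by auto
  have row: "?s (i, j) \<le> ?s (i, j')" if *: "(i, j) \<in> ?D" "(i, j') \<in> ?D" "j < j'" for i j j'
  proof (cases "(i, j) \<in> ?D'")
    case True
    note D' = True
    show ?thesis
    proof (cases "(i, j') \<in> ?D'")
      case True
      then show ?thesis using * t D' by (simp add: add_strip_def tableaux_def)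
    next
      case False
      then have "?s (i, j') = M" "?s (i, j) = t (i, j)"
        using *(2) D' by (simp_all add: add_strip_def)
      then show ?thesis using lt[OF D'] by simp
    qed
  next
    case False
    then have j: "j \<in> E" "i = h j - 1" using out[OF *(1)] by auto
    \<comment> \<open>The cell is at the bottom of its column, so a cell further right in the same
      row is also at the bottom of a column of the same height; that column belongs to the strip,
      and both cells carry \<open>M\<close>.\<close>
    have "h j' = h j"
      using * j heights_le[OF h, of j j'] by (auto simp: column_diagram_def)
    then have "j' \<in> E" using strips_row[OF h E j(1), of j'] *(3) by simp
    then have "(i, j') \<notin> ?D'" using j \<open>h j' = h j\<close> by (auto simp: column_diagram_def strip_heights_def)
    then show ?thesis using * False by (simp add: add_strip_def)
  qed
  have col: "?s (i, j) < ?s (i', j)" if *: "(i, j) \<in> ?D" "(i', j) \<in> ?D" "i < i'" for i i' j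
  proof -
    have D': "(i, j) \<in> ?D'" using * by (auto simp: column_diagram_def strip_heights_def)
    then show ?thesis using * t lt[OF D'] by (auto simp: add_strip_def tableaux_def)
  qed
  have "?s c < Suc M" if "c \<in> ?D" for c
    using that lt[of c] by (auto simp: add_strip_def)
  moreover have "?s \<in> extensional ?D"
    using sub by (auto simp: add_strip_def extensional_def)
  ultimately show "?s \<in> tableaux (Suc M) ?D" using row col by (auto simp: tableaux_def)
  show "restrict ?s ?D' = t"
    using t by (auto simp: fun_eq_iff add_strip_def tableaux_def extensional_def restrict_def)
  show "max_strip M h ?s = E"
  proof (rule set_eqI)
    fix j
    show "j \<in> max_strip M h ?s \<longleftrightarrow> j \<in> E"
    proof (cases "j \<in> E")
      case True
      then have "(h j - 1, j) \<notin> ?D'" "(h j - 1, j) \<in> ?D" "0 < h j"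
        using strips_pos[OF h E True] by (auto simp: column_diagram_def strip_heights_def)
      then show ?thesis using True by (simp add: max_strip_def add_strip_def)
    next
      case False
      have "?s (h j - 1, j) \<noteq> M" if "0 < h j"
      proof -
        have "(h j - 1, j) \<in> ?D'" using that False by (auto simp: column_diagram_def strip_heights_def)
        then show ?thesis using lt by (auto simp: add_strip_def)
      qed
      then show ?thesis using False by (auto simp: max_strip_def)
    qed
  qed
qed

text \<open>Strict columns confine the largest entry \<open>M\<close> to the bottoms of columns, and
  weakly increasing rows pass it on to an equally high right neighbour, which is the strip
  condition.\<close>

lemma max_strip_tableau:
  assumes h: "heights N h" and t: "t \<in> tableaux (Suc M) (column_diagram h)"
  defines "E \<equiv> max_strip M h t"
  shows "E \<in> strips N h"
    "restrict t (column_diagram (strip_heights h E)) \<in> tableaux M (column_diagram (strip_heights h E))"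
    "add_strip M h E (restrict t (column_diagram (strip_heights h E))) = t"
proof -
  let ?D' = "column_diagram (strip_heights h E)" and ?D = "column_diagram h"
  have lt: "t c < Suc M" if "c \<in> ?D" for c using t that by (auto simp: tableaux_def)
  show E: "E \<in> strips N h"
    unfolding strips_def
  proof (intro CollectI conjI ballI impI subsetI)
    fix c assume "c \<in> E" then show "c \<in> {..<N}" using heights_pos[OF h] by (auto simp: E_def max_strip_def)
  next
    fix c assume c: "c \<in> E" "h (Suc c) = h c"
    then have hc: "0 < h c" "t (h c - 1, c) = M" by (auto simp: E_def max_strip_def)
    then have D: "(h c - 1, c) \<in> ?D" "(h c - 1, Suc c) \<in> ?D" using c by (auto simp: column_diagram_def)
    then have "t (h c - 1, c) \<le> t (h c - 1, Suc c)" using t by (auto simp: tableaux_def)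
    then have "t (h c - 1, Suc c) = M" using lt[OF D(2)] hc by simp
    then show "Suc c \<in> E" using c hc by (simp add: E_def max_strip_def)
  qed
  have sub: "?D' \<subseteq> ?D" using column_diagram_strip(1)[OF h E] by blast
  have lt': "t (i, j) < M" if "(i, j) \<in> ?D'" for i j
  proof (cases "i = h j - 1")
    case True
    then have "j \<notin> E" "0 < h j" using that by (auto simp: column_diagram_def strip_heights_def split: if_splits)
    then show ?thesis using lt[of "(i, j)"] that sub True by (auto simp: E_def max_strip_def less_Suc_eq)
  next
    case False
    then have "i < h j - 1" "(h j - 1, j) \<in> ?D" "(i, j) \<in> ?D"
      using that sub by (auto simp: column_diagram_def)
    then have "t (i, j) < t (h j - 1, j)" using t by (auto simp: tableaux_def)
    then show ?thesis using lt[OF \<open>(h j - 1, j) \<in> ?D\<close>] by simp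
  qed
  show "restrict t ?D' \<in> tableaux M ?D'"
    using t lt' sub unfolding tableaux_def by (auto simp: subset_iff)
  show "add_strip M h E (restrict t ?D') = t"
  proof
    fix c :: "nat \<times> nat"
    obtain i j where c: "c = (i, j)" by fastforce
    consider "c \<in> ?D'" | "c \<in> ?D" "c \<notin> ?D'" | "c \<notin> ?D" by blast
    then show "add_strip M h E (restrict t ?D') c = t c"
    proof cases
      case 2
      then have "j \<in> E" "i = h j - 1" using c column_diagram_strip(1)[OF h E] by auto
      then show ?thesis using 2 c by (auto simp: add_strip_def E_def max_strip_def)
    next
      case 3
      have "t c = undefined" by (rule extensional_arb[OF _ 3]) (use t in \<open>simp add: tableaux_def\<close>)
      then show ?thesis using 3 sub by (auto simp: add_strip_def)
    qed (simp add: add_strip_def)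
  qed
qed

lemma prod_add_strip:
  assumes h: "heights N h" and E: "E \<in> strips N h"
  shows "(\<Prod>c\<in>column_diagram h. x (add_strip M h E t c))
    = x M ^ card E * (\<Prod>c\<in>column_diagram (strip_heights h E). x (t c))"
proof -
  let ?D' = "column_diagram (strip_heights h E)" and ?S = "(\<lambda>j. (h j - 1, j)) ` E"
  have fin: "finite E" using E finite_subset by (auto simp: strips_def)
  have "(\<Prod>c\<in>column_diagram h. x (add_strip M h E t c))
      = (\<Prod>c\<in>?D'. x (add_strip M h E t c)) * (\<Prod>c\<in>?S. x (add_strip M h E t c))"
    using column_diagram_strip[OF h E] fin
    by (simp add: prod.union_disjoint finite_column_diagram[OF strip_heights[OF h E]])
  also have "(\<Prod>c\<in>?D'. x (add_strip M h E t c)) = (\<Prod>c\<in>?D'. x (t c))"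
    by (intro prod.cong) (auto simp: add_strip_def)
  also have "(\<Prod>c\<in>?S. x (add_strip M h E t c)) = (\<Prod>c\<in>?S. x M)"
  proof (rule prod.cong[OF refl])
    fix c assume "c \<in> ?S"
    then have "c \<notin> ?D'" "c \<in> column_diagram h" using column_diagram_strip[OF h E] by blast+
    then show "x (add_strip M h E t c) = x M" by (simp add: add_strip_def)
  qed
  also have "\<dots> = x M ^ card E" by (simp add: card_image inj_on_def)
  finally show ?thesis by (simp add: mult.commute)
qed

text \<open>Both sides obey the branching rule that removes the horizontal strip of cells with the
  largest entry: on the bead side the sets \<open>E\<close> that are not strips vanish, and the
  strips lower exactly the beads of the shortened columns.\<close>

lemma tableau_poly_bead_poly:
  assumes "heights N h"
  shows "tableau_poly x M (column_diagram h) = bead_poly x N M (\<lambda>c. int (h c) - int c)"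
  using assms
proof (induction M arbitrary: h)
  case 0
  show ?case
  proof (cases "column_diagram h = {}")
    case True
    then have "h j = 0" for j by (auto simp: column_diagram_def)
    moreover have "tableaux 0 ({} :: (nat \<times> nat) set) = {\<lambda>_. undefined}"
      by (auto simp: tableaux_def)
    moreover have "ground N (\<lambda>c. int (h c) - int c) = (1 :: 'a)"
      using \<open>\<And>j. h j = 0\<close> ground_start[of N] by simp
    ultimately show ?thesis unfolding bead_poly.simps tableau_poly_def True by simp
  next
    case False
    then obtain i j where "i < h j" by (auto simp: column_diagram_def)
    \<comment> \<open>The first bead lies above 0, which is no ground position, so the determinant
      without variables vanishes; there is no tableau without entries either.\<close>
    then have "0 < h 0" using heights_le[OF 0, of 0 j] by simp
    moreover from this have "0 < N" by (rule heights_pos[OF 0])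
    ultimately have "ground N (\<lambda>c. int (h c) - int c) = 0" by (intro ground_eq_0I) force
    moreover have "tableaux 0 (column_diagram h) = {}" using False by (auto simp: tableaux_def)
    ultimately show ?thesis by (simp add: tableau_poly_def)
  qed
next
  case (Suc M)
  note h = Suc.prems
  let ?b = "\<lambda>c. int (h c) - int c" and ?D' = "\<lambda>E. column_diagram (strip_heights h E)"
  have fin: "finite (strips N h)" by (rule finite_subset[of _ "Pow {..<N}"]) (auto simp: strips_def)
  have "bead_poly x N (Suc M) ?b = (\<Sum>E\<in>strips N h. x M ^ card E * bead_poly x N M (lower ?b E))"
    unfolding bead_poly.simps
  proof (rule sum.mono_neutral_right)
    show "strips N h \<subseteq> Pow {..<N}" by (auto simp: strips_def)
    show "\<forall>E\<in>Pow {..<N} - strips N h. x M ^ card E * bead_poly x N M (lower ?b E) = 0"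
      by (auto simp: bead_poly_not_strip[OF h])
  qed simp
  also have "\<dots> = (\<Sum>E\<in>strips N h. x M ^ card E * tableau_poly x M (?D' E))"
  proof (rule sum.cong[OF refl])
    fix E assume E: "E \<in> strips N h"
    have "lower ?b E = (\<lambda>c. int (strip_heights h E c) - int c)"
    proof
      fix c show "lower ?b E c = int (strip_heights h E c) - int c"
        using strips_pos[OF h E, of c] by (auto simp: lower_def strip_heights_def)
    qed
    then show "x M ^ card E * bead_poly x N M (lower ?b E) = x M ^ card E * tableau_poly x M (?D' E)"
      using Suc.IH[OF strip_heights[OF h E]] by simp
  qed
  also have "\<dots> = (\<Sum>E\<in>strips N h. \<Sum>t\<in>tableaux M (?D' E). \<Prod>c\<in>column_diagram h. x (add_strip M h E t c))"
    unfolding tableau_poly_def sum_distrib_left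
    by (intro sum.cong refl prod_add_strip[OF h, symmetric])
  also have "\<dots> = (\<Sum>(E, t)\<in>(SIGMA E:strips N h. tableaux M (?D' E)). \<Prod>c\<in>column_diagram h. x (add_strip M h E t c))"
    using strip_heights[OF h] by (intro sum.Sigma fin ballI finite_tableaux finite_column_diagram)
  also have "\<dots> = tableau_poly x (Suc M) (column_diagram h)"
    unfolding tableau_poly_def
    by (rule sum.reindex_bij_witness[of _
          "\<lambda>t. (max_strip M h t, restrict t (?D' (max_strip M h t)))"
          "\<lambda>(E, t). add_strip M h E t"])
       (use max_strip_tableau[OF h] add_strip_tableau[OF h] in auto)
  finally show ?case ..
qed

section \<open>Permutations extending a family of paths\<close>

definition path_extensions :: "'a list list \<Rightarrow> ('a \<Rightarrow> 'a) set" where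
  "path_extensions P = {w. w permutes set (concat P) \<and> (\<forall>p\<in>set P. successively (\<lambda>a b. w a = b) p)}"

text \<open>Indexing by the set of orbits counts each cycle once. For \<open>p = power_sum\<close>
  this is the power sum of the cycle type.\<close>

definition cycle_weight :: "(nat \<Rightarrow> 'r :: comm_ring_1) \<Rightarrow> 'a set \<Rightarrow> ('a \<Rightarrow> 'a) \<Rightarrow> 'r" where
  "cycle_weight p S w = (\<Prod>c\<in>orbit w ` S. p (card c))"

text \<open>A single equation between lists captures the edges of a path together with the edge that
  closes it; the cycle built from the list satisfies this equation.\<close>

lemma map_eq_rotate1_iff:
  assumes "q \<noteq> []"
  shows "map w q = rotate1 q \<longleftrightarrow> successively (\<lambda>a b. w a = b) q \<and> w (last q) = hd q"
proof -
  have "map w (a # l) = l @ [z] \<longleftrightarrow> successively (\<lambda>a b. w a = b) (a # l) \<and> w (last (a # l)) = z" for a l z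
    by (induction l arbitrary: a) auto
  then show ?thesis using assms by (cases q) auto
qed

lemma cyclic_on_rotate1:
  assumes "q \<noteq> []" "map w q = rotate1 q"
  shows "cyclic_on w (set q)"
proof -
  have im: "w ` set q = set q" using assms(2) by (metis set_map set_rotate1)
  have "set q = orbit w (last q)"
  proof
    have "q ! k \<in> orbit w (last q)" if "k < length q" for k
      using that
    proof (induction k)
      case 0
      then have "w (last q) = q ! 0" using assms map_eq_rotate1_iff[of q w] by (simp add: hd_conv_nth)
      then show ?case using orbit.base by metis
    next
      case (Suc k)
      then have "w (q ! k) = q ! Suc k"
        using assms map_eq_rotate1_iff[of q w] by (auto simp: successively_conv_nth)
      then show ?case using Suc orbit.step by (metis Suc_lessD)
    qed
    then show "set q \<subseteq> orbit w (last q)" by (auto simp: in_set_conv_nth)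
    show "orbit w (last q) \<subseteq> set q"
    proof
      fix y assume "y \<in> orbit w (last q)"
      then show "y \<in> set q" using im assms(1) by induction auto
    qed
  qed
  then show ?thesis using assms(1) by (auto simp: cyclic_on_def)
qed

lemma mset_concat_update:
  assumes "i < length Ps"
  shows "mset (concat (Ps[i := q @ Ps ! i])) = mset (q @ concat Ps)"
proof -
  have "concat Ps = concat (take i Ps) @ Ps ! i @ concat (drop (Suc i) Ps)"
    by (subst id_take_nth_drop[OF assms]) simp
  then show ?thesis using assms by (simp add: upd_conv_take_nth_drop)
qed

lemma distinct_concat_nth_disjoint:
  assumes "distinct (concat Ps)" "[] \<notin> set Ps" "i < length Ps" "j < length Ps" "i \<noteq> j"
  shows "set (Ps ! i) \<inter> set (Ps ! j) = {}"
proof -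
  have "distinct Ps" using assms(1,2) by (simp add: distinct_concat_iff)
  then have "Ps ! i \<noteq> Ps ! j" using assms by (simp add: nth_eq_iff_index_eq)
  then show ?thesis using assms by (simp add: distinct_concat_iff)
qed

text \<open>A vertex that is not the first of its path is already the image of its predecessor. As
  \<open>w\<close> is injective, only first vertices are left for the end of
  \<open>q\<close>.\<close>

lemma path_extensions_last:
  assumes d: "distinct (concat (q # Ps))" and ne: "[] \<notin> set (q # Ps)"
    and w: "w \<in> path_extensions (q # Ps)"
  shows "w (last q) = hd q \<or> (\<exists>i<length Ps. w (last q) = hd (Ps ! i))"
proof -
  have q: "q \<noteq> []" using ne by auto
  have perm: "w permutes set (concat (q # Ps))"
    and succ: "\<forall>p\<in>set (q # Ps). successively (\<lambda>a b. w a = b) p"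
    using w by (auto simp: path_extensions_def)
  have "last q \<in> set (concat (q # Ps))" using q by simp
  then have "w (last q) \<in> set (concat (q # Ps))" using permutes_in_image[OF perm] by blast
  then obtain p where p: "p \<in> set (q # Ps)" "w (last q) \<in> set p" by auto
  then obtain k where k: "k < length p" "w (last q) = p ! k" by (metis in_set_conv_nth)
  have "k = 0"
  proof (rule ccontr)
    assume "k \<noteq> 0"
    then obtain k' where k': "k = Suc k'" by (cases k) auto
    then have "w (p ! k') = w (last q)" using succ p(1) k by (auto simp: successively_conv_nth)
    then have e: "p ! k' = last q" using permutes_inj[OF perm] by (metis injD)
    show False
    proof (cases "p = q")
      case True
      have "q ! k' = q ! (length q - 1)" using e True q by (simp add: last_conv_nth)
      then have "k' = length q - 1" using d q k k' True by (subst (asm) nth_eq_iff_index_eq) auto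
      then show False using k k' True by auto
    next
      case False
      then have "p \<in> set Ps" using p by auto
      moreover have "last q \<in> set p" using e k k' by (metis Suc_lessD nth_mem)
      moreover have "last q \<in> set q" using q by simp
      ultimately show False using d by auto
    qed
  qed
  then have "w (last q) = hd p" using k by (metis hd_conv_nth length_greater_0_conv)
  then show ?thesis using p(1) by (auto simp: in_set_conv_nth)
qed

text \<open>Sending the end of \<open>q\<close> to the start of another path means prescribing the
  edges of the concatenated path.\<close>

lemma path_extensions_update:
  assumes "q \<noteq> []" "[] \<notin> set Ps" "i < length Ps"
  shows "path_extensions (Ps[i := q @ Ps ! i])
    = {w \<in> path_extensions (q # Ps). w (last q) = hd (Ps ! i)}"
proof -
  have ne: "Ps ! i \<noteq> []" using assms by (metis nth_mem)
  have "set (concat (Ps[i := q @ Ps ! i])) = set (concat (q # Ps))"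
    using mset_concat_update[OF assms(3), of q] by (metis concat.simps(2) mset_eq_setD)
  moreover have "(\<forall>p\<in>set (Ps[i := q @ Ps ! i]). successively (\<lambda>a b. w a = b) p) \<longleftrightarrow>
      (\<forall>p\<in>set (q # Ps). successively (\<lambda>a b. w a = b) p) \<and> w (last q) = hd (Ps ! i)" for w
    using assms ne by (auto simp: all_set_conv_all_nth nth_list_update successively_append_iff)
  ultimately show ?thesis
    by (intro set_eqI) (simp only: path_extensions_def mem_Collect_eq conj_assoc)
qed

text \<open>The two factors have disjoint supports, so the composite has the orbits of
  \<open>w\<close> on \<open>S\<close> and the new orbit \<open>set q\<close>, which is not among
  them.\<close>

lemma cycle_weight_closed:
  assumes d: "set q \<inter> S = {}" "q \<noteq> []" "distinct q" "finite S"
    and w: "w permutes S" and c: "c permutes set q" "map c q = rotate1 q"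
  shows "cycle_weight p (set q \<union> S) (w \<circ> c) = p (length q) * cycle_weight p S w"
proof -
  let ?v = "w \<circ> c"
  have vq: "?v x = c x" if "x \<in> set q" for x
  proof -
    have "c x \<in> set q" using permutes_in_image[OF c(1)] that by simp
    then show ?thesis using w d(1) by (auto simp: permutes_def)
  qed
  have vS: "?v x = w x" if "x \<in> S" for x using that d(1) c(1) by (auto simp: permutes_def)
  have "map ?v q = rotate1 q" using vq c(2) by (metis map_cong)
  then have "cyclic_on ?v (set q)" using d(2) by (rule cyclic_on_rotate1[rotated])
  then have "orbit ?v x = set q" if "x \<in> set q" for x using that by (rule orbit_cyclic_eq3)
  then have "orbit ?v ` set q = {set q}" using d(2) by (cases q) auto
  moreover have oS: "orbit ?v x = orbit w x" if "x \<in> S" for x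
    by (rule orbit_cong0[OF that]) (use vS permutes_in_image[OF w] in auto)
  ultimately have o: "orbit ?v ` (set q \<union> S) = insert (set q) (orbit w ` S)"
    by (auto simp: image_Un)
  have "hd q \<in> set q" using d(2) by simp
  then have "hd q \<notin> S" using d(1) by blast
  then have "set q \<notin> orbit w ` S" using permutes_orbit_subset[OF w] \<open>hd q \<in> set q\<close> by blast
  then show ?thesis using d unfolding cycle_weight_def o by (simp add: distinct_card)
qed

text \<open>Composition with the cycle of \<open>q\<close> maps the extensions of \<open>Ps\<close>
  bijectively onto the extensions of \<open>q # Ps\<close> that close \<open>q\<close>; the inverse
  restricts a permutation to the remaining vertices.\<close>

lemma path_extensions_closed:
  assumes d: "distinct (concat (q # Ps))" and ne: "[] \<notin> set (q # Ps)"
  shows "(\<Sum>w | w \<in> path_extensions (q # Ps) \<and> w (last q) = hd q.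
        cycle_weight p (set (concat (q # Ps))) w)
      = p (length q) * (\<Sum>w\<in>path_extensions Ps. cycle_weight p (set (concat Ps)) w)"
proof -
  let ?S = "set (concat Ps)" and ?c = "cycle_of_list q"
  have q: "q \<noteq> []" "distinct q" "set q \<inter> ?S = {}" using d ne by auto
  have c: "?c permutes set q" by (rule cycle_permutes)
  have rc: "map ?c q = rotate1 q" using cyclic_rotation[OF q(2), of 1] by simp
  have sc: "successively (\<lambda>a b. ?c a = b) q" "?c (last q) = hd q"
    using rc map_eq_rotate1_iff[OF q(1)] by auto
  have Sq: "set (concat (q # Ps)) - set q = ?S" using q(3) by auto
  have *: "perm_restrict w ?S \<in> path_extensions Ps" "perm_restrict w ?S \<circ> ?c = w"
    if "w \<in> path_extensions (q # Ps)" "w (last q) = hd q" for w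
  proof -
    have w: "w permutes set (concat (q # Ps))" "\<forall>p\<in>set (q # Ps). successively (\<lambda>a b. w a = b) p"
      using that by (auto simp: path_extensions_def)
    then have rw: "map w q = rotate1 q" using that(2) map_eq_rotate1_iff[OF q(1)] by auto
    have perm: "perm_restrict w ?S permutes ?S"
      using perm_restrict_diff_cyclic[OF w(1) cyclic_on_rotate1[OF q(1) rw]] Sq by simp
    have "successively (\<lambda>a b. perm_restrict w ?S a = b) r" if "r \<in> set Ps" for r
    proof -
      have "successively (\<lambda>a b. w a = b) r" using w(2) that by auto
      moreover have "perm_restrict w ?S a = w a" if "a \<in> set r" for a
        using that \<open>r \<in> set Ps\<close> by (intro perm_restrict_simps(1)) auto
      ultimately show ?thesis by (auto simp: successively_conv_nth)
    qed
    then show "perm_restrict w ?S \<in> path_extensions Ps" using perm by (simp add: path_extensions_def)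
    show "perm_restrict w ?S \<circ> ?c = w"
    proof
      fix x
      consider "x \<in> set q" | "x \<in> ?S" | "x \<notin> set (concat (q # Ps))" by auto
      then show "(perm_restrict w ?S \<circ> ?c) x = w x"
      proof cases
        case 1
        then have "?c x = w x" using rc rw by (metis map_eq_conv)
        moreover have "?c x \<in> set q" using permutes_in_image[OF c] 1 by simp
        ultimately show ?thesis using q(3) by (auto simp: perm_restrict_def)
      next
        case 2
        then have "?c x = x" using c q(3) by (auto simp: permutes_def)
        then show ?thesis using 2 by (simp add: perm_restrict_def)
      next
        case 3
        then have "?c x = x" "w x = x" using c w(1) by (auto simp: permutes_def)
        then show ?thesis by (simp add: perm_restrict_def)
      qed
    qed
  qed
  have **: "w \<circ> ?c \<in> path_extensions (q # Ps)" "(w \<circ> ?c) (last q) = hd q"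
    "perm_restrict (w \<circ> ?c) ?S = w" if "w \<in> path_extensions Ps" for w
  proof -
    have w: "w permutes ?S" "\<forall>p\<in>set Ps. successively (\<lambda>a b. w a = b) p"
      using that by (auto simp: path_extensions_def)
    have vq: "(w \<circ> ?c) x = ?c x" if "x \<in> set q" for x
    proof -
      have "?c x \<in> set q" using permutes_in_image[OF c] that by simp
      then have "?c x \<notin> ?S" using q(3) by blast
      then show ?thesis using permutes_not_in[OF w(1)] by simp
    qed
    have vS: "(w \<circ> ?c) x = w x" if "x \<notin> set q" for x using that c by (auto simp: permutes_def)
    show "(w \<circ> ?c) (last q) = hd q" using vq[of "last q"] q(1) sc(2) by simp
    have "w permutes set (concat (q # Ps))" "?c permutes set (concat (q # Ps))"
      by (rule permutes_subset[OF w(1)], simp, rule permutes_subset[OF c], simp)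
    then have "w \<circ> ?c permutes set (concat (q # Ps))" by (rule permutes_compose[rotated])
    moreover have "successively (\<lambda>a b. (w \<circ> ?c) a = b) q"
      using sc(1) vq by (auto simp: successively_conv_nth)
    moreover have "successively (\<lambda>a b. (w \<circ> ?c) a = b) r" if "r \<in> set Ps" for r
    proof -
      have "(w \<circ> ?c) x = w x" if "x \<in> set r" for x
        using that \<open>r \<in> set Ps\<close> q(3) by (intro vS) auto
      then show ?thesis using w(2) \<open>r \<in> set Ps\<close> by (auto simp: successively_conv_nth)
    qed
    ultimately show "w \<circ> ?c \<in> path_extensions (q # Ps)" by (simp add: path_extensions_def)
    show "perm_restrict (w \<circ> ?c) ?S = w"
    proof
      fix x
      show "perm_restrict (w \<circ> ?c) ?S x = w x"
        using vS[of x] q(3) w(1) by (cases "x \<in> ?S") (auto simp: perm_restrict_def permutes_def)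
    qed
  qed
  have "(\<Sum>w | w \<in> path_extensions (q # Ps) \<and> w (last q) = hd q.
        cycle_weight p (set (concat (q # Ps))) w)
      = (\<Sum>w\<in>path_extensions Ps. cycle_weight p (set (concat (q # Ps))) (w \<circ> ?c))"
    by (rule sum.reindex_bij_witness[of _ "\<lambda>w. w \<circ> ?c" "\<lambda>w. perm_restrict w ?S"])
       (use * ** in auto)
  also have "\<dots> = (\<Sum>w\<in>path_extensions Ps. p (length q) * cycle_weight p ?S w)"
  proof (rule sum.cong[OF refl])
    fix w assume "w \<in> path_extensions Ps"
    then have w: "w permutes ?S" by (simp add: path_extensions_def)
    show "cycle_weight p (set (concat (q # Ps))) (w \<circ> ?c) = p (length q) * cycle_weight p ?S w"
      using cycle_weight_closed[OF q(3,1,2) _ w c rc] by simp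
  qed
  finally show ?thesis by (simp add: sum_distrib_left)
qed

lemma finite_path_extensions: "finite (path_extensions P)"
  by (rule finite_subset[OF _ finite_permutations[of "set (concat P)"]]) (auto simp: path_extensions_def)

text \<open>The extensions are classified by the image of \<open>last q\<close>. The classes are
  disjoint because distinct nonempty paths have distinct first vertices, and joining two paths
  leaves the vertex set unchanged, so the weight is taken over the same set.\<close>

lemma sum_cycle_weight:
  assumes "distinct (concat P)" "[] \<notin> set P"
  shows "(\<Sum>w\<in>path_extensions P. cycle_weight p (set (concat P)) w) = path_poly p (map length P)"
  using assms
proof (induction p "map length P" arbitrary: P rule: path_poly.induct)
  case (1 p)
  then have "P = []" by simp
  then have "path_extensions P = {id}" by (auto simp: path_extensions_def permutes_def fun_eq_iff)
  then show ?case using \<open>P = []\<close> by (simp add: cycle_weight_def)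
next
  case (2 p k ks)
  obtain q Ps where P: "P = q # Ps" and k: "k = length q" and ks: "ks = map length Ps"
    using "2.hyps"(3) by (cases P) auto
  have d: "distinct (concat (q # Ps))" "[] \<notin> set (q # Ps)" using "2.prems" P by auto
  have q: "q \<noteq> []" using d by auto
  let ?W = "path_extensions (q # Ps)" and ?S = "set (concat (q # Ps))"
  let ?U = "\<lambda>i. Ps[i := q @ Ps ! i]"
  have hd_in: "hd (Ps ! i) \<in> set (Ps ! i)" if "i < length Ps" for i
    using d(2) that by (metis hd_in_set list.set_intros(2) nth_mem)
  have W: "?W = {w \<in> ?W. w (last q) = hd q} \<union> (\<Union>i<length Ps. path_extensions (?U i))"
    using path_extensions_last[OF d] path_extensions_update[of q Ps] q d(2) by auto
  have dis: "{w \<in> ?W. w (last q) = hd q} \<inter> (\<Union>i<length Ps. path_extensions (?U i)) = {}"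
  proof -
    have "hd (Ps ! i) \<noteq> hd q" if "i < length Ps" for i
    proof -
      have "hd q \<in> set q" "hd (Ps ! i) \<in> set (concat Ps)" using q hd_in[OF that] that by auto
      moreover have "set q \<inter> set (concat Ps) = {}" using d(1) by auto
      ultimately show ?thesis by (metis disjoint_iff)
    qed
    then show ?thesis using path_extensions_update[of q Ps] q d(2) by auto
  qed
  have dis2: "path_extensions (?U i) \<inter> path_extensions (?U j) = {}"
    if "i < length Ps" "j < length Ps" "i \<noteq> j" for i j
  proof -
    have "hd (Ps ! i) \<noteq> hd (Ps ! j)"
      using distinct_concat_nth_disjoint[of Ps i j] hd_in[OF that(1)] hd_in[OF that(2)] that d
      by (auto simp: disjoint_iff)
    then show ?thesis using path_extensions_update[of q Ps] q d(2) that by auto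
  qed
  have IH: "(\<Sum>w\<in>path_extensions (?U i). cycle_weight p ?S w) = path_poly p (ks[i := ks ! i + k])"
    if i: "i < length Ps" for i
  proof -
    have m: "mset (concat (?U i)) = mset (concat (q # Ps))"
      using mset_concat_update[OF i, of q] by simp
    have U: "ks[i := ks ! i + k] = map length (?U i)"
      using i by (simp add: ks k map_update add.commute)
    have "(\<Sum>w\<in>path_extensions (?U i). cycle_weight p (set (concat (?U i))) w)
        = path_poly p (map length (?U i))"
    proof (rule "2.hyps"(2))
      show "ks[i := ks ! i + k] = map length (?U i)" by (fact U)
      show "distinct (concat (?U i))" using m d(1) mset_eq_imp_distinct_iff by blast
      show "[] \<notin> set (?U i)" using d(2) q set_update_subset_insert[of Ps i] by fastforce
    qed (use i ks in simp)
    then show ?thesis by (simp only: U mset_eq_setD[OF m])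
  qed
  have "(\<Sum>w\<in>?W. cycle_weight p ?S w)
      = (\<Sum>w | w \<in> ?W \<and> w (last q) = hd q. cycle_weight p ?S w)
        + (\<Sum>w\<in>(\<Union>i<length Ps. path_extensions (?U i)). cycle_weight p ?S w)"
    by (subst W, rule sum.union_disjoint) (use dis in \<open>auto simp: finite_path_extensions\<close>)
  also have "(\<Sum>w\<in>(\<Union>i<length Ps. path_extensions (?U i)). cycle_weight p ?S w)
      = (\<Sum>i<length Ps. \<Sum>w\<in>path_extensions (?U i). cycle_weight p ?S w)"
    by (rule sum.UNION_disjoint) (use dis2 in \<open>auto simp: finite_path_extensions\<close>)
  also have "\<dots> = (\<Sum>i<length ks. path_poly p (ks[i := ks ! i + k]))"
    using IH by (intro sum.cong) (auto simp: ks)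
  also have "(\<Sum>w | w \<in> ?W \<and> w (last q) = hd q. cycle_weight p ?S w) = p k * path_poly p ks"
    using path_extensions_closed[OF d, of p] "2.hyps"(1)[OF ks] d by (simp add: k ks)
  finally show ?case by (simp add: P flip: ks k)
qed

text \<open>Needed because a path pair prescribes the vertex counts only as a multiset, whereas
  \<open>path_poly\<close> reads them in a fixed order.\<close>

lemma map_reorder:
  assumes "mset (map f xs) = mset ys"
  shows "\<exists>xs'. mset xs' = mset xs \<and> map f xs' = ys"
  using assms
proof (induction ys arbitrary: xs)
  case Nil
  then show ?case by simp
next
  case (Cons y ys)
  then have "y \<in> set (map f xs)" by (metis list.set_intros(1) mset_eq_setD)
  then obtain x where x: "x \<in> set xs" "f x = y" by auto
  then have "mset (map f (remove1 x xs)) = mset ys"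
    using Cons.prems by (simp add: image_mset_Diff)
  then obtain xs' where xs': "mset xs' = mset (remove1 x xs)" "map f xs' = ys"
    using Cons.IH by blast
  have "mset (x # xs') = mset xs" using x(1) by (simp add: xs'(1))
  moreover have "map f (x # xs') = y # ys" using x(2) xs'(2) by simp
  ultimately show ?case by (intro exI[of _ "x # xs'"] conjI)
qed

lemma path_pair_paths:
  assumes "path_pair n mu I J"
  shows "\<exists>P. [] \<notin> set P \<and> distinct (concat P) \<and> set (concat P) = {1..n} \<and> map length P = mu \<and>
    (\<forall>w. (\<forall>t<length I. w (I ! t) = J ! t) \<longleftrightarrow> (\<forall>p\<in>set P. successively (\<lambda>a b. w a = b) p))"
proof -
  obtain P where l: "length I = length J" and P: "[] \<notin> set P" "distinct (concat P)"
      "set (concat P) = {1..n}" "mset (map length P) = mset mu"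
      "set (zip I J) = (\<Union>p \<in> set P. {(p ! k, p ! Suc k) | k. Suc k < length p})"
    using assms unfolding path_pair_def by (elim conjE exE)
  obtain P' where P': "mset P' = mset P" "map length P' = mu" using map_reorder[OF P(4)] by blast
  have m: "mset (concat P') = mset (concat P)"
  proof -
    have "mset (concat R) = sum_mset (image_mset mset (mset R))" for R :: "nat list list"
      by (simp add: mset_concat sum_mset_sum_list[symmetric])
    then show ?thesis using P'(1) by simp
  qed
  have s: "set P' = set P" by (rule mset_eq_setD[OF P'(1)])
  show ?thesis
  proof (intro exI[of _ P'] conjI allI)
    show "[] \<notin> set P'" using P(1) s by simp
    show "distinct (concat P')" using P(2) m mset_eq_imp_distinct_iff by blast
    show "set (concat P') = {1..n}" using P(3) mset_eq_setD[OF m] by simp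
    show "map length P' = mu" by (fact P')
    fix w :: "nat \<Rightarrow> nat"
    have "(\<forall>t<length I. w (I ! t) = J ! t) \<longleftrightarrow> (\<forall>(a, b)\<in>set (zip I J). w a = b)"
      using l by (auto simp: set_zip)
    also have "\<dots> \<longleftrightarrow> (\<forall>p\<in>set P. \<forall>k. Suc k < length p \<longrightarrow> w (p ! k) = p ! Suc k)"
      unfolding P(5) by auto
    finally show "(\<forall>t<length I. w (I ! t) = J ! t) \<longleftrightarrow> (\<forall>p\<in>set P'. successively (\<lambda>a b. w a = b) p)"
      by (simp add: s successively_conv_nth)
  qed
qed

lemma sum_card_orbits:
  assumes "w permutes S" "finite S"
  shows "(\<Sum>c\<in>orbit w ` S. card c) = card S"
proof -
  have p: "permutation w" using assms permutation_permutes by blast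
  have U: "\<Union> (orbit w ` S) = S"
    using permutes_orbit_subset[OF assms(1)] permutation_self_in_orbit[OF p] by blast
  have "disjoint (orbit w ` S)"
  proof (rule disjointI)
    fix a b assume "a \<in> orbit w ` S" "b \<in> orbit w ` S" "a \<noteq> b"
    then show "a \<inter> b = {}"
      using orbit_cyclic_eq3[OF cyclic_on_orbit'[OF p]] by blast
  qed
  moreover have "finite c" if "c \<in> orbit w ` S" for c
    using that U assms(2) by (metis Union_upper finite_subset)
  ultimately show ?thesis using card_Union_disjoint[of "orbit w ` S"] U by (simp add: disjoint_def pairwise_def disjnt_def)
qed

lemma cycle_type_partition:
  assumes "w permutes {1..n}"
  shows "rev (sorted_list_of_multiset (cycle_type n w)) \<in> partitions_of n"
proof -
  let ?l = "rev (sorted_list_of_multiset (cycle_type n w))"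
  have m: "mset ?l = cycle_type n w" by simp
  have "sorted_wrt (\<ge>) ?l" by (simp add: sorted_wrt_rev)
  moreover have "0 \<notin> set ?l"
  proof
    assume "0 \<in> set ?l"
    then have "0 \<in># cycle_type n w" by (metis m set_mset_mset)
    then obtain x where x: "x \<in> {1..n}" "card (orbit w x) = 0" by (auto simp: cycle_type_def)
    then have "finite (orbit w x)"
      using permutes_orbit_subset[OF assms x(1)] finite_subset by blast
    then show False using x(2) orbit_nonempty[of w x] by simp
  qed
  moreover have "sum_list ?l = n"
  proof -
    have "sum_list ?l = sum_mset (cycle_type n w)" by (simp only: m flip: sum_mset_sum_list)
    also have "\<dots> = (\<Sum>c\<in>orbit w ` {1..n}. card c)"
      by (simp only: cycle_type_def sum_unfold_sum_mset)
    finally show ?thesis using sum_card_orbits[OF assms] by simp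
  qed
  ultimately show ?thesis by (simp add: partitions_of_def is_partition_def)
qed

text \<open>The sum over partitions groups the extensions by cycle type. Since the right-hand side
  does not mention \<open>I\<close> and \<open>J\<close>, the path power sum is independent of the
  chosen pair.\<close>

lemma path_power_sum_eq_path_poly:
  assumes "path_pair n mu I J"
  shows "path_power_sum n I J = path_poly (power_sum :: nat \<Rightarrow> 'a :: comm_ring_1 mvfps) mu"
proof -
  obtain P where P: "[] \<notin> set P" "distinct (concat P)" "set (concat P) = {1..n}" "map length P = mu"
    "\<And>w. (\<forall>t<length I. w (I ! t) = J ! t) \<longleftrightarrow> (\<forall>p\<in>set P. successively (\<lambda>a b. w a = b) p)"
    using path_pair_paths[OF assms] by (elim exE conjE) (rule that; blast)
  let ?W = "path_extensions P"
  \<comment> \<open>The decreasing list of cycle lengths is the only partition with the given cycle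
    type, so it can index the groups.\<close>
  let ?g = "\<lambda>w. rev (sorted_list_of_multiset (cycle_type n w))"
  let ?p = "power_sum :: nat \<Rightarrow> 'a mvfps"
  have W: "?W = {w. w permutes {1..n} \<and> (\<forall>t<length I. w (I ! t) = J ! t)}"
    unfolding path_extensions_def P(3,5) ..
  have g: "?g w = lam \<longleftrightarrow> cycle_type n w = mset lam" if "lam \<in> partitions_of n" for lam w
  proof
    assume "cycle_type n w = mset lam"
    moreover have "sorted (rev lam)"
      using that by (simp add: partitions_of_def is_partition_def sorted_wrt_rev)
    then have "sort lam = rev lam" by (intro properties_for_sort) auto
    ultimately show "?g w = lam" by (simp add: sorted_list_of_multiset_mset)
  next
    assume "?g w = lam"
    then show "cycle_type n w = mset lam" by (metis mset_rev mset_sorted_list_of_multiset)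
  qed
  have weight: "cycle_weight ?p {1..n} w = power_sum_part lam" if "cycle_type n w = mset lam" for w lam
  proof -
    have "power_sum_part lam = prod_mset (image_mset ?p (cycle_type n w))"
      unfolding that power_sum_part_def by (simp flip: prod_mset_prod_list)
    then show ?thesis by (simp add: cycle_weight_def cycle_type_def prod_unfold_prod_mset image_mset.compositionality comp_def)
  qed
  have "path_power_sum n I J = (\<Sum>lam\<in>partitions_of n. \<Sum>w | w \<in> ?W \<and> ?g w = lam. cycle_weight ?p {1..n} w)"
    unfolding path_power_sum_def
  proof (rule sum.cong[OF refl])
    fix lam assume lam: "lam \<in> partitions_of n"
    have "{w. w \<in> ?W \<and> ?g w = lam}
        = {w. w permutes {1..n} \<and> cycle_type n w = mset lam \<and> (\<forall>t<length I. w (I ! t) = J ! t)}"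
      unfolding W g[OF lam] by blast
    moreover have "(\<Sum>w | w \<in> ?W \<and> ?g w = lam. cycle_weight ?p {1..n} w)
        = (\<Sum>w | w \<in> ?W \<and> ?g w = lam. power_sum_part lam)"
      using g[OF lam] weight by (intro sum.cong) auto
    ultimately show "of_nat (path_perm_count n I J lam) * power_sum_part lam
        = (\<Sum>w | w \<in> ?W \<and> ?g w = lam. cycle_weight ?p {1..n} w)"
      by (simp add: path_perm_count_def)
  qed
  also have "\<dots> = (\<Sum>w\<in>?W. cycle_weight ?p {1..n} w)"
  proof (rule sum.group)
    show "?g ` ?W \<subseteq> partitions_of n" using cycle_type_partition by (auto simp: W)
  qed (rule finite_path_extensions finite_partitions_of)+
  also have "\<dots> = path_poly ?p mu" using sum_cycle_weight[OF P(2,1), of ?p] P(3,4) by simp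
  finally show ?thesis .
qed

section \<open>Truncation to finitely many variables\<close>

lift_definition mv_monom :: "nat multiset \<Rightarrow> 'a :: comm_ring_1 mvfps" is "\<lambda>a m. if m = a then 1 else 0" .

text \<open>The substitution of 0 for the variables of index at least \<open>M\<close>. Its values
  stay in the ring of power series, where the polynomial identities are then read with
  \<open>mv_var\<close> as variables.\<close>

lift_definition mv_trunc :: "nat \<Rightarrow> 'a :: comm_ring_1 mvfps \<Rightarrow> 'a mvfps"
  is "\<lambda>M f m. if set_mset m \<subseteq> {..<M} then f m else 0" .

abbreviation mv_var :: "nat \<Rightarrow> 'a :: comm_ring_1 mvfps" where
  "mv_var j \<equiv> mv_monom {#j#}"

lemma mv_monom_empty: "mv_monom {#} = 1"
  by transfer simp

lemma mv_monom_mult: "mv_monom a * mv_monom b = mv_monom (a + b)"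
proof (transfer, rule ext)
  fix a b m :: "nat multiset"
  have "(\<Sum>(c, d)\<in>msplits m. (if c = a then 1 else 0) * (if d = b then 1 else (0 :: 'a)))
      = (\<Sum>(c, d)\<in>msplits m \<inter> {(a, b)}. 1)"
    by (rule sum.mono_neutral_cong_right) (auto simp: finite_msplits split: if_splits)
  also have "\<dots> = (if m = a + b then 1 else 0)" by (auto simp: msplits_def)
  finally show "(\<Sum>(c, d)\<in>msplits m. (if c = a then 1 else 0) * (if d = b then 1 else (0 :: 'a)))
      = (if m = a + b then 1 else 0)" .
qed

lemma mv_var_power: "mv_var j ^ k = mv_monom (replicate_mset k j)"
  by (induction k) (simp_all add: mv_monom_empty mv_monom_mult)

lemma prod_mv_var: "finite D \<Longrightarrow> (\<Prod>c\<in>D. mv_var (t c)) = mv_monom (image_mset t (mset_set D))"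
  by (induction D rule: finite_induct) (simp_all add: mv_monom_empty mv_monom_mult)

lemma mv_trunc_add: "mv_trunc M (f + g) = mv_trunc M f + mv_trunc M g"
  by transfer auto

lemma mv_trunc_uminus: "mv_trunc M (- f) = - mv_trunc M f"
  by transfer auto

lemma mv_trunc_0: "mv_trunc M 0 = 0"
  by transfer auto

lemma mv_trunc_1: "mv_trunc M 1 = 1"
  by transfer auto

text \<open>A product of monomials avoids the discarded variables exactly if both factors
  do.\<close>

lemma mv_trunc_mult: "mv_trunc M (f * g) = mv_trunc M f * mv_trunc M g"
proof (transfer, rule ext)
  fix M :: nat and f g :: "nat multiset \<Rightarrow> 'a" and m
  let ?T = "\<lambda>f m. if set_mset m \<subseteq> {..<M} then f m else (0 :: 'a)"
  show "(if set_mset m \<subseteq> {..<M} then \<Sum>(a, b)\<in>msplits m. f a * g b else 0)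
      = (\<Sum>(a, b)\<in>msplits m. ?T f a * ?T g b)"
  proof (cases "set_mset m \<subseteq> {..<M}")
    case True
    then show ?thesis by (auto simp: msplits_def intro!: sum.cong)
  next
    case False
    then have "?T f a * ?T g b = 0" if "(a, b) \<in> msplits m" for a b
      using that by (auto simp: msplits_def)
    then have "(\<Sum>(a, b)\<in>msplits m. ?T f a * ?T g b) = 0"
      by (intro sum.neutral) (force simp only: prod.case)
    then show ?thesis using False by simp
  qed
qed

lemma mv_trunc_sum: "mv_trunc M (sum f A) = (\<Sum>a\<in>A. mv_trunc M (f a))"
  by (induction A rule: infinite_finite_induct) (simp_all add: mv_trunc_0 mv_trunc_add)

lemma mv_trunc_of_nat: "mv_trunc M (of_nat k) = of_nat k"
  by (induction k) (simp_all add: mv_trunc_0 mv_trunc_1 mv_trunc_add)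

lemma mv_trunc_minus_one_power: "mv_trunc M ((- 1) ^ k * f) = (- 1) ^ k * mv_trunc M f"
  by (induction k) (simp_all add: mv_trunc_uminus)

text \<open>A monomial involves finitely many variables, so its coefficient survives in some
  truncation.\<close>

lemma mv_trunc_eqI:
  assumes "\<And>M. mv_trunc M f = mv_trunc M g"
  shows "f = g"
proof (rule mvfps_eqI)
  fix m :: "nat multiset"
  obtain M where "set_mset m \<subseteq> {..<M}"
    using finite_nat_set_iff_bounded[of "set_mset m"] by auto
  then have "mvcoeff f m = mvcoeff (mv_trunc M f) m" "mvcoeff g m = mvcoeff (mv_trunc M g) m"
    by (transfer, simp)+
  then show "mvcoeff f m = mvcoeff g m" using assms by simp
qed

lemma mvcoeff_sum: "mvcoeff (sum f A) m = (\<Sum>a\<in>A. mvcoeff (f a) m)"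
  by (induction A rule: infinite_finite_induct) (simp_all add: zero_mvfps.rep_eq plus_mvfps.rep_eq)

text \<open>Positivity makes the monomials of different variables distinct. For \<open>k = 0\<close>
  the left-hand side would be 1 and the right-hand side \<open>M\<close>.\<close>

lemma mv_trunc_power_sum:
  assumes "0 < k"
  shows "mv_trunc M (power_sum k) = (\<Sum>j<M. mv_var j ^ k)"
proof (rule mvfps_eqI)
  fix m :: "nat multiset"
  have "mvcoeff (\<Sum>j<M. mv_var j ^ k :: 'a mvfps) m = (\<Sum>j<M. if m = replicate_mset k j then 1 else 0)"
    by (simp add: mvcoeff_sum mv_var_power mv_monom.rep_eq)
  also have "\<dots> = (if \<exists>j<M. m = replicate_mset k j then 1 else 0)"
  proof (cases "\<exists>j<M. m = replicate_mset k j")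
    case True
    then obtain j where j: "j < M" "m = replicate_mset k j" by blast
    have "(m = replicate_mset k i) \<longleftrightarrow> i = j" for i
      using assms j(2) by (metis count_replicate_mset less_irrefl)
    then show ?thesis using j(1) True by simp
  qed (auto intro!: sum.neutral)
  also have "\<dots> = mvcoeff (mv_trunc M (power_sum k)) m"
    using assms by (auto simp: mv_trunc.rep_eq power_sum.rep_eq split: if_splits)
  finally show "mvcoeff (mv_trunc M (power_sum k)) m = mvcoeff (\<Sum>j<M. mv_var j ^ k :: 'a mvfps) m" ..
qed

lemma mv_trunc_path_poly:
  assumes "0 \<notin> set ks"
  shows "mv_trunc M (path_poly power_sum ks) = path_poly (\<lambda>k. \<Sum>j<M. mv_var j ^ k) ks"
  using assms
proof (induction "power_sum :: nat \<Rightarrow> 'a mvfps" ks rule: path_poly.induct)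
  case 1
  then show ?case by (simp add: mv_trunc_1)
next
  case (2 k ks)
  have k: "0 < k" using "2.prems" by auto
  have "0 \<notin> set (ks[i := ks ! i + k])" for i
    using k "2.prems" set_update_subset_insert[of ks i "ks ! i + k"] by auto
  then show ?case
    using 2 k by (simp add: mv_trunc_add mv_trunc_mult mv_trunc_sum mv_trunc_power_sum)
qed

lemma mv_trunc_schur:
  "mv_trunc M (schur lam) = (tableau_poly mv_var M (young_diagram lam) :: 'a :: comm_ring_1 mvfps)"
proof (rule mvfps_eqI)
  fix m :: "nat multiset"
  let ?D = "young_diagram lam"
  let ?c = "\<lambda>t. image_mset t (mset_set ?D)"
  have fin: "finite (tableaux M ?D)" by (rule finite_tableaux[OF finite_young_diagram])
  have "mvcoeff (tableau_poly mv_var M ?D :: 'a mvfps) m = (\<Sum>t\<in>tableaux M ?D. if m = ?c t then 1 else 0)"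
    by (simp add: tableau_poly_def mvcoeff_sum prod_mv_var finite_young_diagram mv_monom.rep_eq)
  also have "\<dots> = of_nat (card {t \<in> tableaux M ?D. ?c t = m})"
    by (simp add: sum.If_cases[OF fin] Int_def eq_commute)
  also have "{t \<in> tableaux M ?D. ?c t = m}
      = (if set_mset m \<subseteq> {..<M} then {t \<in> ssyt lam. ?c t = m} else {})"
    by (auto simp: tableaux_def ssyt_def finite_young_diagram image_subset_iff)
  also have "of_nat (card \<dots>) = mvcoeff (mv_trunc M (schur lam) :: 'a mvfps) m"
    by (simp add: mv_trunc.rep_eq schur.rep_eq)
  finally show "mvcoeff (mv_trunc M (schur lam)) m = mvcoeff (tableau_poly mv_var M ?D :: 'a mvfps) m" ..
qed

section \<open>Moving beads in the order of decreasing destinations\<close>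

definition dests :: "(nat \<Rightarrow> int) \<Rightarrow> nat list \<Rightarrow> nat list \<Rightarrow> int list" where
  "dests b gs ks = map (\<lambda>(g, k). b g + int k) (zip gs ks)"

text \<open>The threshold \<open>c\<close> is a lower bound for the ranks that the moving beads will
  take: they have to stay below the bead of rank \<open>c - 1\<close>, a condition that is void for
  \<open>c = 0\<close>. On the side of tilings it is a lower bound for the columns of the
  tails.\<close>

definition falling :: "nat \<Rightarrow> (nat \<Rightarrow> int) \<Rightarrow> nat \<Rightarrow> nat list \<Rightarrow> nat list set" where
  "falling N b c ks = {gs \<in> dlists N (length ks). set gs \<subseteq> {c..} \<and>
     sorted_wrt (>) (dests b gs ks) \<and> (\<forall>d\<in>set (dests b gs ks). c = 0 \<or> d < b (c - 1))}"

text \<open>A pair \<open>(p, q)\<close> is the move of the bead of rank \<open>q\<close> to a free position, where its rank is \<open>p\<close>.\<close>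

definition moves :: "nat \<Rightarrow> (nat \<Rightarrow> int) \<Rightarrow> nat \<Rightarrow> nat \<Rightarrow> (nat \<times> nat) set" where
  "moves N b c k = {(p, q). c \<le> p \<and> p \<le> q \<and> q < N \<and> b p < b q + int k \<and>
     (p = 0 \<or> b q + int k < b (p - 1))}"

definition moved :: "(nat \<Rightarrow> int) \<Rightarrow> nat \<Rightarrow> nat \<Rightarrow> nat \<Rightarrow> nat \<Rightarrow> int" where
  "moved b p q k = rot p q (raise b q k)"

definition new_rank :: "nat \<Rightarrow> nat \<Rightarrow> nat \<Rightarrow> nat" where
  "new_rank p q g = (if p \<le> g \<and> g < q then Suc g else g)"

definition old_rank :: "nat \<Rightarrow> nat \<Rightarrow> nat \<Rightarrow> nat" where
  "old_rank p q g = (if p < g \<and> g \<le> q then g - 1 else g)"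

lemma old_new_rank: "p \<le> q \<Longrightarrow> g \<noteq> q \<Longrightarrow> old_rank p q (new_rank p q g) = g"
  by (auto simp: old_rank_def new_rank_def)

lemma new_old_rank: "p \<le> q \<Longrightarrow> g \<noteq> p \<Longrightarrow> new_rank p q (old_rank p q g) = g"
  by (auto simp: old_rank_def new_rank_def)

lemma new_rank_neq: "p \<le> q \<Longrightarrow> g \<noteq> q \<Longrightarrow> new_rank p q g \<noteq> p"
  by (auto simp: new_rank_def)

lemma old_rank_neq: "p \<le> q \<Longrightarrow> g \<noteq> p \<Longrightarrow> old_rank p q g \<noteq> q"
  by (auto simp: old_rank_def)

lemma rot_new_rank: "p \<le> q \<Longrightarrow> g \<noteq> q \<Longrightarrow> rot p q b (new_rank p q g) = b g"
  by (auto simp: rot_def new_rank_def)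

lemma moved_new_rank: "p \<le> q \<Longrightarrow> g \<noteq> q \<Longrightarrow> moved b p q k (new_rank p q g) = b g"
  by (simp add: moved_def rot_new_rank raise_def)

lemma moved_self: "moved b p q k p = b q + int k"
  by (simp add: moved_def rot_def raise_def)

lemma inj_on_new_rank: "p \<le> q \<Longrightarrow> q \<notin> A \<Longrightarrow> inj_on (new_rank p q) A"
  by (rule inj_on_inverseI[where g = "old_rank p q"]) (metis old_new_rank)

text \<open>Carrying out the first move, renumbering, and then raising the other beads leads to the
  same positions as raising all beads at once, up to the cyclic shift, whose effect on the
  determinant is (-1)^(q-p).\<close>

lemma displ_moved:
  assumes "p \<le> q" "q \<notin> set gs" "distinct gs" "length gs = length ks"
  shows "displ (moved b p q k) (map (new_rank p q) gs) ks = rot p q (displ b (q # gs) (k # ks))"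
proof
  fix i
  let ?r = "new_rank p q"
  have inj: "inj_on ?r (set gs)" by (rule inj_on_new_rank[OF assms(1,2)])
  show "displ (moved b p q k) (map ?r gs) ks i = rot p q (displ b (q # gs) (k # ks)) i"
  proof (cases "i = p")
    case True
    have "p \<notin> set (map ?r gs)" using new_rank_neq[OF assms(1)] assms(2) by (metis (no_types, lifting) imageE set_map)
    then have "displ (moved b p q k) (map ?r gs) ks p = b q + int k"
      by (simp add: displ_def bump_notin moved_self)
    moreover have "rot p q (displ b (q # gs) (k # ks)) p = displ b (q # gs) (k # ks) q"
      by (simp add: rot_def)
    moreover have "\<dots> = b q + int k" using bump_nth[of "q # gs" "k # ks" 0] assms by (simp add: displ_def)
    ultimately show ?thesis using True by simp
  next
    case False
    define g where "g = old_rank p q i"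
    have g: "g \<noteq> q" "i = ?r g"
      using old_rank_neq[OF assms(1) False] new_old_rank[OF assms(1) False] by (auto simp: g_def)
    have "bump (set (zip (map ?r gs) ks)) i = bump (set (zip gs ks)) g"
    proof (cases "g \<in> set gs")
      case True
      then obtain a where a: "a < length gs" "g = gs ! a" by (metis in_set_conv_nth)
      then show ?thesis
        using bump_nth[of "map ?r gs" ks a] bump_nth[of gs ks a] assms inj g by (simp add: distinct_map)
    next
      case False
      have "i \<notin> set (map ?r gs)"
      proof
        assume "i \<in> set (map ?r gs)"
        then obtain g' where g': "g' \<in> set gs" "?r g = ?r g'" using g by auto
        then have "g' \<noteq> q" using assms(2) by auto
        then have "g = g'" using old_new_rank[OF assms(1)] g g' by metis
        then show False using False g' by simp
      qed
      then show ?thesis using False by (simp add: bump_notin)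
    qed
    moreover have "rot p q (displ b (q # gs) (k # ks)) i = displ b (q # gs) (k # ks) g"
      using rot_new_rank[OF assms(1) g(1)] g(2) by simp
    moreover have "\<dots> = displ b gs ks g" using displ_Cons[OF assms(2)] g(1) by (simp add: raise_def)
    ultimately show ?thesis
      using moved_new_rank[OF assms(1) g(1)] g(2) by (simp add: displ_def)
  qed
qed

lemma dests_new_rank:
  assumes "p \<le> q" "q \<notin> set gs"
  shows "dests (moved b p q k) (map (new_rank p q) gs) ks = dests b gs ks"
proof -
  have "moved b p q k (new_rank p q g) = b g" if "(g, l) \<in> set (zip gs ks)" for g l
    using that assms by (intro moved_new_rank) (auto dest: set_zip_leftD)
  then show ?thesis unfolding dests_def zip_map1 by (auto simp: comp_def)
qed

text \<open>In the new state the bead of rank \<open>p\<close> sits at the first destination. The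
  bound attached to the threshold \<open>Suc p\<close> thus says exactly that all later destinations
  are lower than the first.\<close>

lemma falling_moved_iff:
  assumes b: "\<And>i j. i < j \<Longrightarrow> b j < b i" and pq: "(p, q) \<in> moves N b c k" and q: "q \<notin> set gs"
  shows "q # gs \<in> falling N b c (k # ks) \<longleftrightarrow>
    map (new_rank p q) gs \<in> falling N (moved b p q k) (Suc p) ks"
proof -
  have m: "c \<le> p" "p \<le> q" "q < N" "b p < b q + int k" "p = 0 \<or> b q + int k < b (p - 1)"
    using pq by (auto simp: moves_def)
  have bm: "b j \<le> b i" if "i \<le> j" for i j using b[of i j] that by (cases "i = j") auto
  have cd: "c = 0 \<or> b q + int k < b (c - 1)"
  proof (cases "c = 0")
    case False
    then have "p \<noteq> 0" using m by auto
    then have "b q + int k < b (p - 1)" using m by auto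
    moreover have "b (p - 1) \<le> b (c - 1)" using m(1) by (intro bm) simp
    ultimately show ?thesis by simp
  qed simp
  let ?r = "new_rank p q" and ?d = "dests b gs ks"
  have di: "distinct (map ?r gs) \<longleftrightarrow> distinct gs"
    using inj_on_new_rank[OF m(2) q] by (simp add: distinct_map)
  have lt: "?r g < N \<longleftrightarrow> g < N" if "g \<noteq> q" for g using that m by (auto simp: new_rank_def)
  have "?r g < N \<longleftrightarrow> g < N" if "g \<in> set gs" for g using that q by (intro lt) auto
  then have sub: "set (map ?r gs) \<subseteq> {..<N} \<longleftrightarrow> set gs \<subseteq> {..<N}"
    by (auto simp: image_subset_iff)
  have dc: "dests b (q # gs) (k # ks) = (b q + int k) # ?d" by (simp add: dests_def)
  have ge: "set gs \<subseteq> {c..} \<longleftrightarrow> set (map ?r gs) \<subseteq> {Suc p..}"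
    if len: "length gs = length ks" and dd: "\<forall>d\<in>set ?d. d < b q + int k"
  proof -
    have "c \<le> g \<and> Suc p \<le> ?r g" if "g \<in> set gs" for g
    proof -
      obtain a where a: "a < length gs" "g = gs ! a" using \<open>g \<in> set gs\<close> by (metis in_set_conv_nth)
      then have "b g + int (ks ! a) \<in> set ?d" using len by (force simp: dests_def set_zip)
      then have "b g < b q + int k" using dd by force
      \<comment> \<open>A bead of rank below \<open>p\<close> already lies above the first
        destination, so it cannot have a lower destination.\<close>
      have "p \<le> g"
      proof (rule ccontr)
        assume "\<not> p \<le> g"
        then have "b (p - 1) \<le> b g" by (intro bm) simp
        then show False using \<open>b g < _\<close> \<open>\<not> p \<le> g\<close> m(5) by auto
      qed
      moreover have "g \<noteq> q" using that q by auto
      ultimately show ?thesis using m by (auto simp: new_rank_def)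
    qed
    then show ?thesis by auto
  qed
  have "q # gs \<in> falling N b c (k # ks) \<longleftrightarrow> length gs = length ks \<and> distinct gs \<and> set gs \<subseteq> {..<N} \<and>
      set gs \<subseteq> {c..} \<and> (\<forall>d\<in>set ?d. d < b q + int k) \<and> sorted_wrt (>) ?d"
    using q m cd by (force simp: falling_def dlists_def dc)
  also have "\<dots> \<longleftrightarrow> map ?r gs \<in> falling N (moved b p q k) (Suc p) ks"
    using ge di sub by (auto simp: falling_def dlists_def dests_new_rank[OF m(2) q] moved_self)
  finally show ?thesis .
qed

text \<open>
  A destination occupied by another bead contributes nothing: such a bead cannot leave later, because
  its own destination would be higher.
\<close>

lemma sum_falling_Cons:
  assumes b: "\<And>i j. i < j \<Longrightarrow> b j < b i" and "0 < k"
  shows "(\<Sum>gs\<in>falling N b c (k # ks). bead_poly x N M (displ b gs (k # ks)))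
    = (\<Sum>(p, q)\<in>moves N b c k. (- 1) ^ (q - p) *
        (\<Sum>gs\<in>falling N (moved b p q k) (Suc p) ks. bead_poly x N M (displ (moved b p q k) gs ks)))"
proof -
  have bm: "b j \<le> b i" if "i \<le> j" for i j using b[of i j] that by (cases "i = j") auto
  let ?F = "\<lambda>gs. bead_poly x N M (displ b gs (k # ks))"
  \<comment> \<open>As \<open>b\<close> is decreasing, this is the number of beads at or above the
    destination of \<open>q\<close>, which is the new rank of \<open>q\<close> if the destination is
    free.\<close>
  define rk where "rk q = (LEAST p. b p < b q + int k)" for q
  define G where "G = {gs \<in> falling N b c (k # ks). (rk (hd gs), hd gs) \<in> moves N b c k}"
  have fin: "finite (falling N b' c' ks')" for b' c' ks'
    by (rule finite_subset[OF _ finite_dlists]) (auto simp: falling_def)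
  have finm: "finite (moves N b c k)"
    by (rule finite_subset[of _ "{..<N} \<times> {..<N}"]) (auto simp: moves_def)
  have rk: "rk q = p" if "(p, q) \<in> moves N b c k" for p q
    unfolding rk_def
  proof (rule Least_equality)
    show "b p < b q + int k" using that by (auto simp: moves_def)
    fix p' assume p': "b p' < b q + int k"
    show "p \<le> p'"
    proof (rule ccontr)
      assume "\<not> p \<le> p'"
      then have "b (p - 1) \<le> b p'" by (intro bm) simp
      then show False using that p' \<open>\<not> p \<le> p'\<close> by (auto simp: moves_def)
    qed
  qed
  have zero: "?F gs = 0" if gs: "gs \<in> falling N b c (k # ks) - G" for gs
  proof -
    obtain q gs' where q: "gs = q # gs'" using gs by (cases gs) (auto simp: falling_def dlists_def)
    let ?d = "b q + int k"
    have f: "distinct gs" "length gs' = length ks" "set gs \<subseteq> {..<N}" "c \<le> q"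
      "\<forall>d\<in>set (dests b gs' ks). d < ?d" "c = 0 \<or> ?d < b (c - 1)"
      using gs by (auto simp: falling_def dlists_def dests_def q)
    have "\<exists>i<N. b i = ?d"
    proof (rule ccontr)
      assume no: "\<not> (\<exists>i<N. b i = ?d)"
      let ?p = "rk q"
      have P: "b q < ?d" using assms(2) by simp
      have p: "b ?p < ?d" unfolding rk_def by (rule LeastI[of "\<lambda>p. b p < b q + int k", OF P])
      have pq: "?p \<le> q" unfolding rk_def by (rule Least_le[of "\<lambda>p. b p < b q + int k", OF P])
      have "?p = 0 \<or> ?d < b (?p - 1)"
      proof (cases "?p = 0")
        case False
        then have "\<not> b (?p - 1) < ?d" unfolding rk_def by (intro not_less_Least) simp
        moreover have "b (?p - 1) \<noteq> ?d" using no pq f(3) q by auto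
        ultimately show ?thesis by simp
      qed simp
      moreover have "c \<le> ?p"
      proof (rule ccontr)
        assume "\<not> c \<le> ?p"
        then have "b (c - 1) \<le> b ?p" by (intro bm) simp
        then show False using f(6) p \<open>\<not> c \<le> ?p\<close> by auto
      qed
      ultimately have "(?p, q) \<in> moves N b c k" using p pq f(3) q by (auto simp: moves_def)
      then show False using gs q by (simp add: G_def)
    qed
    then obtain i where i: "i < N" "b i = ?d" by blast
    have iq: "i \<noteq> q" using i assms(2) by auto
    have "i \<notin> set gs'"
    proof
      assume "i \<in> set gs'"
      then obtain a where a: "a < length gs'" "i = gs' ! a" by (metis in_set_conv_nth)
      then have "b i + int (ks ! a) \<in> set (dests b gs' ks)" using f(2) by (force simp: dests_def set_zip)
      then show False using f(5) i(2) by force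
    qed
    then have "bump (set (zip gs (k # ks))) i = 0" using iq by (intro bump_notin) (simp add: q)
    then have "displ b gs (k # ks) i = b i" by (simp add: displ_def)
    moreover have "displ b gs (k # ks) q = ?d"
      using bump_nth[of gs "k # ks" 0] f(1,2) by (simp add: displ_def q)
    ultimately show ?thesis using i iq f(3) q by (intro bead_poly_repeated[of i N q]) auto
  qed
  have "(\<Sum>gs\<in>falling N b c (k # ks). ?F gs) = (\<Sum>gs\<in>G. ?F gs)"
    by (rule sum.mono_neutral_right) (use zero in \<open>auto simp: fin G_def\<close>)
  also have "\<dots> = (\<Sum>((p, q), gs)\<in>(SIGMA (p, q):moves N b c k. falling N (moved b p q k) (Suc p) ks).
      (- 1) ^ (q - p) * bead_poly x N M (displ (moved b p q k) gs ks))"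
  proof (rule sum.reindex_bij_witness[of _ "\<lambda>((p, q), gs). q # map (old_rank p q) gs"
        "\<lambda>gs. ((rk (hd gs), hd gs), map (new_rank (rk (hd gs)) (hd gs)) (tl gs))"])
    fix gs assume gs: "gs \<in> G"
    then obtain q gs' where q: "gs = q # gs'" by (cases gs) (auto simp: G_def falling_def dlists_def)
    let ?p = "rk q"
    have pq: "(?p, q) \<in> moves N b c k" "?p \<le> q" "q < N" using gs q by (auto simp: G_def moves_def)
    have nq: "q \<notin> set gs'" "distinct gs'" "length gs' = length ks"
      using gs q by (auto simp: G_def falling_def dlists_def)
    have F: "gs \<in> falling N b c (k # ks)" using gs by (simp add: G_def)
    have "map (old_rank ?p q) (map (new_rank ?p q) gs') = gs'"
      unfolding map_map comp_def by (rule map_idI) (metis old_new_rank[OF pq(2)] nq(1))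
    then show "(\<lambda>((p, q), gs). q # map (old_rank p q) gs)
        ((rk (hd gs), hd gs), map (new_rank (rk (hd gs)) (hd gs)) (tl gs)) = gs"
      using q by simp
    have "map (new_rank ?p q) gs' \<in> falling N (moved b ?p q k) (Suc ?p) ks"
      using falling_moved_iff[OF b pq(1) nq(1), of ks] F q by simp
    then show "((rk (hd gs), hd gs), map (new_rank (rk (hd gs)) (hd gs)) (tl gs))
        \<in> (SIGMA (p, q):moves N b c k. falling N (moved b p q k) (Suc p) ks)"
      using pq q by simp
    have "bead_poly x N M (displ (moved b ?p q k) (map (new_rank ?p q) gs') ks)
        = (- 1) ^ (q - ?p) * bead_poly x N M (displ b gs (k # ks))"
      unfolding displ_moved[OF pq(2) nq] q by (rule bead_poly_rot[OF pq(2,3)])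
    then have "(- 1) ^ (q - ?p) * bead_poly x N M (displ (moved b ?p q k) (map (new_rank ?p q) gs') ks)
        = ?F gs"
      by (simp add: mult.assoc[symmetric] power_mult_distrib[symmetric])
    then show "(\<lambda>((p, q), gs). (- 1) ^ (q - p) * bead_poly x N M (displ (moved b p q k) gs ks))
        ((rk (hd gs), hd gs), map (new_rank (rk (hd gs)) (hd gs)) (tl gs)) = ?F gs"
      using q by simp
  next
    fix y assume "y \<in> (SIGMA (p, q):moves N b c k. falling N (moved b p q k) (Suc p) ks)"
    then obtain p q gs where y: "y = ((p, q), gs)" and pq: "(p, q) \<in> moves N b c k"
      and gs: "gs \<in> falling N (moved b p q k) (Suc p) ks" by auto
    have le: "p \<le> q" using pq by (auto simp: moves_def)
    have np: "p \<notin> set gs" using gs by (auto simp: falling_def)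
    have nq: "q \<notin> set (map (old_rank p q) gs)"
      using old_rank_neq[OF le] np by (metis (no_types, lifting) imageE set_map)
    have id: "map (new_rank p q) (map (old_rank p q) gs) = gs"
      unfolding map_map comp_def by (rule map_idI) (metis new_old_rank[OF le] np)
    then have "q # map (old_rank p q) gs \<in> falling N b c (k # ks)"
      using falling_moved_iff[OF b pq nq, of ks] gs by simp
    then show "(\<lambda>((p, q), gs). q # map (old_rank p q) gs) y \<in> G"
      using pq rk[OF pq] by (simp add: G_def y)
    show "((rk (hd ((\<lambda>((p, q), gs). q # map (old_rank p q) gs) y)),
          hd ((\<lambda>((p, q), gs). q # map (old_rank p q) gs) y)),
         map (new_rank (rk (hd ((\<lambda>((p, q), gs). q # map (old_rank p q) gs) y)))
               (hd ((\<lambda>((p, q), gs). q # map (old_rank p q) gs) y)))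
          (tl ((\<lambda>((p, q), gs). q # map (old_rank p q) gs) y))) = y"
      using rk[OF pq] id by (simp add: y)
  qed
  also have "\<dots> = (\<Sum>(p, q)\<in>moves N b c k. (- 1) ^ (q - p) *
        (\<Sum>gs\<in>falling N (moved b p q k) (Suc p) ks. bead_poly x N M (displ (moved b p q k) gs ks)))"
    using finm fin by (subst sum.Sigma[symmetric]) (auto simp: sum_distrib_left split_def)
  finally show ?thesis .
qed

section \<open>Ribbons\<close>

definition skew_columns :: "(nat \<Rightarrow> nat) \<Rightarrow> (nat \<Rightarrow> nat) \<Rightarrow> (nat \<times> nat) set" where
  "skew_columns h h' = column_diagram h' - column_diagram h"

lemma mem_skew_columns: "(i, j) \<in> skew_columns h h' \<longleftrightarrow> h j \<le> i \<and> i < h' j"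
  by (auto simp: skew_columns_def column_diagram_def)

text \<open>Neighbouring columns share exactly one row: the lowest new cell of column
  \<open>Suc j\<close> lies beside the highest new cell of column \<open>j\<close>.\<close>

definition ribbon_columns :: "(nat \<Rightarrow> nat) \<Rightarrow> (nat \<Rightarrow> nat) \<Rightarrow> nat \<Rightarrow> nat \<Rightarrow> bool" where
  "ribbon_columns h h' p q \<longleftrightarrow> p \<le> q \<and> (\<forall>j. j < p \<or> q < j \<longrightarrow> h' j = h j) \<and> h p < h' p \<and>
     (\<forall>j. p \<le> j \<longrightarrow> j < q \<longrightarrow> h' (Suc j) = Suc (h j))"

text \<open>Connectedness forces neighbouring columns to share a row, and the absence of a 2x2
  square forbids a second one.\<close>

lemma ribbon_imp_ribbon_columns:
  assumes h: "heights N h" and h': "heights N h'" and le: "\<And>j. h j \<le> h' j"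
    and rib: "ribbon (skew_columns h h')"
  shows "\<exists>p q. ribbon_columns h h' p q"
proof -
  let ?S = "skew_columns h h'"
  have ne: "?S \<noteq> {}" and conn: "edgewise_connected ?S"
    and sq: "\<And>i j. \<not> {(i, j), (i, Suc j), (Suc i, j), (Suc i, Suc j)} \<subseteq> ?S"
    using rib unfolding ribbon_def by blast+
  define C where "C = snd ` ?S"
  have C: "finite C" "C \<noteq> {}"
    using ne finite_column_diagram[OF h'] by (auto simp: C_def skew_columns_def)
  define p q where "p = Min C" and "q = Max C"
  have pC: "p \<in> C" "q \<in> C" and bnd: "\<And>j. j \<in> C \<Longrightarrow> p \<le> j \<and> j \<le> q"
    using C by (auto simp: p_def q_def)
  obtain ip where ip: "(ip, p) \<in> ?S" using pC by (auto simp: C_def)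
  obtain iq where iq: "(iq, q) \<in> ?S" using pC by (auto simp: C_def)
  have out: "h' j = h j" if "j < p \<or> q < j" for j
  proof (rule ccontr)
    assume "h' j \<noteq> h j"
    then have "(h j, j) \<in> ?S" using le[of j] by (simp add: mem_skew_columns)
    then have "j \<in> C" by (force simp: C_def)
    then show False using bnd that by fastforce
  qed
  have step: "h' (Suc j) = Suc (h j)" if j: "p \<le> j" "j < q" for j
  proof (rule antisym)
    show "Suc (h j) \<le> h' (Suc j)"
    proof (rule ccontr)
      assume cut: "\<not> Suc (h j) \<le> h' (Suc j)"
      \<comment> \<open>Without a common row no edge joins column \<open>j\<close> to the next one,
        so a walk from the first column never gets beyond \<open>j\<close>.\<close>
      have "snd c \<le> j" if "((ip, p), c) \<in> {(a, b). a \<in> ?S \<and> b \<in> ?S \<and> edge_adjacent a b}\<^sup>*" for c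
        using that
      proof (induction rule: rtrancl_induct)
        case base
        then show ?case using j by simp
      next
        case (step c d)
        obtain i k i' k' where cd: "c = (i, k)" "d = (i', k')" by fastforce
        then have m: "h k \<le> i" "i < h' k" "h k' \<le> i'" "i' < h' k'" "edge_adjacent (i, k) (i', k')"
          using step by (auto simp: mem_skew_columns)
        show ?case
        proof (rule ccontr)
          assume "\<not> snd d \<le> j"
          then have "k = j" "k' = Suc j" "i = i'"
            using m(5) step.IH cd by (auto simp: edge_adjacent_def)
          then show False using m cut by simp
        qed
      qed
      moreover have "((ip, p), (iq, q)) \<in> {(a, b). a \<in> ?S \<and> b \<in> ?S \<and> edge_adjacent a b}\<^sup>*"
        using conn ip iq unfolding edgewise_connected_def by blast
      ultimately show False using j by fastforce
    qed
    show "h' (Suc j) \<le> Suc (h j)"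
    proof (rule ccontr)
      assume "\<not> h' (Suc j) \<le> Suc (h j)"
      then have "{(h j, j), (h j, Suc j), (Suc (h j), j), (Suc (h j), Suc j)} \<subseteq> ?S"
        using heights_le[OF h, of j "Suc j"] heights_le[OF h', of j "Suc j"] by (auto simp: mem_skew_columns)
      then show False using sq by blast
    qed
  qed
  have "p \<le> q" using bnd pC by blast
  moreover have "h p < h' p" using ip by (auto simp: mem_skew_columns)
  ultimately have "ribbon_columns h h' p q" using out step by (simp add: ribbon_columns_def)
  then show ?thesis by blast
qed

locale added_ribbon =
  fixes N h h' p q
  assumes h: "heights N h" and h': "heights N h'" and rc: "ribbon_columns h h' p q"
begin

abbreviation (input) "S \<equiv> skew_columns h h'"

lemma pq: "p \<le> q" and pos: "h p < h' p" and out: "j < p \<or> q < j \<Longrightarrow> h' j = h j"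
  and step_eq: "p \<le> j \<Longrightarrow> j < q \<Longrightarrow> h' (Suc j) = Suc (h j)"
  using rc by (auto simp: ribbon_columns_def)

lemma less: "p \<le> j \<Longrightarrow> j \<le> q \<Longrightarrow> h j < h' j"
proof (cases "j = p")
  case False
  assume "p \<le> j" "j \<le> q"
  then show ?thesis using step_eq[of "j - 1"] heights_le[OF h, of "j - 1" j] False by simp
qed (simp add: pos)

lemma le: "h j \<le> h' j"
  using less[of j] out[of j] by (cases "p \<le> j \<and> j \<le> q") auto

lemma cols: "(i, j) \<in> S \<Longrightarrow> p \<le> j \<and> j \<le> q"
  using out[of j] by (auto simp: mem_skew_columns intro: leI)

lemma snd_image: "snd ` S = {p..q}"
proof
  show "snd ` S \<subseteq> {p..q}" using cols by auto
  show "{p..q} \<subseteq> snd ` S"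
  proof
    fix j assume "j \<in> {p..q}"
    then have "(h j, j) \<in> S" using less by (simp add: mem_skew_columns)
    then show "j \<in> snd ` S" by force
  qed
qed

text \<open>No row in between is skipped: row \<open>i\<close> is met in the first column from
  \<open>p\<close> on whose old height is at most \<open>i\<close>.\<close>

lemma fst_image: "fst ` S = {h q..<h' p}"
proof
  show "fst ` S \<subseteq> {h q..<h' p}"
  proof clarsimp
    fix i j assume *: "(i, j) \<in> S"
    then have "p \<le> j" "j \<le> q" using cols by auto
    then show "h q \<le> i \<and> i < h' p"
      using * heights_le[OF h, of j q] heights_le[OF h', of p j] by (auto simp: mem_skew_columns)
  qed
  show "{h q..<h' p} \<subseteq> fst ` S"
  proof
    fix i assume i: "i \<in> {h q..<h' p}"
    define j where "j = (LEAST j. p \<le> j \<and> h j \<le> i)"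
    have qi: "p \<le> q \<and> h q \<le> i" using i pq by simp
    have j: "p \<le> j \<and> h j \<le> i" unfolding j_def by (rule LeastI[of "\<lambda>j. p \<le> j \<and> h j \<le> i", OF qi])
    have jq: "j \<le> q" unfolding j_def by (rule Least_le[of "\<lambda>j. p \<le> j \<and> h j \<le> i", OF qi])
    have "i < h' j"
    proof (cases "j = p")
      case True
      then show ?thesis using i by simp
    next
      case False
      have "\<not> (p \<le> j - 1 \<and> h (j - 1) \<le> i)"
      proof
        assume "p \<le> j - 1 \<and> h (j - 1) \<le> i"
        then have "(LEAST j. p \<le> j \<and> h j \<le> i) \<le> j - 1" by (rule Least_le)
        then have "j \<le> j - 1" by (simp only: j_def[symmetric])
        then show False using j False by (cases j) auto
      qed
      then show ?thesis using step_eq[of "j - 1"] j jq False by auto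
    qed
    then have "(i, j) \<in> S" using j by (simp add: mem_skew_columns)
    then show "i \<in> fst ` S" by force
  qed
qed

lemma tail: "ribbon_tail S = (h' p - 1, p)"
  unfolding ribbon_tail_def
proof (rule the_equality)
  have t: "(h' p - 1, p) \<in> S" using pos by (simp add: mem_skew_columns)
  have m: "fst d \<le> h' p - 1 \<and> p \<le> snd d" if "d \<in> S" for d
  proof -
    have "fst d \<in> fst ` S" "snd d \<in> snd ` S" using that by auto
    then show ?thesis unfolding fst_image snd_image by auto
  qed
  show "(h' p - 1, p) \<in> S \<and> (\<forall>d\<in>S. fst d \<le> fst (h' p - 1, p) \<and> snd (h' p - 1, p) \<le> snd d)"
    using t m by simp
  fix c assume "c \<in> S \<and> (\<forall>d\<in>S. fst d \<le> fst c \<and> snd c \<le> snd d)"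
  then have "fst c = h' p - 1" "snd c = p" using t m by (metis antisym fst_conv, metis antisym snd_conv)
  then show "c = (h' p - 1, p)" by (simp add: prod_eq_iff)
qed

text \<open>The column lengths telescope because each new height is one more than the preceding old
  height. In terms of beads, the position \<open>h q - q\<close> is raised by the size of the ribbon
  to \<open>h' p - p\<close>.\<close>

lemma card_eq: "int (card S) = int (h' p) - int (h q) + int (q - p)"
proof -
  have "(\<Sum>j = p..r. int (h' j) - int (h j)) = int (h' p) - int (h r) + int (r - p)" if "p \<le> r" "r \<le> q" for r
    using that
  proof (induction r rule: dec_induct)
    case (step r)
    then show ?case using step_eq[of r]
      by (simp add: Suc_diff_le)
  qed simp
  moreover have "card S = (\<Sum>j = p..q. h' j - h j)"
  proof -
    have "S = (\<lambda>(j, i). (i, j)) ` (SIGMA j:{p..q}. {h j..<h' j})"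
      using cols by (auto simp: mem_skew_columns image_iff)
    then have "card S = card (SIGMA j:{p..q}. {h j..<h' j})"
      by (simp add: card_image inj_on_def split_def prod_eq_iff)
    then show ?thesis by simp
  qed
  then have "int (card S) = (\<Sum>j = p..q. int (h' j) - int (h j))"
    using le by (simp add: of_nat_diff)
  ultimately show ?thesis using pq by simp
qed

text \<open>A ribbon has one cell less than it has rows and columns together, so the exponent
  exceeds the height by the even number 2 + 2 (q - p). This form isolates the contribution
  \<open>q - p\<close> of the bead shift.\<close>

lemma sign: "ribbon_sign S = (- 1 :: 'r :: comm_ring_1) ^ (card S + 1 + (q - p))"
proof -
  have lt: "h q < h' p" using heights_le[OF h pq] pos by simp
  have "int (card S) = int (h' p - h q) + int (q - p)" using card_eq lt by (simp add: of_nat_diff)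
  then have c: "card S = (h' p - h q) + (q - p)" by linarith
  have "ribbon_height S = h' p - h q - 1" by (simp add: ribbon_height_def fst_image)
  moreover obtain m where m: "h' p - h q = Suc m" using lt by (metis Suc_diff_Suc)
  moreover have "(- 1 :: 'r) ^ m = (- 1) ^ (Suc m + d + 1 + d)" for d
    by (simp add: minus_one_power_iff)
  ultimately show ?thesis unfolding ribbon_sign_def c by simp
qed

text \<open>Each cell is joined to the top of its column, and the top of column \<open>j\<close> to
  the bottom of column \<open>Suc j\<close>, which lies in the same row.\<close>

lemma is_ribbon: "ribbon S"
proof -
  let ?R = "{(a, b). a \<in> S \<and> b \<in> S \<and> edge_adjacent a b}"
  have sym: "sym (?R\<^sup>*)"
    by (rule sym_rtrancl) (auto simp: sym_def edge_adjacent_def)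
  have col: "((i, j), (h j, j)) \<in> ?R\<^sup>*" if "h j \<le> i" "i < h' j" for i j
    using that
  proof (induction i rule: dec_induct)
    case (step i)
    then have "((Suc i, j), (i, j)) \<in> ?R" by (auto simp: mem_skew_columns edge_adjacent_def)
    then show ?case using step by (meson Suc_lessD converse_rtrancl_into_rtrancl)
  qed simp
  have top: "((h p, p), (h j, j)) \<in> ?R\<^sup>*" if "p \<le> j" "j \<le> q" for j
    using that
  proof (induction j rule: dec_induct)
    case (step j)
    have e: "h' (Suc j) = Suc (h j)" using step by (intro step_eq) auto
    have "((h j, j), (h j, Suc j)) \<in> ?R"
      using e step less[of j] heights_le[OF h, of j "Suc j"] by (auto simp: mem_skew_columns edge_adjacent_def)
    moreover have "((h j, Suc j), (h (Suc j), Suc j)) \<in> ?R\<^sup>*"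
      using e heights_le[OF h, of j "Suc j"] by (intro col) auto
    ultimately show ?case using step by (meson Suc_leD rtrancl.rtrancl_into_rtrancl rtrancl_trans)
  qed simp
  have to: "((h p, p), c) \<in> ?R\<^sup>*" if "c \<in> S" for c
  proof -
    obtain i j where c: "c = (i, j)" by fastforce
    then have ij: "p \<le> j" "j \<le> q" "h j \<le> i" "i < h' j" using that cols by (auto simp: mem_skew_columns)
    then have "((h j, j), (i, j)) \<in> ?R\<^sup>*" using col sym by (meson symD)
    then show ?thesis using top[OF ij(1,2)] c by (meson rtrancl_trans)
  qed
  have "edgewise_connected S"
    unfolding edgewise_connected_def using to sym by (meson rtrancl_trans symD)
  moreover have "\<not> {(i, j), (i, Suc j), (Suc i, j), (Suc i, Suc j)} \<subseteq> S" for i j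
  proof
    assume *: "{(i, j), (i, Suc j), (Suc i, j), (Suc i, Suc j)} \<subseteq> S"
    then have "p \<le> j" "Suc j \<le> q" using cols by blast+
    then have "h' (Suc j) = Suc (h j)" by (intro step_eq) auto
    then show False using * by (auto simp: mem_skew_columns)
  qed
  moreover have "skew_shape S"
  proof -
    obtain lam nu where "is_partition lam" "young_diagram lam = column_diagram h'"
      "is_partition nu" "young_diagram nu = column_diagram h"
      using column_diagram_partition[OF h] column_diagram_partition[OF h'] by blast
    moreover have "column_diagram h \<subseteq> column_diagram h'"
      using le by (auto simp: column_diagram_def intro: less_le_trans)
    ultimately show ?thesis unfolding skew_shape_def skew_columns_def by metis
  qed
  moreover have "(h p, p) \<in> S" using pos by (simp add: mem_skew_columns)
  then have "S \<noteq> {}" by blast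
  ultimately show ?thesis unfolding ribbon_def by blast
qed

end

section \<open>Adding ribbons as moving beads\<close>

definition beads :: "(nat \<Rightarrow> nat) \<Rightarrow> nat \<Rightarrow> int" where
  "beads h j = int (h j) - int j"

text \<open>For admissible moves the argument of \<open>nat\<close> is nonnegative, so nothing is
  cut off.\<close>

definition moved_heights :: "(nat \<Rightarrow> nat) \<Rightarrow> nat \<Rightarrow> nat \<Rightarrow> nat \<Rightarrow> nat \<Rightarrow> nat" where
  "moved_heights h p q k j = nat (moved (beads h) p q k j + int j)"

lemma beads_less: "heights N h \<Longrightarrow> i < j \<Longrightarrow> beads h j < beads h i"
  using heights_le[of N h i j] by (simp add: beads_def)

text \<open>For \<open>p < j \<le> q\<close> the ribbon condition says that bead \<open>j\<close> of
  the new shape is at the position of bead \<open>j - 1\<close> of the old one: these beads are only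
  renumbered, and \<open>q\<close> alone moves.\<close>

lemma (in added_ribbon) beads_moved: "beads h' = moved (beads h) p q (card S)"
proof
  fix j
  consider "j = p" | "p < j" "j \<le> q" | "j < p \<or> q < j" by linarith
  then show "beads h' j = moved (beads h) p q (card S) j"
  proof cases
    case 1
    then show ?thesis using card_eq pq by (simp add: moved_self beads_def of_nat_diff)
  next
    case 2
    then obtain i where "j = Suc i" by (cases j) auto
    then show ?thesis using 2 step_eq[of i] by (simp add: moved_def rot_def raise_def beads_def)
  next
    case 3
    then show ?thesis using out[of j] pq by (auto simp: moved_def rot_def raise_def beads_def)
  qed
qed

lemma (in added_ribbon) moves: "c \<le> p \<Longrightarrow> (p, q) \<in> moves N (beads h) c (card S)"
proof -
  assume "c \<le> p"
  have "beads h' p = beads h q + int (card S)" by (simp add: beads_moved moved_self)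
  moreover have "q < N" using less[of q] heights_pos[OF h', of q] pq by simp
  moreover have "beads h p < beads h' p" using pos by (simp add: beads_def)
  moreover have "p = 0 \<or> beads h' p < beads h (p - 1)"
    using beads_less[OF h', of "p - 1" p] out[of "p - 1"] by (cases "p = 0") (auto simp: beads_def)
  ultimately show ?thesis using pq \<open>c \<le> p\<close> by (auto simp: moves_def)
qed

lemma (in added_ribbon) heights_eq: "h' = moved_heights h p q (card S)"
  by (simp add: moved_heights_def fun_eq_iff flip: beads_moved) (simp add: beads_def)

text \<open>Strictly decreasing bead positions are weakly decreasing column heights. The
  inequalities on the two sides of the destination supply this at column \<open>p\<close> and make
  the column gain at least one cell.\<close>

lemma moved_heights:
  assumes h: "heights N h" and m: "(p, q) \<in> moves N (beads h) c k"
  shows "added_ribbon N h (moved_heights h p q k) p q"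
    and "card (skew_columns h (moved_heights h p q k)) = k"
proof -
  let ?h = "moved_heights h p q k"
  have pq: "p \<le> q" "q < N" "beads h p < beads h q + int k" "p = 0 \<or> beads h q + int k < beads h (p - 1)"
    using m by (auto simp: moves_def)
  have hp: "int (?h p) = beads h q + int k + int p"
    using pq(3) by (simp add: moved_heights_def moved_self beads_def)
  have hmid: "?h (Suc j) = Suc (h j)" if "p \<le> j" "j < q" for j
    using that by (simp add: moved_heights_def moved_def rot_def raise_def beads_def)
  have hout: "?h j = h j" if "j < p \<or> q < j" for j
    using that pq by (auto simp: moved_heights_def moved_def rot_def raise_def beads_def)
  have pos: "h p < ?h p" using hp pq(3) by (simp add: beads_def)
  have "?h (Suc j) \<le> ?h j" for j
  proof -
    consider "Suc j < p \<or> q < j" | "Suc j = p" | "j = p" "j < q" | "p < j" "j < q" | "j = q" by linarith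
    then show ?thesis
    proof cases
      case 1
      then show ?thesis using hout[of j] hout[of "Suc j"] heights_le[OF h, of j "Suc j"] by auto
    next
      case 2
      then have "int (?h p) \<le> int (h j)" using hp pq(4) by (auto simp: beads_def)
      then show ?thesis using 2 hout[of j] by simp
    next
      case 3
      then show ?thesis using hmid[of j] pos by simp
    next
      case 4
      then obtain i where "j = Suc i" by (cases j) auto
      then show ?thesis using hmid[of j] hmid[of i] heights_le[OF h, of i j] 4 by simp
    next
      case 5
      have "?h (Suc j) = h (Suc j)" using hout 5 by simp
      moreover have "h j < ?h j"
      proof (cases "p = q")
        case False
        then obtain i where "j = Suc i" using pq 5 by (cases j) auto
        then show ?thesis using hmid[of i] heights_le[OF h, of i j] 5 pq False by simp
      qed (use pos 5 in simp)
      ultimately show ?thesis using heights_le[OF h, of j "Suc j"] by simp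
    qed
  qed
  then have "antimono ?h" by (rule decseq_SucI)
  moreover have "?h j = 0" if "N \<le> j" for j
    using hout[of j] that pq h by (simp add: heights_def)
  ultimately have h': "heights N ?h" by (simp add: heights_def)
  moreover have "ribbon_columns h ?h p q"
    using pq pos hmid hout by (simp add: ribbon_columns_def)
  ultimately show ar: "added_ribbon N h ?h p q" using h by unfold_locales
  show "card (skew_columns h ?h) = k"
  proof -
    interpret added_ribbon N h ?h p q by (fact ar)
    show ?thesis using card_eq hp pq(1) by (simp add: beads_def of_nat_diff)
  qed
qed

text \<open>A tiling grown from an arbitrary diagram, which makes it accessible to induction on the
  list. After each ribbon the bound \<open>c\<close> is set just beyond the column of its
  tail.\<close>

primrec ribbon_ext :: "nat \<Rightarrow> (nat \<Rightarrow> nat) \<Rightarrow> nat \<Rightarrow> (nat \<times> nat) set list \<Rightarrow> bool" where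
  "ribbon_ext N h c [] \<longleftrightarrow> True"
| "ribbon_ext N h c (S # T) \<longleftrightarrow> (\<exists>h'. heights N h' \<and> h \<le> h' \<and> S = skew_columns h h' \<and> ribbon S \<and>
     c \<le> snd (ribbon_tail S) \<and> ribbon_ext N h' (Suc (snd (ribbon_tail S))) T)"

definition ribbon_exts :: "nat \<Rightarrow> (nat \<Rightarrow> nat) \<Rightarrow> nat \<Rightarrow> nat list \<Rightarrow> (nat \<times> nat) set list set" where
  "ribbon_exts N h c ks = {T. ribbon_ext N h c T \<and> map card T = ks}"

lemma ribbon_exts_Nil: "ribbon_exts N h c [] = {[]}"
  by (auto simp: ribbon_exts_def)

text \<open>The column of the tail is the new rank \<open>p\<close> of the moved bead, so the bound
  on tails and the threshold of \<open>moves\<close> are the same number.\<close>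

lemma ribbon_exts_Cons:
  assumes h: "heights N h"
  shows "ribbon_exts N h c (k # ks) = (\<lambda>((p, q), T). skew_columns h (moved_heights h p q k) # T) `
    (SIGMA (p, q):moves N (beads h) c k. ribbon_exts N (moved_heights h p q k) (Suc p) ks)" (is "?L = ?R")
proof
  show "?L \<subseteq> ?R"
  proof
    fix ST assume "ST \<in> ?L"
    then obtain S T where ST: "ST = S # T" "card S = k" "map card T = ks" "ribbon_ext N h c (S # T)"
      by (auto simp: ribbon_exts_def)
    then obtain h' where H: "heights N h'" "h \<le> h'" "S = skew_columns h h'" "ribbon S"
      "c \<le> snd (ribbon_tail S)" "ribbon_ext N h' (Suc (snd (ribbon_tail S))) T" by auto
    obtain p q where "ribbon_columns h h' p q"
      using ribbon_imp_ribbon_columns[OF h H(1)] H(2-4) by (auto simp: le_fun_def)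
    then interpret added_ribbon N h h' p q using h H(1) by unfold_locales
    have e: "h' = moved_heights h p q k" using heights_eq ST(2) H(3) by simp
    have "snd (ribbon_tail S) = p" using tail H(3) by simp
    then have "(p, q) \<in> moves N (beads h) c k" "T \<in> ribbon_exts N h' (Suc p) ks"
      using moves ST H by (auto simp: ribbon_exts_def)
    then show "ST \<in> ?R" using ST(1) H(3) e by force
  qed
  show "?R \<subseteq> ?L"
  proof clarify
    fix p q T assume m: "(p, q) \<in> moves N (beads h) c k"
      and T: "T \<in> ribbon_exts N (moved_heights h p q k) (Suc p) ks"
    let ?h = "moved_heights h p q k"
    interpret added_ribbon N h ?h p q by (rule moved_heights(1)[OF h m])
    have "c \<le> p" using m by (auto simp: moves_def)
    moreover have "h \<le> ?h" using le by (simp add: le_fun_def)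
    ultimately have "ribbon_ext N h c (S # T)"
      using T h' is_ribbon tail by (auto simp: ribbon_exts_def intro!: exI[of _ ?h])
    then show "S # T \<in> ?L" using T moved_heights(2)[OF h m] by (simp add: ribbon_exts_def)
  qed
qed

text \<open>The columns met by the first ribbon form the interval from \<open>p\<close> to
  \<open>q\<close>, which determines the move.\<close>

lemma inj_on_moved_heights:
  assumes h: "heights N h"
  shows "inj_on (\<lambda>((p, q), T). skew_columns h (moved_heights h p q k) # T)
    (SIGMA (p, q):moves N (beads h) c k. X p q)"
proof (rule inj_onI)
  fix y z
  assume "y \<in> (SIGMA (p, q):moves N (beads h) c k. X p q)" "z \<in> (SIGMA (p, q):moves N (beads h) c k. X p q)"
    and yz: "(\<lambda>((p, q), T). skew_columns h (moved_heights h p q k) # T) y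
      = (\<lambda>((p, q), T). skew_columns h (moved_heights h p q k) # T) z"
  then obtain p q T p' q' T' where y: "y = ((p, q), T)" and z: "z = ((p', q'), T')"
    and m: "(p, q) \<in> moves N (beads h) c k" "(p', q') \<in> moves N (beads h) c k" by fast
  have eq: "skew_columns h (moved_heights h p q k) = skew_columns h (moved_heights h p' q' k)" "T = T'"
    using yz y z by auto
  interpret A: added_ribbon N h "moved_heights h p q k" p q by (rule moved_heights(1)[OF h m(1)])
  interpret B: added_ribbon N h "moved_heights h p' q' k" p' q' by (rule moved_heights(1)[OF h m(2)])
  have "{p..q} = {p'..q'}" unfolding A.snd_image[symmetric] B.snd_image[symmetric] eq(1) ..
  then have "p = p'" "q = q'" using A.pq B.pq by (simp_all add: Icc_eq_Icc)
  then show "y = z" using y z eq(2) by simp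
qed

lemma finite_moves: "finite (moves N b c k)"
  by (rule finite_subset[of _ "{..<N} \<times> {..<N}"]) (auto simp: moves_def)

lemma finite_ribbon_exts: "heights N h \<Longrightarrow> finite (ribbon_exts N h c ks)"
proof (induction ks arbitrary: h c)
  case Nil
  then show ?case by (simp add: ribbon_exts_Nil)
next
  case (Cons k ks)
  have "finite (ribbon_exts N (moved_heights h p q k) (Suc p) ks)"
    if "(p, q) \<in> moves N (beads h) c k" for p q
  proof -
    interpret added_ribbon N h "moved_heights h p q k" p q by (rule moved_heights(1)[OF Cons.prems that])
    show ?thesis by (rule Cons.IH[OF h'])
  qed
  then show ?case unfolding ribbon_exts_Cons[OF Cons.prems]
    by (intro finite_imageI finite_SigmaI finite_moves) auto
qed

text \<open>Both sides unfold by the same recursion over the first move. Of the exponent in the sign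
  of a ribbon, \<open>q - p\<close> matches the renumbering of the beads, and the size plus one goes
  into the global sign.\<close>

lemma sum_ribbon_exts:
  fixes x :: "nat \<Rightarrow> 'r :: comm_ring_1"
  assumes "heights N h" "0 \<notin> set ks"
  shows "(\<Sum>T\<in>ribbon_exts N h c ks. tiling_sign T * tableau_poly x M (column_diagram h \<union> \<Union> (set T)))
    = (- 1) ^ (sum_list ks + length ks) *
      (\<Sum>gs\<in>falling N (beads h) c ks. bead_poly x N M (displ (beads h) gs ks))"
  using assms
proof (induction ks arbitrary: h c)
  case Nil
  have "falling N (beads h) c [] = {[]}" by (auto simp: falling_def dlists_def dests_def)
  moreover have "displ (beads h) [] [] = (\<lambda>j. int (h j) - int j)"
    by (auto simp: displ_def bump_def beads_def)
  ultimately show ?case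
    using tableau_poly_bead_poly[OF Nil.prems(1), of x M] by (simp add: ribbon_exts_Nil tiling_sign_def)
next
  case (Cons k ks)
  note h = Cons.prems(1)
  have k: "0 < k" "0 \<notin> set ks" using Cons.prems by auto
  let ?h = "\<lambda>p q. moved_heights h p q k"
  let ?f = "\<lambda>h T. tiling_sign T * tableau_poly x M (column_diagram h \<union> \<Union> (set T))"
  have inner: "(\<Sum>T\<in>ribbon_exts N (?h p q) (Suc p) ks. ?f h (skew_columns h (?h p q) # T))
      = (- 1) ^ (sum_list (k # ks) + length (k # ks)) * ((- 1) ^ (q - p) *
        (\<Sum>gs\<in>falling N (moved (beads h) p q k) (Suc p) ks. bead_poly x N M (displ (moved (beads h) p q k) gs ks)))"
    if m: "(p, q) \<in> moves N (beads h) c k" for p q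
  proof -
    interpret added_ribbon N h "?h p q" p q by (rule moved_heights(1)[OF h m])
    have ck: "card S = k" by (rule moved_heights(2)[OF h m])
    have b: "beads (?h p q) = moved (beads h) p q k" using beads_moved ck by simp
    have "column_diagram h \<subseteq> column_diagram (?h p q)"
      using le by (auto simp: column_diagram_def intro: less_le_trans)
    then have "column_diagram h \<union> S = column_diagram (?h p q)" by (auto simp: skew_columns_def)
    then have "?f h (S # T) = ribbon_sign S * ?f (?h p q) T" for T
      by (simp add: tiling_sign_def Un_assoc[symmetric] mult.assoc)
    then have "(\<Sum>T\<in>ribbon_exts N (?h p q) (Suc p) ks. ?f h (S # T))
        = ribbon_sign S * (\<Sum>T\<in>ribbon_exts N (?h p q) (Suc p) ks. ?f (?h p q) T)"
      by (simp add: sum_distrib_left)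
    also have "\<dots> = (- 1) ^ (k + 1 + (q - p)) * ((- 1) ^ (sum_list ks + length ks) *
        (\<Sum>gs\<in>falling N (moved (beads h) p q k) (Suc p) ks. bead_poly x N M (displ (moved (beads h) p q k) gs ks)))"
      unfolding Cons.IH[OF h' k(2)] sign ck b ..
    finally show ?thesis by (simp add: power_add mult_ac)
  qed
  have "(\<Sum>T\<in>ribbon_exts N h c (k # ks). ?f h T)
      = (\<Sum>((p, q), T)\<in>(SIGMA (p, q):moves N (beads h) c k. ribbon_exts N (?h p q) (Suc p) ks).
          ?f h (skew_columns h (?h p q) # T))"
    unfolding ribbon_exts_Cons[OF h]
    by (subst sum.reindex[OF inj_on_moved_heights[OF h]]) (auto simp: comp_def split_def)
  also have "\<dots> = (\<Sum>(p, q)\<in>moves N (beads h) c k. \<Sum>T\<in>ribbon_exts N (?h p q) (Suc p) ks.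
          ?f h (skew_columns h (?h p q) # T))"
  proof -
    have "finite (ribbon_exts N (?h p q) (Suc p) ks)" if "(p, q) \<in> moves N (beads h) c k" for p q
    proof -
      interpret added_ribbon N h "?h p q" p q by (rule moved_heights(1)[OF h that])
      show ?thesis by (rule finite_ribbon_exts[OF h'])
    qed
    then show ?thesis by (subst sum.Sigma[symmetric]) (auto simp: finite_moves split_def)
  qed
  also have "\<dots> = (\<Sum>(p, q)\<in>moves N (beads h) c k. (- 1) ^ (sum_list (k # ks) + length (k # ks)) *
      ((- 1) ^ (q - p) * (\<Sum>gs\<in>falling N (moved (beads h) p q k) (Suc p) ks.
        bead_poly x N M (displ (moved (beads h) p q k) gs ks))))"
    using inner by (intro sum.cong) auto
  also have "\<dots> = (- 1) ^ (sum_list (k # ks) + length (k # ks)) *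
      (\<Sum>gs\<in>falling N (beads h) c (k # ks). bead_poly x N M (displ (beads h) gs (k # ks)))"
    using sum_falling_Cons[OF beads_less[OF h] k(1), where c = c and ks = ks and x = x and M = M]
    by (simp add: sum_distrib_left split_def)
  finally show ?case .
qed

section \<open>Labelled and unlabelled moves\<close>

text \<open>Unlabelled moves: each element pairs a bead with the amount by which it is raised, and
  no bead moves twice. Equal amounts are no longer told apart.\<close>

definition move_sets :: "nat \<Rightarrow> nat list \<Rightarrow> (nat \<times> nat) set set" where
  "move_sets N ks = {Q. finite Q \<and> inj_on fst Q \<and> fst ` Q \<subseteq> {..<N} \<and> image_mset snd (mset_set Q) = mset ks}"

lemma finite_move_sets: "finite (move_sets N ks)"
proof (rule finite_subset)
  show "move_sets N ks \<subseteq> Pow ({..<N} \<times> set ks)"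
  proof clarify
    fix Q g k assume Q: "Q \<in> move_sets N ks" and gk: "(g, k) \<in> Q"
    have "(g, k) \<in># mset_set Q" using Q gk by (simp add: move_sets_def)
    then have "snd (g, k) \<in># image_mset snd (mset_set Q)" by (metis imageI set_image_mset)
    moreover have "image_mset snd (mset_set Q) = mset ks" using Q by (simp add: move_sets_def)
    ultimately have "k \<in> set ks" by (metis set_mset_mset snd_conv)
    moreover have "fst (g, k) \<in> {..<N}" using Q gk by (force simp: move_sets_def simp del: fst_conv)
    ultimately show "g \<in> {..<N} \<and> k \<in> set ks" by simp
  qed
qed simp

lemma set_zip_move_sets:
  assumes "gs \<in> dlists N (length ks)"
  shows "set (zip gs ks) \<in> move_sets N ks"
proof -
  have g: "distinct gs" "length gs = length ks" "set gs \<subseteq> {..<N}" using assms by (auto simp: dlists_def)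
  have "distinct (zip gs ks)" using g(1) by (rule distinct_zipI1)
  then have "mset_set (set (zip gs ks)) = mset (zip gs ks)" by (rule mset_set_set)
  then have "image_mset snd (mset_set (set (zip gs ks))) = mset (map snd (zip gs ks))" by simp
  also have "\<dots> = mset ks" using g(2) by simp
  finally have "image_mset snd (mset_set (set (zip gs ks))) = mset ks" .
  moreover have "inj_on fst (set (zip gs ks))"
    using g by (auto simp: inj_on_def set_zip nth_eq_iff_index_eq)
  moreover have "fst ` set (zip gs ks) \<subseteq> {..<N}" using g(3) by (auto dest: set_zip_leftD)
  ultimately show ?thesis by (simp add: move_sets_def)
qed

text \<open>The first amount \<open>k\<close> may be assigned to any of the beads that
  \<open>Q\<close> raises by \<open>k\<close>; there are as many of them as occurrences of
  \<open>k\<close> in the list, and the induction builds up the factorials.\<close>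

lemma card_labellings:
  assumes "Q \<in> move_sets N ks"
  shows "card {gs \<in> dlists N (length ks). set (zip gs ks) = Q} = (\<Prod>i\<in>set ks. fact (count_list ks i))"
  using assms
proof (induction ks arbitrary: Q)
  case Nil
  then have "Q = {}" by (auto simp: move_sets_def mset_set_empty_iff)
  then have "{gs \<in> dlists N (length []). set (zip gs []) = Q} = {[]}" by (auto simp: dlists_def)
  then show ?case by simp
next
  case (Cons k ks)
  let ?A = "{g. (g, k) \<in> Q}" and ?L = "\<lambda>ks Q. {gs \<in> dlists N (length ks). set (zip gs ks) = Q}"
  have Q: "finite Q" "inj_on fst Q" "fst ` Q \<subseteq> {..<N}" "image_mset snd (mset_set Q) = mset (k # ks)"
    using Cons.prems by (auto simp: move_sets_def)
  have A: "?A = fst ` {q \<in> Q. snd q = k}" by force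
  have "count (image_mset snd (mset_set Q)) k = card {q \<in> Q. snd q = k}"
    using Q(1) by (simp add: count_image_mset' flip: sum.inter_filter) (auto intro!: arg_cong[of _ _ card])
  then have cA: "card ?A = count_list (k # ks) k"
    unfolding A Q(4) using inj_on_subset[OF Q(2)] by (subst card_image) (auto simp: count_mset)
  have finA: "finite ?A" unfolding A using Q(1) by simp
  have QA: "Q - {(g, k)} \<in> move_sets N ks" if "g \<in> ?A" for g
  proof -
    have "mset_set Q = add_mset (g, k) (mset_set (Q - {(g, k)}))"
      using that Q(1) by (simp add: mset_set.remove)
    then have "image_mset snd (mset_set (Q - {(g, k)})) = mset ks" using Q(4) by simp
    then show ?thesis using Q by (auto simp: move_sets_def intro: inj_on_subset)
  qed
  have "bij_betw (\<lambda>(g, gs). g # gs) (SIGMA g:?A. ?L ks (Q - {(g, k)})) (?L (k # ks) Q)"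
  proof (rule bij_betwI[where g = "\<lambda>l. (hd l, tl l)"])
    show "(\<lambda>(g, gs). g # gs) \<in> (SIGMA g:?A. ?L ks (Q - {(g, k)})) \<rightarrow> ?L (k # ks) Q"
    proof
      fix y assume "y \<in> (SIGMA g:?A. ?L ks (Q - {(g, k)}))"
      then obtain g gs where y: "y = (g, gs)" and *: "(g, k) \<in> Q" "length gs = length ks"
        "set (zip gs ks) = Q - {(g, k)}" "distinct gs" "set gs \<subseteq> {..<N}"
        by (auto simp: dlists_def)
      have "g \<notin> set gs"
      proof
        assume "g \<in> set gs"
        then have "g \<in> fst ` set (zip gs ks)" using *(2) by (metis map_fst_zip set_map)
        then obtain q where "q \<in> Q - {(g, k)}" "fst q = g" using *(3) by (metis imageE)
        then show False using inj_onD[OF Q(2), of q "(g, k)"] *(1) by auto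
      qed
      moreover have "g < N" using *(1) Q(3) by force
      moreover have "insert (g, k) (Q - {(g, k)}) = Q" using *(1) by blast
      ultimately show "(\<lambda>(g, gs). g # gs) y \<in> ?L (k # ks) Q" using * y by (simp add: dlists_def)
    qed
    show "(\<lambda>l. (hd l, tl l)) \<in> ?L (k # ks) Q \<rightarrow> (SIGMA g:?A. ?L ks (Q - {(g, k)}))"
    proof
      fix l assume l: "l \<in> ?L (k # ks) Q"
      then obtain g gs where e: "l = g # gs" by (cases l) (auto simp: dlists_def)
      then have "(g, k) \<notin> set (zip gs ks)" using l by (auto simp: dlists_def dest: set_zip_leftD)
      then show "(hd l, tl l) \<in> (SIGMA g:?A. ?L ks (Q - {(g, k)}))" using l e by (auto simp: dlists_def)
    qed
  qed (auto simp: dlists_def length_Suc_conv)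
  then have "card (?L (k # ks) Q) = card (SIGMA g:?A. ?L ks (Q - {(g, k)}))"
    by (simp add: bij_betw_same_card)
  also have "\<dots> = (\<Sum>g\<in>?A. card (?L ks (Q - {(g, k)})))"
    by (rule card_SigmaI[OF finA]) (auto intro: finite_subset[OF _ finite_dlists])
  also have "\<dots> = (\<Sum>g\<in>?A. \<Prod>i\<in>set ks. fact (count_list ks i))"
    using Cons.IH[OF QA] by (intro sum.cong) auto
  also have "\<dots> = count_list (k # ks) k * (\<Prod>i\<in>set ks. fact (count_list ks i))"
    unfolding sum_constant cA by simp
  also have "(\<Prod>i\<in>set ks. fact (count_list ks i)) = (\<Prod>i\<in>insert k (set ks). fact (count_list ks i) :: nat)"
    by (rule prod.mono_neutral_left) auto
  also have "\<dots> = fact (count_list ks k) * (\<Prod>i\<in>insert k (set ks) - {k}. fact (count_list ks i))"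
    by (rule prod.remove) auto
  also have "(\<Prod>i\<in>insert k (set ks) - {k}. fact (count_list ks i) :: nat)
      = (\<Prod>i\<in>insert k (set ks) - {k}. fact (count_list (k # ks) i))"
    by (rule prod.cong) auto
  also have "count_list (k # ks) k * (fact (count_list ks k) *
        (\<Prod>i\<in>insert k (set ks) - {k}. fact (count_list (k # ks) i)))
      = fact (count_list (k # ks) k) * (\<Prod>i\<in>insert k (set ks) - {k}. fact (count_list (k # ks) i))"
    by (simp add: algebra_simps)
  also have "\<dots> = (\<Prod>i\<in>insert k (set ks). fact (count_list (k # ks) i))"
    by (rule prod.remove[symmetric]) auto
  finally show ?case by simp
qed

lemma sum_dlists_move_sets:
  "(\<Sum>gs\<in>dlists N (length ks). G (set (zip gs ks)))
    = of_nat (\<Prod>i\<in>set ks. fact (count_list ks i)) * (\<Sum>Q\<in>move_sets N ks. G Q :: 'r :: comm_ring_1)"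
proof -
  have "(\<Sum>gs\<in>dlists N (length ks). G (set (zip gs ks)))
      = (\<Sum>Q\<in>move_sets N ks. \<Sum>gs | gs \<in> dlists N (length ks) \<and> set (zip gs ks) = Q. G (set (zip gs ks)))"
    by (rule sum.group[symmetric]) (auto simp: finite_dlists finite_move_sets set_zip_move_sets)
  also have "\<dots> = (\<Sum>Q\<in>move_sets N ks. of_nat (\<Prod>i\<in>set ks. fact (count_list ks i)) * G Q)"
  proof (rule sum.cong[OF refl])
    fix Q assume Q: "Q \<in> move_sets N ks"
    have "(\<Sum>gs | gs \<in> dlists N (length ks) \<and> set (zip gs ks) = Q. G (set (zip gs ks)))
        = (\<Sum>gs | gs \<in> dlists N (length ks) \<and> set (zip gs ks) = Q. G Q)"
      by (rule sum.cong) auto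
    then show "(\<Sum>gs | gs \<in> dlists N (length ks) \<and> set (zip gs ks) = Q. G (set (zip gs ks)))
        = of_nat (\<Prod>i\<in>set ks. fact (count_list ks i)) * G Q"
      using card_labellings[OF Q] by simp
  qed
  finally show ?thesis by (simp add: sum_distrib_left)
qed

lemma sorted_wrt_set_unique:
  assumes "\<And>a b. R a b \<Longrightarrow> \<not> R b a" "sorted_wrt R xs" "sorted_wrt R ys" "set xs = set ys"
  shows "xs = ys"
  using assms(2-4)
proof (induction xs arbitrary: ys)
  case (Cons a xs)
  then obtain b ys' where ys: "ys = b # ys'" by (cases ys) auto
  have ab: "a = b"
  proof (rule ccontr)
    assume "a \<noteq> b"
    then have "a \<in> set ys'" "b \<in> set xs" using Cons.prems(3) ys by auto
    then show False using Cons.prems(1,2) ys assms(1) by auto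
  qed
  have "a \<notin> set xs" "b \<notin> set ys'" using Cons.prems(1,2) ys assms(1) by auto
  then have "set xs = set ys'" using Cons.prems(3) ys ab by auto
  then show ?case using Cons.IH[of ys'] Cons.prems ys ab by simp
qed simp

definition dest :: "nat \<times> nat \<Rightarrow> int" where
  "dest q = int (snd q) - int (fst q)"

lemma sorted_wrt_inj_on: "sorted_wrt (\<lambda>a b. (f b :: 'b :: order) < f a) xs \<Longrightarrow> inj_on f (set xs)"
  by (induction xs) (auto dest: less_imp_neq)

lemma falling_ground:
  "falling N ground_state 0 ks
    = {gs \<in> dlists N (length ks). sorted_wrt (\<lambda>a b. dest b < dest a) (zip gs ks)}"
proof -
  have "dests ground_state gs ks = map dest (zip gs ks)" for gs
    by (auto simp: dests_def dest_def)
  then show ?thesis by (simp add: falling_def sorted_wrt_map)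
qed

lemma bead_poly_move_set_zero:
  assumes "Q \<in> move_sets N ks" "\<not> inj_on dest Q"
  shows "bead_poly x N M (\<lambda>c. ground_state c + bump Q c) = 0"
proof -
  have Q: "finite Q" "inj_on fst Q" "fst ` Q \<subseteq> {..<N}" using assms(1) by (auto simp: move_sets_def)
  have b: "ground_state (fst q) + bump Q (fst q) = dest q" if "q \<in> Q" for q
  proof -
    have "bump Q (fst q) = (\<Sum>r\<in>{q}. if fst r = fst q then int (snd r) else 0)"
      unfolding bump_def using that Q by (intro sum.mono_neutral_right) (auto simp: inj_on_def)
    then show ?thesis by (simp add: dest_def)
  qed
  obtain q r where qr: "q \<in> Q" "r \<in> Q" "q \<noteq> r" "dest q = dest r" using assms(2) by (auto simp: inj_on_def)
  then have "fst q \<noteq> fst r" using Q(2) by (auto simp: inj_on_def)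
  then show ?thesis using qr b Q(3) by (intro bead_poly_repeated[of "fst q" N "fst r"]) auto
qed

text \<open>Sorting a set of moves by decreasing destinations is possible in exactly one way if
  these are distinct. It determines the list of beads together with the rearrangement of
  \<open>mu\<close>, so every such set is counted once.\<close>

lemma sum_falling_move_sets:
  assumes "\<And>Q. Q \<in> move_sets N mu \<Longrightarrow> \<not> inj_on dest Q \<Longrightarrow> G Q = 0"
  shows "(\<Sum>ks\<in>permutations_of_multiset (mset mu). \<Sum>gs\<in>falling N ground_state 0 ks. G (set (zip gs ks)))
    = (\<Sum>Q\<in>move_sets N mu. G Q)"
proof -
  let ?P = "permutations_of_multiset (mset mu)"
  let ?X = "SIGMA ks:?P. falling N ground_state 0 ks"
  let ?f = "\<lambda>(ks, gs). set (zip gs ks)"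
  let ?srt = "sorted_wrt (\<lambda>a b. dest b < dest a)"
  have fin: "finite (falling N b c ks)" for b c ks
    by (rule finite_subset[OF _ finite_dlists]) (auto simp: falling_def)
  have inj: "inj_on ?f ?X"
  proof (rule inj_onI)
    fix y z assume "y \<in> ?X" "z \<in> ?X" and e: "?f y = ?f z"
    then obtain ks gs ks' gs' where y: "y = (ks, gs)" "gs \<in> falling N ground_state 0 ks"
      and z: "z = (ks', gs')" "gs' \<in> falling N ground_state 0 ks'" by auto
    have "zip gs ks = zip gs' ks'"
      by (rule sorted_wrt_set_unique[of "\<lambda>a b. dest b < dest a"]) (use y z e in \<open>auto simp: falling_ground\<close>)
    moreover have "length gs = length ks" "length gs' = length ks'" using y z by (auto simp: falling_ground dlists_def)
    ultimately show "y = z" using y z by (metis map_fst_zip map_snd_zip)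
  qed
  have img: "?f ` ?X = {Q \<in> move_sets N mu. inj_on dest Q}"
  proof
    show "?f ` ?X \<subseteq> {Q \<in> move_sets N mu. inj_on dest Q}"
    proof clarsimp
      fix ks gs assume ks: "ks \<in> ?P" and "gs \<in> falling N ground_state 0 ks"
      then have gs: "gs \<in> dlists N (length ks)" "?srt (zip gs ks)" by (auto simp: falling_ground)
      have "mset ks = mset mu" using ks by (rule permutations_of_multisetD)
      then have "set (zip gs ks) \<in> move_sets N mu"
        using set_zip_move_sets[OF gs(1)] by (simp add: move_sets_def)
      moreover have "inj_on dest (set (zip gs ks))"
        by (rule sorted_wrt_inj_on[OF gs(2)])
      ultimately show "set (zip gs ks) \<in> move_sets N mu \<and> inj_on dest (set (zip gs ks))" by simp
    qed
    show "{Q \<in> move_sets N mu. inj_on dest Q} \<subseteq> ?f ` ?X"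
    proof clarify
      fix Q assume Q: "Q \<in> move_sets N mu" and injd: "inj_on dest Q"
      have q: "finite Q" "inj_on fst Q" "fst ` Q \<subseteq> {..<N}" "image_mset snd (mset_set Q) = mset mu"
        using Q by (auto simp: move_sets_def)
      \<comment> \<open>The destinations in decreasing order; pulled back along the injective
        \<open>dest\<close> they list the moves of \<open>Q\<close>.\<close>
      define D where "D = rev (sorted_list_of_set (dest ` Q))"
      define L where "L = map (inv_into Q dest) D"
      have sD: "set D = dest ` Q" using q(1) by (simp add: D_def)
      have setL: "set L = Q" using injd by (simp add: L_def sD)
      have mapL: "map dest L = D" using sD by (auto simp: L_def comp_def f_inv_into_f intro!: map_idI)
      have "sorted_wrt (>) D" by (simp add: D_def sorted_wrt_rev strict_sorted_list_of_set)
      then have srt: "?srt L" unfolding mapL[symmetric] sorted_wrt_map .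
      have "distinct D" by (simp add: D_def)
      then have dL: "distinct L" using mapL by (metis distinct_map)
      have "mset L = mset_set Q" using dL setL by (metis mset_set_set)
      then have "map snd L \<in> ?P" using q(4) by (intro permutations_of_multisetI) simp
      moreover have "map fst L \<in> falling N ground_state 0 (map snd L)"
        using srt q(2,3) dL setL by (simp add: falling_ground dlists_def distinct_map zip_map_fst_snd)
      ultimately have "(map snd L, map fst L) \<in> ?X" by simp
      moreover have "?f (map snd L, map fst L) = Q" using setL by (simp add: zip_map_fst_snd)
      ultimately show "Q \<in> ?f ` ?X" by (metis imageI)
    qed
  qed
  have "(\<Sum>ks\<in>?P. \<Sum>gs\<in>falling N ground_state 0 ks. G (set (zip gs ks))) = (\<Sum>y\<in>?X. G (?f y))"
    by (subst sum.Sigma) (auto simp: fin split_def)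
  also have "\<dots> = (\<Sum>Q\<in>?f ` ?X. G Q)" by (subst sum.reindex[OF inj]) simp
  also have "\<dots> = (\<Sum>Q\<in>move_sets N mu. G Q)"
    unfolding img using assms by (intro sum.mono_neutral_left finite_move_sets) auto
  finally show ?thesis .
qed

section \<open>Monotonic tilings\<close>

text \<open>In the induction the first ribbon is absorbed into the base diagram, which turns
  disjointness from this ribbon into disjointness from the new base.\<close>

lemma ribbon_extI:
  assumes "heights N h" "\<forall>i\<le>length T. \<exists>h'. heights N h' \<and> column_diagram h \<union> \<Union> (set (take i T)) = column_diagram h'"
    and "\<forall>S\<in>set T. ribbon S \<and> S \<inter> column_diagram h = {} \<and> c \<le> snd (ribbon_tail S)"
    and "sorted_wrt (\<lambda>S S'. S \<inter> S' = {}) T" "sorted_wrt (<) (map (\<lambda>S. snd (ribbon_tail S)) T)"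
  shows "ribbon_ext N h c T"
  using assms
proof (induction T arbitrary: h c)
  case (Cons S T)
  obtain h' where h': "heights N h'" "column_diagram h \<union> S = column_diagram h'"
    using Cons.prems(2)[rule_format, of 1] by auto
  have S: "S = skew_columns h h'" using h'(2) Cons.prems(3) by (auto simp: skew_columns_def)
  have "h j \<le> h' j" for j
  proof (rule ccontr)
    assume "\<not> h j \<le> h' j"
    then have "(h' j, j) \<in> column_diagram h" "(h' j, j) \<notin> column_diagram h'"
      by (auto simp: column_diagram_def)
    then show False using h'(2) by blast
  qed
  then have "h \<le> h'" by (simp add: le_fun_def)
  moreover have "ribbon_ext N h' (Suc (snd (ribbon_tail S))) T"
  proof (rule Cons.IH[OF h'(1)])
    show "\<forall>i\<le>length T. \<exists>h''. heights N h'' \<and> column_diagram h' \<union> \<Union> (set (take i T)) = column_diagram h''"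
    proof (intro allI impI)
      fix i assume "i \<le> length T"
      then show "\<exists>h''. heights N h'' \<and> column_diagram h' \<union> \<Union> (set (take i T)) = column_diagram h''"
        using Cons.prems(2)[rule_format, of "Suc i"] by (simp add: h'(2)[symmetric] Un_assoc)
    qed
    show "\<forall>S'\<in>set T. ribbon S' \<and> S' \<inter> column_diagram h' = {} \<and> Suc (snd (ribbon_tail S)) \<le> snd (ribbon_tail S')"
      using Cons.prems(3-5) unfolding h'(2)[symmetric] by (auto simp: Suc_le_eq)
  qed (use Cons.prems in auto)
  ultimately show ?case using Cons.prems(3) h'(1) S by auto
qed simp

lemma ribbon_extD:
  assumes "heights N h" "ribbon_ext N h c T"
  shows "(\<forall>i\<le>length T. \<exists>h'. heights N h' \<and> column_diagram h \<union> \<Union> (set (take i T)) = column_diagram h') \<and>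
    (\<forall>S\<in>set T. ribbon S \<and> S \<inter> column_diagram h = {} \<and> c \<le> snd (ribbon_tail S)) \<and>
    sorted_wrt (\<lambda>S S'. S \<inter> S' = {}) T \<and> sorted_wrt (<) (map (\<lambda>S. snd (ribbon_tail S)) T)"
  using assms
proof (induction T arbitrary: h c)
  case Nil
  then show ?case by auto
next
  case (Cons S T)
  let ?t = "snd (ribbon_tail S)"
  obtain h' where h': "heights N h'" "h \<le> h'" "S = skew_columns h h'" "ribbon S" "c \<le> ?t"
    "ribbon_ext N h' (Suc ?t) T" using Cons.prems(2) by auto
  have sub: "column_diagram h \<subseteq> column_diagram h'"
    using h'(2) by (auto simp: column_diagram_def le_fun_def intro: less_le_trans)
  then have U: "column_diagram h \<union> S = column_diagram h'" using h'(3) by (auto simp: skew_columns_def)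
  have dS: "S \<inter> column_diagram h = {}" using h'(3) by (auto simp: skew_columns_def)
  note IH = Cons.IH[OF h'(1,6)]
  have "\<exists>h''. heights N h'' \<and> column_diagram h \<union> \<Union> (set (take i (S # T))) = column_diagram h''"
    if "i \<le> length (S # T)" for i
  proof (cases i)
    case 0
    then show ?thesis using Cons.prems(1) by auto
  next
    case (Suc i')
    then have "i' \<le> length T" using that by simp
    then show ?thesis using IH Suc by (simp add: Un_assoc[symmetric] U)
  qed
  moreover have "S' \<inter> column_diagram h = {}" "S \<inter> S' = {}" "?t < snd (ribbon_tail S')" "ribbon S'"
    if "S' \<in> set T" for S'
  proof -
    have "ribbon S' \<and> S' \<inter> column_diagram h' = {} \<and> Suc ?t \<le> snd (ribbon_tail S')" using IH that by blast
    then show "S' \<inter> column_diagram h = {}" "S \<inter> S' = {}" "?t < snd (ribbon_tail S')" "ribbon S'"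
      using U by auto
  qed
  ultimately show ?case using IH dS h'(4,5) by fastforce
qed

lemma column_diagram_0: "column_diagram (\<lambda>_. 0) = {}"
  by (simp add: column_diagram_def)

lemma heights_0: "heights N (\<lambda>_. 0)"
  by (simp add: heights_def antimono_def monotone_def)

text \<open>The width \<open>sum_list mu\<close> suffices for every intermediate shape, because such
  a shape has at most as many cells as the whole tiling and at most as many columns as
  cells.\<close>

lemma monotonic_tilings_eq:
  "monotonic_tilings_of_type mu
    = (\<Union>ks\<in>permutations_of_multiset (mset mu). ribbon_exts (sum_list mu) (\<lambda>_. 0) 0 ks)"
proof -
  let ?N = "sum_list mu"
  have "monotonic_ribbon_tiling lam T \<Longrightarrow> ribbon_ext ?N (\<lambda>_. 0) 0 T"
    if m: "mset (map card T) = mset mu" for lam T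
  proof (rule ribbon_extI)
    assume t: "monotonic_ribbon_tiling lam T"
    then have dj: "sorted_wrt (\<lambda>S S'. S \<inter> S' = {}) T" and U: "\<Union> (set T) = young_diagram lam"
      and lam: "is_partition lam"
      by (auto simp: monotonic_ribbon_tiling_def)
    have fin: "\<forall>S\<in>set T. finite S" using U finite_young_diagram[of lam] by (metis Union_upper finite_subset)
    have "card (\<Union> (set T)) = sum_list (map card T)" using dj fin
    proof (induction T)
      case (Cons S T)
      have "S \<inter> \<Union> (set T) = {}" using Cons.prems by auto
      then show ?case using Cons by (simp add: card_Un_disjoint)
    qed simp
    also have "\<dots> = ?N" using m by (metis sum_mset_sum_list)
    finally have cU: "card (\<Union> (set T)) = ?N" .
    show "\<forall>i\<le>length T. \<exists>h'. heights ?N h' \<and> column_diagram (\<lambda>_. 0) \<union> \<Union> (set (take i T)) = column_diagram h'"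
    proof (intro allI impI)
      fix i assume "i \<le> length T"
      then obtain nu where nu: "is_partition nu" "\<Union> (set (take i T)) = young_diagram nu"
        using t by (auto simp: monotonic_ribbon_tiling_def)
      have "sum_list nu = card (\<Union> (set (take i T)))" by (simp add: nu(2) card_young_diagram)
      also have "\<dots> \<le> card (\<Union> (set T))"
        by (rule card_mono) (use fin in \<open>auto dest: in_set_takeD\<close>)
      finally have "sum_list nu \<le> ?N" by (simp add: cU)
      then show "\<exists>h'. heights ?N h' \<and> column_diagram (\<lambda>_. 0) \<union> \<Union> (set (take i T)) = column_diagram h'"
        using young_diagram_heights[OF nu(1)] nu(2) heights_mono by (metis column_diagram_0 Un_empty_left)
    qed
  qed (auto simp: monotonic_ribbon_tiling_def column_diagram_0 heights_0)
  moreover have "\<exists>lam. monotonic_ribbon_tiling lam T" if T: "ribbon_ext ?N (\<lambda>_. 0) 0 T" for T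
  proof -
    note D = ribbon_extD[OF heights_0 T, unfolded column_diagram_0 Un_empty_left]
    have P: "\<exists>nu. is_partition nu \<and> \<Union> (set (take i T)) = young_diagram nu" if "i \<le> length T" for i
      using D that column_diagram_partition by metis
    then obtain lam where "is_partition lam" "\<Union> (set T) = young_diagram lam"
      using P[of "length T"] by auto
    then have "monotonic_ribbon_tiling lam T" using D P by (auto simp: monotonic_ribbon_tiling_def)
    then show ?thesis ..
  qed
  ultimately show ?thesis
    by (auto simp: monotonic_tilings_of_type_def ribbon_exts_def permutations_of_multiset_def)
qed

lemma young_diagram_tiling_shape:
  "T \<in> monotonic_tilings_of_type mu \<Longrightarrow> young_diagram (tiling_shape T) = \<Union> (set T)"
  using tiling_shape_eq by (auto simp: monotonic_tilings_of_type_def monotonic_ribbon_tiling_def)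

lemma mv_trunc_tiling_sign: "mv_trunc M (tiling_sign T * f) = tiling_sign T * mv_trunc M f"
  by (induction T arbitrary: f)
     (simp_all add: tiling_sign_def ribbon_sign_def mult.assoc mv_trunc_minus_one_power)

theorem theorem5p12:
  fixes n :: nat and mu I J :: "nat list"
  assumes "mu \<in> partitions_of n" and "path_pair n mu I J"
  shows "(path_power_sum n I J :: 'a :: field_char_0 mvfps) =
    of_nat (\<Prod>i \<in> set mu. fact (count_list mu i)) *
      (\<Sum>T \<in> monotonic_tilings_of_type mu. tiling_sign T * schur (tiling_shape T))"
proof (rule mv_trunc_eqI)
  fix M
  let ?N = "sum_list mu" and ?m = "\<Prod>i \<in> set mu. fact (count_list mu i) :: nat"
  let ?P = "permutations_of_multiset (mset mu)" and ?s = "(- 1 :: 'a mvfps) ^ (sum_list mu + length mu)"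
  \<comment> \<open>The two sides meet in the sum of \<open>?G\<close> over the sets of moves:
    tilings reach it through the decreasing order, the path power sum through labelled
    lists.\<close>
  let ?G = "\<lambda>Q. bead_poly mv_var ?N M (\<lambda>c. ground_state c + bump Q c) :: 'a mvfps"
  have nz: "0 \<notin> set mu" using assms(1) by (auto simp: partitions_of_def is_partition_def)
  have disp: "displ ground_state gs ks = (\<lambda>c. ground_state c + bump (set (zip gs ks)) c)" for gs ks
    by (auto simp: displ_def)
  have zero: "?G Q = 0" if "Q \<in> move_sets ?N mu" "\<not> inj_on dest Q" for Q
    by (rule bead_poly_move_set_zero[OF that])
  have b0: "beads (\<lambda>_. 0) = ground_state" by (auto simp: beads_def)
  have "mv_trunc M (\<Sum>T\<in>monotonic_tilings_of_type mu. tiling_sign T * schur (tiling_shape T))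
      = (\<Sum>T\<in>monotonic_tilings_of_type mu. tiling_sign T * tableau_poly mv_var M (\<Union> (set T)) :: 'a mvfps)"
    unfolding mv_trunc_sum mv_trunc_tiling_sign mv_trunc_schur
    by (intro sum.cong) (auto simp: young_diagram_tiling_shape)
  also have "\<dots> = (\<Sum>ks\<in>?P. \<Sum>T\<in>ribbon_exts ?N (\<lambda>_. 0) 0 ks. tiling_sign T * tableau_poly mv_var M (\<Union> (set T)))"
    unfolding monotonic_tilings_eq
    by (rule sum.UNION_disjoint) (auto simp: finite_ribbon_exts[OF heights_0], auto simp: ribbon_exts_def)
  also have "\<dots> = (\<Sum>ks\<in>?P. ?s * (\<Sum>gs\<in>falling ?N ground_state 0 ks. ?G (set (zip gs ks))))"
  proof (rule sum.cong[OF refl])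
    fix ks assume "ks \<in> ?P"
    then have ks: "mset ks = mset mu" by (rule permutations_of_multisetD)
    then have "0 \<notin> set ks" "sum_list ks = sum_list mu" "length ks = length mu"
      using nz by (metis mset_eq_setD, metis sum_mset_sum_list, metis mset_eq_length)
    then show "(\<Sum>T\<in>ribbon_exts ?N (\<lambda>_. 0) 0 ks. tiling_sign T * tableau_poly mv_var M (\<Union> (set T)))
        = ?s * (\<Sum>gs\<in>falling ?N ground_state 0 ks. ?G (set (zip gs ks)))"
      using sum_ribbon_exts[OF heights_0[of ?N], where ks = ks and c = 0 and x = mv_var and M = M] by (simp add: column_diagram_0 b0 disp)
  qed
  also have "\<dots> = ?s * (\<Sum>Q\<in>move_sets ?N mu. ?G Q)"
    unfolding sum_distrib_left[symmetric]
    by (rule arg_cong[where f = "\<lambda>z. ?s * z"], rule sum_falling_move_sets[of ?N mu ?G, OF zero])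
  finally have R: "mv_trunc M (\<Sum>T\<in>monotonic_tilings_of_type mu. tiling_sign T * schur (tiling_shape T) :: 'a mvfps)
      = ?s * (\<Sum>Q\<in>move_sets ?N mu. ?G Q)" .
  have "mv_trunc M (path_power_sum n I J :: 'a mvfps) = path_poly (\<lambda>k. \<Sum>j<M. mv_var j ^ k) mu"
    unfolding path_power_sum_eq_path_poly[OF assms(2)] by (rule mv_trunc_path_poly[OF nz])
  also have "\<dots> = ?s * bead_sum mv_var ?N M mu" by (rule path_poly_power_sums[OF order_refl nz])
  \<comment> \<open>A set of moves is counted once for every way to permute its equal parts among
    the labels, which is the origin of the factor \<open>?m\<close>.\<close>
  also have "bead_sum mv_var ?N M mu = of_nat ?m * (\<Sum>Q\<in>move_sets ?N mu. ?G Q)"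
    unfolding bead_sum_def disp by (rule sum_dlists_move_sets)
  finally show "mv_trunc M (path_power_sum n I J :: 'a mvfps) = mv_trunc M (of_nat ?m *
      (\<Sum>T\<in>monotonic_tilings_of_type mu. tiling_sign T * schur (tiling_shape T)))"
    unfolding mv_trunc_mult mv_trunc_of_nat R by (simp only: mult.left_commute)
qed

end
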